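(* Consider the block-issuance model described in the context, with $k\ge2$. There exist integrable random variables $X_\infty^{(o)}$ and $X_\infty^{(i)}$, $i\in\mathcal N$, such that, as $n\to\infty$, \[ X_n^{(o)}\Longrightarrow X_\infty^{(o)},\qquad X_n^{(i)}\Longrightarrow X_\infty^{(i)},\quad i\in\mathcal N, \] (convergence in distribution) and, with $\mu^{(o)}:=\mathbb E[X_\infty^{(o)}]$ and $\mu^{(i)}:=\mathbb E[X_\infty^{(i)}]$, \[ \frac1n\sum_{m=1}^nX_m^{(o)}\longrightarrow\mu^{(o)},\qquad\frac1n\sum_{m=1}^nX_m^{(i)}\longrightarrow\mu^{(i)},\quad i\in\mathcal N, \] almost surely.
   Context: **Model.** Let $\mathcal N=\{1,\dots,N\}$ be a finite set of nodes, $k\ge2$ an integer, $\lambda>0$ and $0\le\Delta<\infty$. Blocks are issued at times $0<t_1<t_2<\cdots$ forming a homogeneous Poisson process on $\mathbb R_+$ with rate $\lambda$; put $t_0:=0$. Block $n\ge1$, issued at $t_n$, carries a mark $\kappa_n=(\mathrm{blockID}_n,\mathrm{Ref}_n,\mathrm{nodeID}_n,\mathrm{delay}_n)$, where: - $\mathrm{blockID}_n$ are i.i.d. $\mathrm{Unif}[0,1]$, independent of the Poisson process (hence a.s. distinct); blocks are identified with their identifiers; - the issuers $\mathrm{nodeID}_n$ are i.i.d. $\mathcal N$-valued, independent of everything else; - $\mathrm{delay}_n=(\mathrm{delay}_n(j))_{j\in\mathcal N}$, where $\mathrm{delay}_n(j)\ge0$ is the time after $t_n$ until node $j$ receives block $n$.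 Delays are i.i.d. across blocks: if the issuer is $i$, the vector is drawn from a law depending only on $i$, with $j$-th coordinate distributed as $\Delta_i(j)$, and $\mathrm{delay}_n(i)=0$ for the issuer $i$. Conditional on $(t_m,\mathrm{blockID}_m,\mathrm{nodeID}_m)_{m\le n}$, $\mathrm{delay}_n$ is independent of the past. Partial synchrony: $\mathbb P(\Delta_i(j)\le\Delta)=1$ for all $i,j\in\mathcal N$; - $\mathrm{Ref}_n$ is the list of earlier blocks referenced by block $n$, defined below. There is a genesis block $\star$, visible to all nodes from time $0$. Messages with arrival time at most $t_n$ are processed before block $n$ is issued. For $i\in\mathcal N$, the pre-issuance local tip pool is \[\mathrm{pool}_n^-(i)=\Bigl(\{\star\}\cup\{\mathrm{blockID}_m: m<n,\ t_m+\mathrm{delay}_m(i)\le t_n\}\Bigr)\setminus\bigcup_{m<n:\,t_m+\mathrm{delay}_m(i)\le t_n}\{\text{entries of }\mathrm{Ref}_m\}.\] $\mathrm{Ref}_n$ consists of $\min\{k,|\mathrm{pool}_n^-(\mathrm{nodeID}_n)|\}$ distinct elements sampled uniformly without replacement from $\mathrm{pool}_n^-(\mathrm{nodeID}_n)$. The post-issuance local tip pool $\mathrm{pool}_n(i)$ is defined by the same formula with $m<n$ replaced by $m\le n$. The observer tip pool is $\mathrm{pool}_n^{(o)}=\bigl(\{\star\}\cup\{\mathrm{blockID}_1,\dots,\mathrm{blockID}_n\}\bigr)\setminus\bigcup_{m=1}^n\{\text{entries of }\mathrm{Ref}_m\}$. At $n=0$ all pools equal $\{\star\}$. Put $X_n^{(o)}=|\mathrm{pool}_n^{(o)}|$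 and $X_n^{(i)}=|\mathrm{pool}_n(i)|$. *)

theory Defs
  imports "HOL-Probability.Probability"
begin

text \<open>
  A block is identified with its real identifier; the genesis block carries none.
  A list of references is made a measurable object through its coordinates: the
  \<sigma>-algebra on lists is the one of the disjoint union of the finite powers of the
  space of blocks.
\<close>

datatype block = Genesis | Block real

definition block_space :: "block measure" where
  "block_space = sigma UNIV {A. Block -` A \<in> sets borel}"

definition ref_space :: "block list measure" where
  "ref_space = sigma UNIV {{xs. i < length xs \<and> xs ! i \<in> A} | i A. A \<in> sets block_space}"

text \<open>
  Conventions: \<^term>\<open>t n \<omega>\<close>, \<^term>\<open>bid n \<omega>\<close>, \<^term>\<open>issuer n \<omega>\<close>,
  \<^term>\<open>delay n \<omega> $ j\<close> and \<^term>\<open>ref n \<omega>\<close> are the issue time, the identifier, the issuing node,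
  the delay towards node \<^term>\<open>j\<close> and the reference list of block \<open>n \<ge> 1\<close>. Index 0 is used only
  for \<open>t\<^sub>0 = 0\<close>. The nodes are the elements of an arbitrary finite type.
\<close>

text \<open>The pool obtained from the genesis block and the blocks with index in \<^term>\<open>J\<close>:\<close>

definition tips :: "(nat \<Rightarrow> 'a \<Rightarrow> real) \<Rightarrow> (nat \<Rightarrow> 'a \<Rightarrow> block list) \<Rightarrow> nat set \<Rightarrow> 'a \<Rightarrow> block set" where
  "tips bid ref J \<omega> = ({Genesis} \<union> {Block (bid m \<omega>) | m. m \<in> J}) - (\<Union>m\<in>J. set (ref m \<omega>))"

definition pre_pool ::
  "(nat \<Rightarrow> 'a \<Rightarrow> real) \<Rightarrow> (nat \<Rightarrow> 'a \<Rightarrow> real) \<Rightarrow> (nat \<Rightarrow> 'a \<Rightarrow> real ^ 'n) \<Rightarrow>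
    (nat \<Rightarrow> 'a \<Rightarrow> block list) \<Rightarrow> nat \<Rightarrow> 'n \<Rightarrow> 'a \<Rightarrow> block set" where
  "pre_pool t bid delay ref n i \<omega> =
     tips bid ref {m. 1 \<le> m \<and> m < n \<and> t m \<omega> + delay m \<omega> $ i \<le> t n \<omega>} \<omega>"

definition local_pool ::
  "(nat \<Rightarrow> 'a \<Rightarrow> real) \<Rightarrow> (nat \<Rightarrow> 'a \<Rightarrow> real) \<Rightarrow> (nat \<Rightarrow> 'a \<Rightarrow> real ^ 'n) \<Rightarrow>
    (nat \<Rightarrow> 'a \<Rightarrow> block list) \<Rightarrow> nat \<Rightarrow> 'n \<Rightarrow> 'a \<Rightarrow> block set" where
  "local_pool t bid delay ref n i \<omega> =
     tips bid ref {m. 1 \<le> m \<and> m \<le> n \<and> t m \<omega> + delay m \<omega> $ i \<le> t n \<omega>} \<omega>"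

definition observer_pool ::
  "(nat \<Rightarrow> 'a \<Rightarrow> real) \<Rightarrow> (nat \<Rightarrow> 'a \<Rightarrow> block list) \<Rightarrow> nat \<Rightarrow> 'a \<Rightarrow> block set" where
  "observer_pool bid ref n \<omega> = tips bid ref {1..n} \<omega>"

definition Xobs :: "(nat \<Rightarrow> 'a \<Rightarrow> real) \<Rightarrow> (nat \<Rightarrow> 'a \<Rightarrow> block list) \<Rightarrow> nat \<Rightarrow> 'a \<Rightarrow> real" where
  "Xobs bid ref n \<omega> = real (card (observer_pool bid ref n \<omega>))"

definition Xloc ::
  "(nat \<Rightarrow> 'a \<Rightarrow> real) \<Rightarrow> (nat \<Rightarrow> 'a \<Rightarrow> real) \<Rightarrow> (nat \<Rightarrow> 'a \<Rightarrow> real ^ 'n) \<Rightarrow>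
    (nat \<Rightarrow> 'a \<Rightarrow> block list) \<Rightarrow> 'n \<Rightarrow> nat \<Rightarrow> 'a \<Rightarrow> real" where
  "Xloc t bid delay ref i n \<omega> = real (card (local_pool t bid delay ref n i \<omega>))"

text \<open>The (equally likely) outcomes of drawing up to \<^term>\<open>k\<close> elements without replacement:\<close>

definition draws :: "nat \<Rightarrow> 'b set \<Rightarrow> 'b list set" where
  "draws k S = {xs. distinct xs \<and> set xs \<subseteq> S \<and> length xs = min k (card S)}"

text \<open>The marks of a block that do not involve references, with the time since the previous block:\<close>

definition primitives ::
  "(nat \<Rightarrow> 'a \<Rightarrow> real) \<Rightarrow> (nat \<Rightarrow> 'a \<Rightarrow> real) \<Rightarrow> (nat \<Rightarrow> 'a \<Rightarrow> 'n) \<Rightarrow> (nat \<Rightarrow> 'a \<Rightarrow> real ^ 'n) \<Rightarrow>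
    nat \<Rightarrow> 'a \<Rightarrow> real \<times> real \<times> 'n \<times> (real ^ 'n)" where
  "primitives t bid issuer delay n \<omega> = (t n \<omega> - t (n - 1) \<omega>, bid n \<omega>, issuer n \<omega>, delay n \<omega>)"

definition primitive_space :: "(real \<times> real \<times> 'n \<times> (real ^ 'n :: finite)) measure" where
  "primitive_space = borel \<Otimes>\<^sub>M borel \<Otimes>\<^sub>M count_space UNIV \<Otimes>\<^sub>M borel"

text \<open>
  The \<sigma>-algebra given which the references of block \<^term>\<open>n\<close> are drawn: all times,
  identifiers, issuers and delays (also future ones, on which the draw does not depend),
  and all earlier references.
\<close>

definition history ::
  "'a measure \<Rightarrow> (nat \<Rightarrow> 'a \<Rightarrow> real) \<Rightarrow> (nat \<Rightarrow> 'a \<Rightarrow> real) \<Rightarrow> (nat \<Rightarrow> 'a \<Rightarrow> 'n) \<Rightarrow>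
    (nat \<Rightarrow> 'a \<Rightarrow> real ^ 'n :: finite) \<Rightarrow> (nat \<Rightarrow> 'a \<Rightarrow> block list) \<Rightarrow> nat \<Rightarrow> 'a measure" where
  "history M t bid issuer delay ref n = sigma (space M)
     ({primitives t bid issuer delay m -` A \<inter> space M | m A. 1 \<le> m \<and> A \<in> sets primitive_space} \<union>
      {ref m -` A \<inter> space M | m A. 1 \<le> m \<and> m < n \<and> A \<in> sets ref_space})"

text \<open>
  The issue times form a homogeneous Poisson process of rate \<open>rate\<close>, given through its
  independent exponential inter-arrival times (in particular \<open>0 < t\<^sub>1 < t\<^sub>2 < \<dots>\<close> almost surely).
  \<open>D i\<close> is the law of the delay vector of a block issued by \<open>i\<close>; its \<open>j\<close>-th marginal
  is the law of \<open>\<Delta>\<^sub>i(j)\<close>.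
\<close>

locale block_issuance = prob_space M
  for M :: "'a measure" +
  fixes k :: nat and rate \<Delta> :: real
    and p :: "'n :: finite pmf" and D :: "'n \<Rightarrow> (real ^ 'n) measure"
    and t bid :: "nat \<Rightarrow> 'a \<Rightarrow> real" and issuer :: "nat \<Rightarrow> 'a \<Rightarrow> 'n"
    and delay :: "nat \<Rightarrow> 'a \<Rightarrow> real ^ 'n" and ref :: "nat \<Rightarrow> 'a \<Rightarrow> block list"
  assumes k_ge_2: "k \<ge> 2" and rate_pos: "rate > 0" and Delta_nonneg: "\<Delta> \<ge> 0"
    and D_prob: "\<And>i. prob_space (D i)" and D_sets: "\<And>i. sets (D i) = sets borel"
    and D_nonneg: "\<And>i. AE d in D i. \<forall>j. 0 \<le> d $ j"
    and D_issuer: "\<And>i. AE d in D i. d $ i = 0"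
    and partial_synchrony: "\<And>i j. AE d in D i. d $ j \<le> \<Delta>"
    and t_0: "\<And>\<omega>. t 0 \<omega> = 0"
    and primitives_indep:
      "indep_vars (\<lambda>_. primitive_space) (primitives t bid issuer delay) {1..}"
    and primitives_law:
      "\<And>n A B i C. n \<ge> 1 \<Longrightarrow> A \<in> sets borel \<Longrightarrow> B \<in> sets borel \<Longrightarrow> C \<in> sets borel \<Longrightarrow>
         prob {\<omega> \<in> space M. t n \<omega> - t (n - 1) \<omega> \<in> A \<and> bid n \<omega> \<in> B \<and> issuer n \<omega> = i \<and> delay n \<omega> \<in> C} =
         measure (density lborel (exponential_density rate)) A *
         measure (uniform_measure lborel {0..1}) B *
         pmf p i * measure (D i) C"
    and ref_measurable: "\<And>n. n \<ge> 1 \<Longrightarrow> ref n \<in> M \<rightarrow>\<^sub>M ref_space"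
    and ref_law:
      "\<And>n B. n \<ge> 1 \<Longrightarrow> B \<in> sets ref_space \<Longrightarrow>
         AE \<omega> in M. real_cond_exp M (history M t bid issuer delay ref n)
                      (\<lambda>\<omega>. indicator B (ref n \<omega>)) \<omega> =
           measure_pmf.prob (pmf_of_set (draws k (pre_pool t bid delay ref n (issuer n \<omega>) \<omega>))) B"

end

theory Submission
  imports Defs
begin

text \<open>
  Replacing blocks by their indices, the reference lists are a Markov chain driven by the
  i.i.d. sequence of gaps, issuers and delays. A gap longer than \<open>\<Delta>\<close> lets every node
  see all earlier blocks; then the number \<open>L\<close> of tips becomes \<open>L + 1 - min k L\<close>, so that \<open>l\<close> long gaps in a
  row reduce at most \<open>l\<close> tips to one, and the process starts afresh from that tip. Conditionally on the environment,
  \<open>L\<close> has negative drift whenever it is large compared with the number of consecutive short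
  gaps; hence \<open>L\<close> has a uniformly bounded exponential moment.

  In a window of \<open>B\<close> blocks of \<open>l\<close> steps, consider the first block all of whose gaps
  are long. Its position depends on the environment only, so the process
  regenerates there unless \<open>L > l\<close> at its start, and the law of the pools at the end of the window is a function of the
  environment inside the window. Choosing \<open>B\<close> of order \<open>l / a\<^sup>l\<close>, where \<open>a\<close>
  is the probability of a long gap, makes the error exponentially small in \<open>l\<close>. This gives a
  polynomial mixing rate, from which convergence in distribution is immediate, and
  which bounds the variance of the sums by \<open>n\<^sup>2\<^sup>-\<^sup>\<gamma>\<close>; Chebyshev's inequality along a
  sequence \<open>j\<^sup>p\<close> and monotonicity of the sums yield the strong law.
\<close>

section \<open>Strong law under decay of correlations\<close>

text \<open>The number of tips is unbounded, so no fixed number of long gaps is sure to bring it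
  down to one, while a run of \<open>l\<close> long gaps is met only after about
  \<open>1 / a^l\<close> steps, \<open>a\<close> being the probability of a long gap. A plain union
  bound over the \<open>B\<close> candidate blocks would cost a factor that may well exceed the
  exponential decay of the probability of more than \<open>l\<close> tips. The remedy is
  independence: given the environment, the law of the tip count at the start of a block depends on
  earlier entries only, not on the gaps inside the block. Each candidate therefore contributes
  \<open>a^l\<close> times that probability, and \<open>B * a^l\<close> is only of order
  \<open>l\<close>. Hence an exponential moment with any base above 1 suffices.

  References are drawn given all primitives, future ones included. For a fixed environment the
  histories thus form an inhomogeneous Markov chain with finitely many states at each time;
  conditional expectations become finite sums, and their measurability in the environment reduces to
  that of point masses.\<close>

lemma strict_mono_bracket:
  fixes f :: "nat \<Rightarrow> nat"
  assumes "strict_mono f" "f J \<le> n"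
  obtains j where "J \<le> j" "f j \<le> n" "n < f (Suc j)"
proof -
  have fin: "finite {j. f j \<le> n}"
    by (rule finite_subset[of _ "{..n}"]) (use strict_mono_imp_increasing[OF assms(1)] order_trans in auto)
  define j where "j = Max {j. f j \<le> n}"
  have "j \<in> {j. f j \<le> n}" unfolding j_def by (rule Max_in[OF fin]) (use assms(2) in auto)
  moreover have "J \<le> j" unfolding j_def by (rule Max_ge[OF fin]) (use assms(2) in auto)
  moreover have "\<not> f (Suc j) \<le> n"
  proof
    assume "f (Suc j) \<le> n"
    then have "Suc j \<le> j" unfolding j_def by (intro Max_ge[OF fin]) auto
    then show False by simp
  qed
  ultimately show thesis by (intro that) auto
qed

text \<open>Between two consecutive sampling points, \<open>S n / n\<close> lies between
  \<open>S (f j) / f (j + 1)\<close> and \<open>S (f (j + 1)) / f j\<close>. Both bounds have the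
  limit \<open>\<mu>\<close> because the sampling points grow by a factor tending to 1.\<close>

lemma average_interpolation:
  fixes S :: "nat \<Rightarrow> real" and f :: "nat \<Rightarrow> nat"
  assumes S: "mono S" "\<And>n. 0 \<le> S n" and f: "strict_mono f" "\<And>j. 0 < f j"
    and lim: "(\<lambda>j. S (f j) / real (f j)) \<longlonglongrightarrow> \<mu>" and ratio: "(\<lambda>j. real (f (Suc j)) / real (f j)) \<longlonglongrightarrow> 1"
  shows "(\<lambda>n. S n / real n) \<longlonglongrightarrow> \<mu>"
proof (rule LIMSEQ_I)
  fix e :: real assume e: "0 < e"
  have "(\<lambda>j. (S (f j) / real (f j)) / (real (f (Suc j)) / real (f j))) \<longlonglongrightarrow> \<mu> / 1"
    by (intro tendsto_divide lim ratio) simp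
  then have lower: "(\<lambda>j. S (f j) / real (f (Suc j))) \<longlonglongrightarrow> \<mu>"
    using less_imp_neq[OF f(2), symmetric] by simp
  have "(\<lambda>j. (S (f (Suc j)) / real (f (Suc j))) * (real (f (Suc j)) / real (f j))) \<longlonglongrightarrow> \<mu> * 1"
    by (intro tendsto_mult ratio filterlim_compose[OF lim filterlim_Suc])
  moreover have "(S (f (Suc j)) / real (f (Suc j))) * (real (f (Suc j)) / real (f j)) = S (f (Suc j)) / real (f j)" for j
    using less_imp_neq[OF f(2), symmetric] by simp
  ultimately have upper: "(\<lambda>j. S (f (Suc j)) / real (f j)) \<longlonglongrightarrow> \<mu>" by (simp only: mult_1_right)
  have "eventually (\<lambda>j. S (f j) / real (f (Suc j)) > \<mu> - e \<and> S (f (Suc j)) / real (f j) < \<mu> + e) sequentially"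
    using e by (intro eventually_conj order_tendstoD[OF lower] order_tendstoD[OF upper]) auto
  then obtain J where J: "\<And>j. J \<le> j \<Longrightarrow> S (f j) / real (f (Suc j)) > \<mu> - e \<and> S (f (Suc j)) / real (f j) < \<mu> + e"
    by (auto simp: eventually_sequentially)
  show "\<exists>N. \<forall>n\<ge>N. norm (S n / real n - \<mu>) < e"
  proof (intro exI allI impI)
    fix n assume "f J \<le> n"
    then obtain j where j: "J \<le> j" "f j \<le> n" "n < f (Suc j)" by (rule strict_mono_bracket[OF f(1)])
    have n: "0 < n" using f(2)[of j] j by simp
    have "S (f j) / real (f (Suc j)) \<le> S n / real n"
      using j n monoD[OF S(1) j(2)] S(2) by (intro frac_le) auto
    moreover have "S n / real n \<le> S (f (Suc j)) / real (f j)"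
      using j f(2)[of j] monoD[OF S(1), of n "f (Suc j)"] S(2) by (intro frac_le) auto
    ultimately show "norm (S n / real n - \<mu>) < e" using J[OF j(1)] by (simp add: abs_less_iff)
  qed
qed

lemma Cesaro_mean:
  fixes a :: "nat \<Rightarrow> real"
  assumes "a \<longlonglongrightarrow> \<mu>"
  shows "(\<lambda>n. (\<Sum>m=1..n. a m) / real n) \<longlonglongrightarrow> \<mu>"
proof -
  have "(\<lambda>n. (\<Sum>m=1..n. \<bar>a m - \<mu>\<bar>) / real n) \<longlonglongrightarrow> 0"
  proof (rule LIMSEQ_I)
    fix e :: real assume e: "0 < e"
    then obtain N where N: "\<And>n. N \<le> n \<Longrightarrow> \<bar>a n - \<mu>\<bar> < e / 2"
      using LIMSEQ_D[OF assms, of "e / 2"] by auto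
    \<comment> \<open>The first \<open>N\<close> terms contribute a constant; \<open>N'\<close> is
      chosen so that this constant is below \<open>n * e / 2\<close> from then on.\<close>
    define D where "D = (\<Sum>m=1..N. \<bar>a m - \<mu>\<bar>)"
    have D: "0 \<le> D" by (auto simp: D_def intro: sum_nonneg)
    obtain N' :: nat where N': "2 * D / e < real N'" using reals_Archimedean2 by blast
    show "\<exists>N. \<forall>n\<ge>N. norm ((\<Sum>m=1..n. \<bar>a m - \<mu>\<bar>) / real n - 0) < e"
    proof (intro exI[of _ "Suc (max N N')"] allI impI)
      fix n assume n: "Suc (max N N') \<le> n"
      have "{1..n} = {1..N} \<union> {Suc N..n}" using n by auto
      then have "(\<Sum>m=1..n. \<bar>a m - \<mu>\<bar>) = D + (\<Sum>m=Suc N..n. \<bar>a m - \<mu>\<bar>)"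
        unfolding D_def by (simp add: sum.union_disjoint)
      also have "(\<Sum>m=Suc N..n. \<bar>a m - \<mu>\<bar>) \<le> (\<Sum>m=Suc N..n. e / 2)"
        by (intro sum_mono less_imp_le N) auto
      also have "\<dots> \<le> real n * (e / 2)" using e n by simp
      also have "D + real n * (e / 2) < real n * e"
      proof -
        have "D < real N' * (e / 2)" using N' e by (simp add: field_simps)
        also have "\<dots> \<le> real n * (e / 2)" using n e by (intro mult_right_mono) auto
        finally show ?thesis by simp
      qed
      finally have "(\<Sum>m=1..n. \<bar>a m - \<mu>\<bar>) / real n < e" using n by (simp add: divide_less_eq mult.commute)
      moreover have "0 \<le> (\<Sum>m=1..n. \<bar>a m - \<mu>\<bar>) / real n" by (intro divide_nonneg_nonneg sum_nonneg) auto
      ultimately show "norm ((\<Sum>m=1..n. \<bar>a m - \<mu>\<bar>) / real n - 0) < e" by simp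
    qed
  qed
  moreover have "\<forall>\<^sub>F n in sequentially. norm ((\<Sum>m=1..n. a m) / real n - \<mu>) \<le> (\<Sum>m=1..n. \<bar>a m - \<mu>\<bar>) / real n"
    using eventually_gt_at_top[of 0]
  proof eventually_elim
    case (elim n)
    then have "(\<Sum>m=1..n. a m) / real n - \<mu> = (\<Sum>m=1..n. a m - \<mu>) / real n"
      by (simp add: sum_subtractf field_simps)
    then show ?case using sum_abs[of "\<lambda>m. a m - \<mu>" "{1..n}"] by (simp add: divide_right_mono)
  qed
  ultimately have "(\<lambda>n. (\<Sum>m=1..n. a m) / real n - \<mu>) \<longlonglongrightarrow> 0" by (rule Lim_null_comparison[rotated])
  then show ?thesis by (simp add: LIM_zero_iff)
qed

text \<open>By monotone convergence the sum of all squares has finite expectation, so it is finite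
  almost surely and its terms tend to 0. This does the work of Chebyshev's inequality and the
  Borel-Cantelli lemma in one stroke.\<close>

lemma (in prob_space) AE_tendsto_0_of_summable_second_moments:
  fixes Z :: "nat \<Rightarrow> 'a \<Rightarrow> real"
  assumes [measurable]: "\<And>j. random_variable borel (Z j)"
    and int: "\<And>j. integrable M (\<lambda>\<omega>. (Z j \<omega>)\<^sup>2)"
    and sum: "summable (\<lambda>j. expectation (\<lambda>\<omega>. (Z j \<omega>)\<^sup>2))"
  shows "AE \<omega> in M. (\<lambda>j. Z j \<omega>) \<longlonglongrightarrow> 0"
proof -
  have "(\<integral>\<^sup>+\<omega>. (\<Sum>j. ennreal ((Z j \<omega>)\<^sup>2)) \<partial>M) = (\<Sum>j. \<integral>\<^sup>+\<omega>. ennreal ((Z j \<omega>)\<^sup>2) \<partial>M)"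
    by (rule nn_integral_suminf) measurable
  also have "\<dots> = (\<Sum>j. ennreal (expectation (\<lambda>\<omega>. (Z j \<omega>)\<^sup>2)))"
    by (intro suminf_cong nn_integral_eq_integral int) auto
  also have "\<dots> = ennreal (\<Sum>j. expectation (\<lambda>\<omega>. (Z j \<omega>)\<^sup>2))"
    by (rule suminf_ennreal2[OF _ sum]) (auto intro: integral_nonneg_AE)
  finally have "(\<integral>\<^sup>+\<omega>. (\<Sum>j. ennreal ((Z j \<omega>)\<^sup>2)) \<partial>M) \<noteq> \<infinity>" by simp
  then have "AE \<omega> in M. (\<Sum>j. ennreal ((Z j \<omega>)\<^sup>2)) \<noteq> \<infinity>"
    by (intro nn_integral_PInf_AE) auto
  then show ?thesis
  proof (eventually_elim)
    case (elim \<omega>)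
    then have "summable (\<lambda>j. (Z j \<omega>)\<^sup>2)"
      by (intro summable_suminf_not_top) auto
    then have "(\<lambda>j. (Z j \<omega>)\<^sup>2) \<longlonglongrightarrow> 0" by (rule summable_LIMSEQ_zero)
    then have "(\<lambda>j. sqrt ((Z j \<omega>)\<^sup>2)) \<longlonglongrightarrow> sqrt 0" by (rule tendsto_real_sqrt)
    then show ?case by (simp add: tendsto_rabs_zero_iff)
  qed
qed

lemma (in prob_space) strong_law_of_variance_bound:
  fixes X :: "nat \<Rightarrow> 'a \<Rightarrow> real" and \<gamma> C \<mu> :: real
  assumes [measurable]: "\<And>n. random_variable borel (X n)"
    and nonneg: "\<And>n \<omega>. 0 \<le> X n \<omega>"
    and mean: "(\<lambda>n. expectation (X n)) \<longlonglongrightarrow> \<mu>"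
    and \<gamma>: "0 < \<gamma>"
    and int: "\<And>n. integrable M (\<lambda>\<omega>. (\<Sum>m=1..n. X m \<omega> - expectation (X m))\<^sup>2)"
    and var: "\<And>n. 1 \<le> n \<Longrightarrow> expectation (\<lambda>\<omega>. (\<Sum>m=1..n. X m \<omega> - expectation (X m))\<^sup>2) \<le> C * (real n)\<^sup>2 * real n powr (- \<gamma>)"
  shows "AE \<omega> in M. (\<lambda>n. (\<Sum>m=1..n. X m \<omega>) / real n) \<longlonglongrightarrow> \<mu>"
proof -
  \<comment> \<open>Since \<open>p * \<gamma>\<close> exceeds 2, the factor
    \<open>n powr (- \<gamma>)\<close> along \<open>n = j^p\<close> is at most
    \<open>1 / j^2\<close>, which is summable.\<close>
  obtain p :: nat where p: "2 / \<gamma> < real p" using reals_Archimedean2 by blast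
  have "0 < real p" using p \<gamma> by (meson divide_pos_pos less_trans zero_less_numeral)
  then have p0: "0 < p" by simp
  \<comment> \<open>A power is sparse enough for that summability, yet its consecutive ratios tend
    to 1, as the interpolation requires; a geometric sequence would fail the latter. The shift by
    one keeps \<open>f j\<close> positive.\<close>
  define f where "f j = (Suc j) ^ p" for j
  have f: "strict_mono f" "\<And>j. 0 < f j"
    using p0 by (auto simp: f_def strict_mono_def intro: power_strict_mono)
  define Z where "Z j \<omega> = (\<Sum>m=1..f j. X m \<omega> - expectation (X m)) / real (f j)" for j \<omega>
  have Z_meas: "random_variable borel (Z j)" for j unfolding Z_def by measurable
  have Z_int: "integrable M (\<lambda>\<omega>. (Z j \<omega>)\<^sup>2)" for j
    unfolding Z_def power_divide by (intro integrable_divide int)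
  have Z_le: "expectation (\<lambda>\<omega>. (Z j \<omega>)\<^sup>2) \<le> C * (1 / (real (Suc j))\<^sup>2)" for j
  proof -
    have "expectation (\<lambda>\<omega>. (Z j \<omega>)\<^sup>2) = expectation (\<lambda>\<omega>. (\<Sum>m=1..f j. X m \<omega> - expectation (X m))\<^sup>2) / (real (f j))\<^sup>2"
      unfolding Z_def power_divide by simp
    also have "\<dots> \<le> (C * (real (f j))\<^sup>2 * real (f j) powr (- \<gamma>)) / (real (f j))\<^sup>2"
      using f(2)[of j] by (intro divide_right_mono var) auto
    also have "\<dots> = C * real (f j) powr (- \<gamma>)" using f(2)[of j] by simp
    also have "\<dots> \<le> C * (1 / (real (Suc j))\<^sup>2)"
    proof (rule mult_left_mono)
      \<comment> \<open>The variance bound at \<open>n = 1\<close> has a nonnegative left-hand side,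
        which forces the sign of \<open>C\<close>.\<close>
      have "0 \<le> expectation (\<lambda>\<omega>. (\<Sum>m=1..1. X m \<omega> - expectation (X m))\<^sup>2)"
        by (intro integral_nonneg_AE) auto
      then have "0 \<le> C * (real 1)\<^sup>2 * real 1 powr (- \<gamma>)" by (rule order_trans[OF _ var]) simp
      then show "0 \<le> C" by simp
      have "real (f j) powr (- \<gamma>) = real (Suc j) powr (- (real p * \<gamma>))"
        by (simp add: f_def powr_realpow[symmetric] powr_powr)
      also have "\<dots> \<le> real (Suc j) powr (- 2)"
        using p \<gamma> by (intro powr_mono) (auto simp: field_simps)
      also have "\<dots> = 1 / (real (Suc j))\<^sup>2" by (simp add: powr_minus_divide powr_numeral)
      finally show "real (f j) powr (- \<gamma>) \<le> 1 / (real (Suc j))\<^sup>2" .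
    qed
    finally show ?thesis .
  qed
  have "summable (\<lambda>j. C * (1 / (real (Suc j))\<^sup>2))"
    using inverse_squares_sums by (intro summable_mult) (auto simp: sums_iff)
  then have "summable (\<lambda>j. expectation (\<lambda>\<omega>. (Z j \<omega>)\<^sup>2))"
    by (rule summable_comparison_test'[where N = 0]) (use Z_le in \<open>auto simp: abs_of_nonneg integral_nonneg_AE\<close>)
  then have AE_Z: "AE \<omega> in M. (\<lambda>j. Z j \<omega>) \<longlonglongrightarrow> 0"
    by (rule AE_tendsto_0_of_summable_second_moments[OF Z_meas Z_int])
  have ratio: "(\<lambda>j. real (f (Suc j)) / real (f j)) \<longlonglongrightarrow> 1"
  proof -
    have "(\<lambda>j. (1 + 1 / real (Suc j)) ^ p) \<longlonglongrightarrow> (1 + 0) ^ p"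
      by (intro tendsto_intros LIMSEQ_Suc[OF lim_1_over_n])
    moreover have "(1 + 1 / real (Suc j)) ^ p = real (f (Suc j)) / real (f j)" for j
    proof -
      have "1 + 1 / real (Suc j) = real (Suc (Suc j)) / real (Suc j)" by (simp add: field_simps)
      then show ?thesis by (simp add: f_def power_divide)
    qed
    ultimately show ?thesis by simp
  qed
  have means: "(\<lambda>j. (\<Sum>m=1..f j. expectation (X m)) / real (f j)) \<longlonglongrightarrow> \<mu>"
    by (rule filterlim_compose[OF Cesaro_mean[OF mean] filterlim_subseq[OF f(1)]])
  from AE_Z show ?thesis
  proof eventually_elim
    case (elim \<omega>)
    have "(\<lambda>j. Z j \<omega> + (\<Sum>m=1..f j. expectation (X m)) / real (f j)) \<longlonglongrightarrow> 0 + \<mu>"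
      by (intro tendsto_add elim means)
    then have lim: "(\<lambda>j. (\<Sum>m=1..f j. X m \<omega>) / real (f j)) \<longlonglongrightarrow> \<mu>"
      by (simp add: Z_def sum_subtractf diff_divide_distrib)
    show ?case
    proof (rule average_interpolation[where S = "\<lambda>n. \<Sum>m=1..n. X m \<omega>", OF _ _ f lim ratio])
      show "mono (\<lambda>n. \<Sum>m=1..n. X m \<omega>)" by (intro monoI sum_mono2) (auto simp: nonneg)
    qed (auto intro: sum_nonneg nonneg)
  qed
qed

text \<open>For passing from truncated to unbounded variables at a cost of order \<open>T^-2\<close>
  times fourth powers: where the larger argument \<open>m\<close> exceeds \<open>T\<close>, one has
  \<open>m^2 \<le> m^4 / T^2\<close>.\<close>

lemma truncation_bounds:
  fixes u v T :: real
  assumes "0 \<le> u" "0 \<le> v" "0 < T"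
  shows "u \<le> 1 + u ^ 4" "u * v \<le> 1 + u ^ 4 + v ^ 4"
    "min T u * min T v \<le> u * v" "u * v - min T u * min T v \<le> (u ^ 4 + v ^ 4) / T\<^sup>2"
    "u - min T u \<le> (1 + u ^ 4) / T\<^sup>2"
proof -
  have sq: "w\<^sup>2 \<le> 1 + w ^ 4" for w :: real
  proof -
    have "0 \<le> (w\<^sup>2 - 1 / 2)\<^sup>2" by simp
    then show ?thesis by (simp add: power2_diff power_mult[symmetric] field_simps)
  qed
  have lin: "2 * w \<le> 1 + w\<^sup>2" for w :: real using sum_squares_bound[of 1 w] by simp
  show one: "u \<le> 1 + u ^ 4" using sq[of u] lin[of u] zero_le_power[OF assms(1), of 4] by linarith
  have "2 * (u * v) \<le> u\<^sup>2 + v\<^sup>2" using sum_squares_bound[of u v] by simp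
  then show "u * v \<le> 1 + u ^ 4 + v ^ 4"
    using sq[of u] sq[of v] zero_le_power[OF assms(1), of 4] zero_le_power[OF assms(2), of 4] by linarith
  show "min T u * min T v \<le> u * v" using assms by (intro mult_mono) auto
  show "u * v - min T u * min T v \<le> (u ^ 4 + v ^ 4) / T\<^sup>2"
  proof (cases "u \<le> T \<and> v \<le> T")
    case True
    then show ?thesis by (simp add: min_absorb2 assms)
  next
    case False
    define m where "m = max u v"
    have m: "T < m" "u \<le> m" "v \<le> m" using False by (auto simp: m_def)
    have "u * v - min T u * min T v \<le> u * v" using assms by simp
    also have "\<dots> \<le> m\<^sup>2" unfolding power2_eq_square using m assms by (intro mult_mono) auto
    also have "\<dots> \<le> m ^ 4 / T\<^sup>2"
    proof -
      have "m\<^sup>2 * T\<^sup>2 \<le> m\<^sup>2 * m\<^sup>2" using m assms by (intro mult_left_mono power_mono) auto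
      then show ?thesis using assms by (simp add: pos_le_divide_eq power_add[symmetric])
    qed
    also have "\<dots> \<le> (u ^ 4 + v ^ 4) / T\<^sup>2"
      using assms by (intro divide_right_mono) (auto simp: m_def max_def)
    finally show ?thesis .
  qed
  show "u - min T u \<le> (1 + u ^ 4) / T\<^sup>2"
  proof (cases "u \<le> T")
    case True
    then show ?thesis using assms by (simp add: min_def)
  next
    case False
    have "u * T\<^sup>2 \<le> u * u\<^sup>2" using False assms by (intro mult_left_mono power_mono) auto
    also have "\<dots> = u ^ 3" by (simp add: power3_eq_cube power2_eq_square)
    also have "\<dots> \<le> 1 + u ^ 4"
    proof (cases "u \<le> 1")
      case True
      then show ?thesis using assms power_le_one[of u 3] zero_le_power[OF assms(1), of 4] by linarith
    next
      case False
      then have "u ^ 3 \<le> u ^ 4" by (intro power_increasing) auto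
      then show ?thesis by simp
    qed
    finally have "u \<le> (1 + u ^ 4) / T\<^sup>2" using assms by (simp add: pos_le_divide_eq)
    moreover have "0 \<le> min T u" using assms by simp
    ultimately show ?thesis by linarith
  qed
qed

text \<open>Regeneration controls bounded functions of the pools, hence \<open>decay\<close> speaks
  of truncated variables, with a factor \<open>T^2\<close> for the two of them. A distance
  \<open>d = A^l\<close> gives an error \<open>q^l\<close>, which is a negative power of
  \<open>d\<close>: the rate is polynomial.\<close>

locale mixing_sequence = prob_space +
  fixes X :: "nat \<Rightarrow> 'a \<Rightarrow> real" and C4 K q A :: real
  assumes X_meas [measurable]: "\<And>n. random_variable borel (X n)"
    and X_nonneg: "\<And>n \<omega>. 0 \<le> X n \<omega>"
    and X_int: "\<And>n. integrable M (\<lambda>\<omega>. X n \<omega> ^ 4)"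
    and X_moment: "\<And>n. expectation (\<lambda>\<omega>. X n \<omega> ^ 4) \<le> C4"
    and K_pos: "0 < K" and q_bounds: "0 < q" "q < 1" and A_gt: "1 < A"
    and decay: "\<And>l s n T. 1 \<le> l \<Longrightarrow> s \<le> n \<Longrightarrow> A ^ l \<le> real (n - s) \<Longrightarrow> 0 < T \<Longrightarrow>
      \<bar>expectation (\<lambda>\<omega>. min T (X s \<omega>) * min T (X n \<omega>)) -
        expectation (\<lambda>\<omega>. min T (X s \<omega>)) * expectation (\<lambda>\<omega>. min T (X n \<omega>))\<bar> \<le> K * T\<^sup>2 * q ^ l"
begin

lemma C4_nonneg: "0 \<le> C4"
  by (rule order_trans[OF _ X_moment[of 0]]) (auto intro: integral_nonneg_AE)

lemma integrable_X: "integrable M (X n)"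
  by (rule Bochner_Integration.integrable_bound[of M "\<lambda>\<omega>. 1 + X n \<omega> ^ 4"])
     (use truncation_bounds(1)[OF X_nonneg X_nonneg zero_less_one] X_nonneg X_int in \<open>auto intro!: AE_I2 simp: abs_of_nonneg\<close>)

lemma integrable_X_mult: "integrable M (\<lambda>\<omega>. X s \<omega> * X n \<omega>)"
  by (rule Bochner_Integration.integrable_bound[of M "\<lambda>\<omega>. 1 + X s \<omega> ^ 4 + X n \<omega> ^ 4"])
     (use truncation_bounds(2)[OF X_nonneg X_nonneg zero_less_one] X_nonneg X_int in \<open>auto intro!: AE_I2 simp: abs_of_nonneg\<close>)

lemma integrable_min: "integrable M (\<lambda>\<omega>. min T (X n \<omega>))" if "0 < T"
  by (rule integrable_const_bound[where B = T]) (use that X_nonneg in \<open>auto simp: abs_of_nonneg\<close>)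

lemma integrable_min_mult: "integrable M (\<lambda>\<omega>. min T (X s \<omega>) * min T (X n \<omega>))" if "0 < T"
  by (rule integrable_const_bound[where B = "T * T"])
     (use that X_nonneg in \<open>auto simp: abs_of_nonneg intro!: mult_mono\<close>)

definition cov :: "nat \<Rightarrow> nat \<Rightarrow> real" where
  "cov s n = expectation (\<lambda>\<omega>. X s \<omega> * X n \<omega>) - expectation (X s) * expectation (X n)"

lemma cov_commute: "cov s n = cov n s"
  by (simp add: cov_def mult.commute)

lemma mean_bounds: "0 \<le> expectation (X n)" "expectation (X n) \<le> 1 + C4"
proof -
  show "0 \<le> expectation (X n)" by (intro integral_nonneg_AE) (simp add: X_nonneg)
  have "expectation (X n) \<le> expectation (\<lambda>\<omega>. 1 + X n \<omega> ^ 4)"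
    by (intro integral_mono integrable_X Bochner_Integration.integrable_add X_int
        truncation_bounds(1)[OF X_nonneg X_nonneg zero_less_one]) auto
  also have "\<dots> = 1 + expectation (\<lambda>\<omega>. X n \<omega> ^ 4)"
    by (subst Bochner_Integration.integral_add) (auto simp: X_int prob_space)
  finally show "expectation (X n) \<le> 1 + C4" using X_moment[of n] by simp
qed

lemma cov_bound: "\<bar>cov s n\<bar> \<le> 1 + 2 * C4 + (1 + C4)\<^sup>2"
proof -
  have "expectation (\<lambda>\<omega>. X s \<omega> * X n \<omega>) \<le> expectation (\<lambda>\<omega>. 1 + X s \<omega> ^ 4 + X n \<omega> ^ 4)"
    by (intro integral_mono integrable_X_mult Bochner_Integration.integrable_add X_int
        truncation_bounds(2)[OF X_nonneg X_nonneg zero_less_one]) auto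
  also have "\<dots> = 1 + expectation (\<lambda>\<omega>. X s \<omega> ^ 4) + expectation (\<lambda>\<omega>. X n \<omega> ^ 4)"
    by (subst Bochner_Integration.integral_add) (auto simp: X_int prob_space Bochner_Integration.integral_add)
  finally have 1: "expectation (\<lambda>\<omega>. X s \<omega> * X n \<omega>) \<le> 1 + 2 * C4" using X_moment[of n] X_moment[of s] by simp
  have 2: "0 \<le> expectation (\<lambda>\<omega>. X s \<omega> * X n \<omega>)" by (intro integral_nonneg_AE) (simp add: X_nonneg)
  have 3: "expectation (X s) * expectation (X n) \<le> (1 + C4)\<^sup>2"
    unfolding power2_eq_square by (intro mult_mono mean_bounds) (use C4_nonneg in simp)
  have 4: "0 \<le> expectation (X s) * expectation (X n)" by (intro mult_nonneg_nonneg mean_bounds)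
  show ?thesis using 1 2 3 4 C4_nonneg by (simp add: cov_def abs_le_iff)
qed

text \<open>Truncation at \<open>T\<close> costs an error of order \<open>T^-2\<close> by the fourth
  moments, and mixing of the truncated variables costs \<open>K * T^2 * q^l\<close>. The choice
  \<open>T = q^(-l/4)\<close> turns both powers into \<open>sqrt q ^ l\<close>.\<close>

lemma cov_decay:
  assumes l: "1 \<le> l" and s: "s \<le> n" and gap: "A ^ l \<le> real (n - s)"
  shows "\<bar>cov s n\<bar> \<le> (K + 4 * (1 + C4)\<^sup>2) * sqrt q ^ l"
proof -
  define h where "h = root 4 q"
  have h: "0 < h" "h ^ 4 = q" using q_bounds by (auto simp: h_def)
  have r: "sqrt q = h\<^sup>2" using h by (intro real_sqrt_unique) (auto simp: power_mult[symmetric])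
  define T where "T = (1 / h) ^ l"
  have T: "0 < T" using h by (simp add: T_def)
  have invT: "1 / T\<^sup>2 = sqrt q ^ l"
    unfolding r T_def using h by (simp add: power_divide power_mult[symmetric] mult.commute)
  have T2: "T\<^sup>2 * q ^ l = sqrt q ^ l"
  proof -
    have "q ^ l = sqrt q ^ l * sqrt q ^ l" using q_bounds by (simp add: power_mult_distrib[symmetric])
    moreover have "T\<^sup>2 * sqrt q ^ l = 1" using invT T by (simp add: field_simps)
    ultimately show ?thesis by simp
  qed
  let ?E2 = "expectation (\<lambda>\<omega>. X s \<omega> * X n \<omega>)" and ?E2' = "expectation (\<lambda>\<omega>. min T (X s \<omega>) * min T (X n \<omega>))"
  let ?m = "\<lambda>n. expectation (X n)" and ?m' = "\<lambda>n. expectation (\<lambda>\<omega>. min T (X n \<omega>))"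
  have "?E2 - ?E2' = expectation (\<lambda>\<omega>. X s \<omega> * X n \<omega> - min T (X s \<omega>) * min T (X n \<omega>))"
    by (rule Bochner_Integration.integral_diff[OF integrable_X_mult integrable_min_mult[OF T], symmetric])
  moreover have "\<dots> \<le> expectation (\<lambda>\<omega>. (X s \<omega> ^ 4 + X n \<omega> ^ 4) / T\<^sup>2)"
    by (intro integral_mono Bochner_Integration.integrable_diff integrable_X_mult integrable_min_mult T integrable_divide
        Bochner_Integration.integrable_add X_int truncation_bounds(4) X_nonneg)
  moreover have "\<dots> = (expectation (\<lambda>\<omega>. X s \<omega> ^ 4) + expectation (\<lambda>\<omega>. X n \<omega> ^ 4)) / T\<^sup>2"
    by (simp add: Bochner_Integration.integral_add[OF X_int X_int])
  moreover have "\<dots> \<le> (2 * C4) / T\<^sup>2"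
    using X_moment[of s] X_moment[of n] by (intro divide_right_mono) auto
  ultimately have 1: "?E2 - ?E2' \<le> 2 * C4 / T\<^sup>2" by linarith
  have 2: "?E2' \<le> ?E2"
    by (intro integral_mono integrable_X_mult integrable_min_mult T truncation_bounds(3) X_nonneg)
  have m: "?m j - ?m' j \<le> (1 + C4) / T\<^sup>2" "?m' j \<le> ?m j" "0 \<le> ?m' j" for j
  proof -
    have "?m j - ?m' j = expectation (\<lambda>\<omega>. X j \<omega> - min T (X j \<omega>))"
      by (rule Bochner_Integration.integral_diff[OF integrable_X integrable_min[OF T], symmetric])
    also have "\<dots> \<le> expectation (\<lambda>\<omega>. (1 + X j \<omega> ^ 4) / T\<^sup>2)"
      by (intro integral_mono Bochner_Integration.integrable_diff integrable_X integrable_min T integrable_divide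
        Bochner_Integration.integrable_add X_int truncation_bounds(5)[OF X_nonneg X_nonneg] X_nonneg) auto
    also have "\<dots> = (1 + expectation (\<lambda>\<omega>. X j \<omega> ^ 4)) / T\<^sup>2"
      by (simp add: Bochner_Integration.integral_add X_int prob_space)
    also have "\<dots> \<le> (1 + C4) / T\<^sup>2" using X_moment[of j] by (intro divide_right_mono) auto
    finally show "?m j - ?m' j \<le> (1 + C4) / T\<^sup>2" .
    show "?m' j \<le> ?m j" by (intro integral_mono integrable_X integrable_min T) auto
    show "0 \<le> ?m' j" by (intro integral_nonneg_AE) (use T X_nonneg in auto)
  qed
  have M: "0 \<le> 1 + C4" using C4_nonneg by simp
  have "?m s * (?m n - ?m' n) \<le> (1 + C4) * ((1 + C4) / T\<^sup>2)"
    using m[of n] mean_bounds[of s] M by (intro mult_mono) auto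
  moreover have "?m' n * (?m s - ?m' s) \<le> (1 + C4) * ((1 + C4) / T\<^sup>2)"
    using m[of n] m[of s] mean_bounds[of n] M by (intro mult_mono) auto
  moreover have "?m s * ?m n - ?m' s * ?m' n = ?m s * (?m n - ?m' n) + ?m' n * (?m s - ?m' s)"
    by (simp add: algebra_simps)
  ultimately have 3: "?m s * ?m n - ?m' s * ?m' n \<le> 2 * (1 + C4)\<^sup>2 / T\<^sup>2" by (simp add: power2_eq_square)
  have 4: "?m' s * ?m' n \<le> ?m s * ?m n"
    using m[of s] m[of n] mean_bounds[of s] by (intro mult_mono) auto
  have 5: "\<bar>?E2' - ?m' s * ?m' n\<bar> \<le> K * sqrt q ^ l"
    using decay[OF l s gap T] T2 by (simp add: mult.assoc)
  have "2 * C4 \<le> 2 * (1 + C4)\<^sup>2" using C4_nonneg by (simp add: power2_eq_square algebra_simps)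
  then have "2 * C4 / T\<^sup>2 \<le> 2 * (1 + C4)\<^sup>2 / T\<^sup>2" using T by (intro divide_right_mono) auto
  then have "\<bar>cov s n\<bar> \<le> K * sqrt q ^ l + 4 * (1 + C4)\<^sup>2 / T\<^sup>2"
    using 1 2 3 4 5 unfolding cov_def abs_le_iff by linarith
  also have "4 * (1 + C4)\<^sup>2 / T\<^sup>2 = 4 * (1 + C4)\<^sup>2 * sqrt q ^ l" by (simp add: invT[symmetric])
  finally show ?thesis by (simp add: algebra_simps)
qed

lemma integrable_centered_mult: "integrable M (\<lambda>\<omega>. (X s \<omega> - expectation (X s)) * (X n \<omega> - expectation (X n)))"
  unfolding left_diff_distrib right_diff_distrib by (intro Bochner_Integration.integrable_diff) (auto intro: integrable_X integrable_X_mult)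

lemma expectation_centered_mult:
  "expectation (\<lambda>\<omega>. (X s \<omega> - expectation (X s)) * (X n \<omega> - expectation (X n))) = cov s n"
proof -
  have "expectation (\<lambda>\<omega>. (X s \<omega> - expectation (X s)) * (X n \<omega> - expectation (X n))) =
    expectation (\<lambda>\<omega>. (X s \<omega> * X n \<omega> - expectation (X n) * X s \<omega>) - (expectation (X s) * X n \<omega> - expectation (X s) * expectation (X n)))"
    by (simp add: algebra_simps)
  also have "\<dots> = (expectation (\<lambda>\<omega>. X s \<omega> * X n \<omega>) - expectation (X n) * expectation (X s)) -
      (expectation (X s) * expectation (X n) - expectation (X s) * expectation (X n))"
    by (simp add: Bochner_Integration.integral_diff integrable_X integrable_X_mult prob_space)
  finally show ?thesis by (simp add: cov_def mult.commute)
qed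

lemma square_sum_centered:
  "(\<Sum>m=1..n. X m \<omega> - expectation (X m))\<^sup>2 =
    (\<Sum>s=1..n. \<Sum>t=1..n. (X s \<omega> - expectation (X s)) * (X t \<omega> - expectation (X t)))"
  by (simp add: power2_eq_square sum_product)

lemma integrable_centered_square: "integrable M (\<lambda>\<omega>. (\<Sum>m=1..n. X m \<omega> - expectation (X m))\<^sup>2)"
  unfolding square_sum_centered by (intro Bochner_Integration.integrable_sum integrable_centered_mult)

lemma variance_eq: "expectation (\<lambda>\<omega>. (\<Sum>m=1..n. X m \<omega> - expectation (X m))\<^sup>2) = (\<Sum>s=1..n. \<Sum>t=1..n. cov s t)"
  unfolding square_sum_centered
  by (simp add: Bochner_Integration.integral_sum integrable_centered_mult expectation_centered_mult)

text \<open>Pairs of indices at distance at most \<open>A^l\<close> are bounded by a constant, and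
  each index has at most \<open>2 * A^l + 1 \<le> 3 * A^l\<close> such partners; all other pairs
  fall under \<open>cov_decay\<close>.\<close>

lemma variance_le:
  assumes l: "1 \<le> l"
  shows "expectation (\<lambda>\<omega>. (\<Sum>m=1..n. X m \<omega> - expectation (X m))\<^sup>2) \<le>
    real n * (3 * A ^ l) * (1 + 2 * C4 + (1 + C4)\<^sup>2) + (real n)\<^sup>2 * ((K + 4 * (1 + C4)\<^sup>2) * sqrt q ^ l)"
proof -
  define N where "N = nat \<lfloor>A ^ l\<rfloor>"
  define K3 where "K3 = 1 + 2 * C4 + (1 + C4)\<^sup>2"
  define R where "R = (K + 4 * (1 + C4)\<^sup>2) * sqrt q ^ l"
  have Al: "1 \<le> A ^ l" using A_gt by simp
  have N: "real N \<le> A ^ l" using Al by (simp add: N_def)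
  have R: "0 \<le> R" using K_pos q_bounds by (auto simp: R_def intro!: mult_nonneg_nonneg add_nonneg_nonneg)
  have K3: "0 \<le> K3" using C4_nonneg by (simp add: K3_def)
  have far: "A ^ l \<le> real (b - a)" if "a + N < b" for a b :: nat
  proof -
    have "Suc N \<le> b - a" using that by simp
    then have "real N + 1 \<le> real (b - a)" by (metis of_nat_Suc add.commute of_nat_le_iff)
    moreover have "A ^ l < real N + 1" using Al by (simp add: N_def)
    ultimately show ?thesis by simp
  qed
  have c: "cov s t \<le> K3 * of_bool (t \<in> {s - N..s + N}) + R" for s t
  proof (cases "t \<in> {s - N..s + N}")
    case True
    then show ?thesis using cov_bound[of s t] R by (simp add: K3_def)
  next
    case False
    then consider "t + N < s" | "s + N < t" by fastforce
    then have "\<bar>cov s t\<bar> \<le> R"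
    proof cases
      case 1
      then show ?thesis using cov_decay[OF l _ far[OF 1]] by (simp add: R_def cov_commute[of s t])
    next
      case 2
      then show ?thesis using cov_decay[OF l _ far[OF 2]] by (simp add: R_def)
    qed
    then show ?thesis unfolding of_bool_def if_not_P[OF False] by simp
  qed
  have "(\<Sum>s=1..n. \<Sum>t=1..n. cov s t) \<le> (\<Sum>s=1..n. \<Sum>t=1..n. K3 * of_bool (t \<in> {s - N..s + N}) + R)"
    by (intro sum_mono c)
  also have "\<dots> = (\<Sum>s=1..n. K3 * real (card ({1..n} \<inter> {s - N..s + N})) + real n * R)"
    by (simp add: sum.distrib sum_distrib_left[symmetric] of_bool_def sum.If_cases Int_def)
  also have "\<dots> \<le> (\<Sum>s=1..n. K3 * (3 * A ^ l) + real n * R)"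
  proof (intro sum_mono add_right_mono mult_left_mono K3)
    fix s
    have "card ({1..n} \<inter> {s - N..s + N}) \<le> card {s - N..s + N}" by (intro card_mono) auto
    also have "\<dots> \<le> 2 * N + 1" by simp
    finally have "real (card ({1..n} \<inter> {s - N..s + N})) \<le> real (2 * N + 1)" by (rule of_nat_mono)
    also have "\<dots> \<le> 3 * A ^ l" using N Al by simp
    finally show "real (card ({1..n} \<inter> {s - N..s + N})) \<le> 3 * A ^ l" .
  qed
  also have "\<dots> = real n * (3 * A ^ l) * K3 + (real n)\<^sup>2 * R"
    by (simp add: power2_eq_square algebra_simps)
  finally show ?thesis unfolding variance_eq K3_def R_def .
qed

lemma variance_power_bound:
  obtains C \<gamma> where "0 < \<gamma>"
    "\<And>n. 1 \<le> n \<Longrightarrow> expectation (\<lambda>\<omega>. (\<Sum>m=1..n. X m \<omega> - expectation (X m))\<^sup>2) \<le> C * (real n)\<^sup>2 * real n powr (- \<gamma>)"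
proof -
  define K3 where "K3 = 1 + 2 * C4 + (1 + C4)\<^sup>2"
  define K2 where "K2 = K + 4 * (1 + C4)\<^sup>2"
  have K3: "0 \<le> K3" using C4_nonneg by (simp add: K3_def)
  have K2: "0 \<le> K2" using K_pos by (simp add: K2_def)
  \<comment> \<open>With \<open>l\<close> about \<open>ln n / (2 * ln A)\<close>, the near pairs
    contribute a multiple of \<open>n^2 * (1 / A)^l\<close> and the far ones a multiple of
    \<open>n^2 * sqrt q ^ l\<close>. The worse of the two bases is \<open>\<rho>\<close>, and
    \<open>\<rho>\<close> raised to the unrounded \<open>l\<close> is
    \<open>n powr (- \<gamma>)\<close>.\<close>
  define \<rho> where "\<rho> = max (sqrt q) (1 / A)"
  have \<rho>: "0 < \<rho>" "\<rho> < 1" using q_bounds A_gt by (auto simp: \<rho>_def max_def)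
  define \<gamma> where "\<gamma> = - ln \<rho> / (2 * ln A)"
  have lnA: "0 < ln A" using A_gt by simp
  have \<gamma>: "0 < \<gamma>" unfolding \<gamma>_def using \<rho> lnA by (intro divide_pos_pos) auto
  \<comment> \<open>Dividing by \<open>\<rho>\<close> pays for rounding \<open>l\<close> down by
    less than one.\<close>
  define C where "C = (3 * K3 + K2) / \<rho>"
  have "expectation (\<lambda>\<omega>. (\<Sum>m=1..n. X m \<omega> - expectation (X m))\<^sup>2) \<le> C * (real n)\<^sup>2 * real n powr (- \<gamma>)"
    if n: "1 \<le> n" for n
  proof -
    define y where "y = ln (real n) / (2 * ln A)"
    define l where "l = nat \<lfloor>y\<rfloor>"
    have y: "0 \<le> y" using n lnA by (simp add: y_def)
    have ly: "real l \<le> y" "y < real l + 1" using y by (auto simp: l_def)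
    have Var: "expectation (\<lambda>\<omega>. (\<Sum>m=1..n. X m \<omega> - expectation (X m))\<^sup>2) \<le> (3 * K3 + K2) * (real n)\<^sup>2 * \<rho> ^ l"
    \<comment> \<open>\<open>variance_le\<close> asks for \<open>1 \<le> l\<close>; for the small
      \<open>n\<close> with \<open>l = 0\<close> the uniform bound on the covariances is
      enough.\<close>
    proof (cases "l = 0")
      case True
      have "(\<Sum>s=1..n. \<Sum>t=1..n. cov s t) \<le> (\<Sum>s=1..n. \<Sum>t=1..n. K3)"
        by (intro sum_mono) (use cov_bound in \<open>auto simp: K3_def abs_le_iff\<close>)
      also have "\<dots> = K3 * (real n)\<^sup>2" by (simp add: power2_eq_square)
      also have "\<dots> \<le> (3 * K3 + K2) * (real n)\<^sup>2" using K3 K2 by (intro mult_right_mono) auto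
      finally show ?thesis using True unfolding variance_eq by simp
    next
      case False
      have "A ^ l * A ^ l = A powr (2 * real l)"
        using A_gt by (simp add: powr_realpow[symmetric] powr_add[symmetric])
      also have "\<dots> \<le> A powr (2 * y)" using A_gt ly by (intro powr_mono) auto
      also have "\<dots> = real n" using A_gt n lnA by (simp add: y_def powr_def)
      finally have AA: "A ^ l * A ^ l \<le> real n" .
      have "real n * A ^ l \<le> (real n)\<^sup>2 * (1 / A) ^ l"
      proof -
        have "real n * (A ^ l * A ^ l) \<le> real n * real n" using AA by (intro mult_left_mono) auto
        then show ?thesis using A_gt by (simp add: power_divide pos_le_divide_eq power2_eq_square mult.assoc)
      qed
      also have "\<dots> \<le> (real n)\<^sup>2 * \<rho> ^ l"
        using A_gt by (intro mult_left_mono power_mono) (auto simp: \<rho>_def)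
      finally have 1: "real n * A ^ l \<le> (real n)\<^sup>2 * \<rho> ^ l" .
      have "expectation (\<lambda>\<omega>. (\<Sum>m=1..n. X m \<omega> - expectation (X m))\<^sup>2) \<le>
          real n * (3 * A ^ l) * K3 + (real n)\<^sup>2 * (K2 * sqrt q ^ l)"
        unfolding K3_def K2_def by (rule variance_le) (use False in simp)
      also have "\<dots> = 3 * K3 * (real n * A ^ l) + K2 * ((real n)\<^sup>2 * sqrt q ^ l)" by (simp add: algebra_simps)
      also have "\<dots> \<le> 3 * K3 * ((real n)\<^sup>2 * \<rho> ^ l) + K2 * ((real n)\<^sup>2 * \<rho> ^ l)"
        using q_bounds K3 K2 by (intro add_mono mult_left_mono 1 power_mono) (auto simp: \<rho>_def)
      finally show ?thesis by (simp add: algebra_simps)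
    qed
    have "\<rho> ^ l = \<rho> powr (real l)" using \<rho> by (simp add: powr_realpow)
    also have "\<dots> \<le> \<rho> powr (y - 1)" using \<rho> ly by (intro powr_mono') auto
    also have "\<dots> = \<rho> powr y / \<rho>" using \<rho> by (simp add: powr_diff)
    also have "\<rho> powr y = real n powr (- \<gamma>)"
      using \<rho> n by (simp add: powr_def y_def \<gamma>_def)
    finally have "(3 * K3 + K2) * (real n)\<^sup>2 * \<rho> ^ l \<le> (3 * K3 + K2) * (real n)\<^sup>2 * (real n powr (- \<gamma>) / \<rho>)"
      using K3 K2 by (intro mult_left_mono) auto
    then show ?thesis using Var by (simp add: C_def)
  qed
  then show thesis using \<gamma> that by blast
qed

lemma strong_law:
  assumes "(\<lambda>n. expectation (X n)) \<longlonglongrightarrow> \<mu>"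
  shows "AE \<omega> in M. (\<lambda>n. (\<Sum>m=1..n. X m \<omega>) / real n) \<longlonglongrightarrow> \<mu>"
proof -
  obtain C \<gamma> where "0 < \<gamma>"
    "\<And>n. 1 \<le> n \<Longrightarrow> expectation (\<lambda>\<omega>. (\<Sum>m=1..n. X m \<omega> - expectation (X m))\<^sup>2) \<le> C * (real n)\<^sup>2 * real n powr (- \<gamma>)"
    by (rule variance_power_bound) blast
  then show ?thesis
    by (intro strong_law_of_variance_bound[OF X_meas X_nonneg assms _ integrable_centered_square]) auto
qed

end

section \<open>Convergence in law and of means from convergence of point masses\<close>

context prob_space begin

lemma prob_finite_values:
  fixes Y :: "'a \<Rightarrow> nat"
  assumes [measurable]: "Y \<in> measurable M (count_space UNIV)" and F: "finite F"
  shows "prob {\<omega> \<in> space M. Y \<omega> \<in> F} = (\<Sum>x\<in>F. prob {\<omega> \<in> space M. Y \<omega> = x})"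
proof -
  have "{\<omega> \<in> space M. Y \<omega> \<in> F} = (\<Union>x\<in>F. {\<omega> \<in> space M. Y \<omega> = x})" by auto
  also have "prob \<dots> = (\<Sum>x\<in>F. prob {\<omega> \<in> space M. Y \<omega> = x})"
    by (rule finite_measure_finite_Union[OF F]) (auto simp: disjoint_family_on_def)
  finally show ?thesis .
qed

text \<open>The fourth moments supply tightness and uniform integrability: neither mass nor mean
  escapes to infinity, so the limits of the point masses form a probability distribution whose mean
  is the limit of the means.\<close>

lemma limit_law:
  fixes Y :: "nat \<Rightarrow> 'a \<Rightarrow> nat"
  assumes meas [measurable]: "\<And>n. Y n \<in> measurable M (count_space UNIV)"
    and int: "\<And>n. integrable M (\<lambda>\<omega>. real (Y n \<omega>) ^ 4)"
    and moment: "\<And>n. expectation (\<lambda>\<omega>. real (Y n \<omega>) ^ 4) \<le> C"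
    and conv: "\<And>x. convergent (\<lambda>n. prob {\<omega> \<in> space M. Y n \<omega> = x})"
  obtains P :: "nat pmf" where "integrable (measure_pmf P) real"
    "(\<lambda>n. expectation (\<lambda>\<omega>. real (Y n \<omega>))) \<longlonglongrightarrow> measure_pmf.expectation P real"
    "weak_conv_m (\<lambda>n. distr M borel (\<lambda>\<omega>. real (Y n \<omega>))) (distr (measure_pmf P) borel real)"
proof -
  define pn where "pn n x = prob {\<omega> \<in> space M. Y n \<omega> = x}" for n x
  define p where "p x = lim (\<lambda>n. pn n x)" for x
  have lim: "(\<lambda>n. pn n x) \<longlonglongrightarrow> p x" for x
    using conv[of x] by (simp add: convergent_LIMSEQ_iff p_def pn_def)
  have p0: "0 \<le> p x" for x
    by (rule LIMSEQ_le_const[OF lim]) (auto simp: pn_def)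
  have C: "0 \<le> C" by (rule order_trans[OF _ moment[of 0]]) (auto intro: integral_nonneg_AE)
  have le4: "real (Y n \<omega>) \<le> real (Y n \<omega>) ^ 4" for n \<omega>
    using power_increasing[of 1 4 "real (Y n \<omega>)"] by (cases "Y n \<omega>") auto
  have int1: "integrable M (\<lambda>\<omega>. real (Y n \<omega>))" for n
    by (rule Bochner_Integration.integrable_bound[OF int[of n]]) (use le4 in auto)
  have int_ind: "integrable M (indicat_real {\<omega> \<in> space M. Y n \<omega> = x})" for n x
    by (rule integrable_const_bound[where B = 1]) auto
  have trunc: "(\<Sum>x<N. g x * pn n x) = expectation (\<lambda>\<omega>. of_bool (Y n \<omega> < N) * g (Y n \<omega>))" for g :: "nat \<Rightarrow> real" and n N
  proof -
    have "of_bool (Y n \<omega> < N) * g (Y n \<omega>) = (\<Sum>x<N. g x * indicator {\<omega> \<in> space M. Y n \<omega> = x} \<omega>)" if "\<omega> \<in> space M" for \<omega>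
    proof -
      have "(\<Sum>x<N. g x * indicator {\<omega> \<in> space M. Y n \<omega> = x} \<omega>) = (\<Sum>x<N. if x = Y n \<omega> then g x else 0)"
        by (intro sum.cong) (use that in \<open>auto simp: indicator_def\<close>)
      then show ?thesis by simp
    qed
    then have "expectation (\<lambda>\<omega>. of_bool (Y n \<omega> < N) * g (Y n \<omega>)) =
      expectation (\<lambda>\<omega>. \<Sum>x<N. g x * indicator {\<omega> \<in> space M. Y n \<omega> = x} \<omega>)"
      by (intro Bochner_Integration.integral_cong) auto
    also have "\<dots> = (\<Sum>x<N. g x * pn n x)"
      by (subst Bochner_Integration.integral_sum) (auto simp: pn_def int_ind)
    finally show ?thesis by simp
  qed
  have tail: "expectation (\<lambda>\<omega>. of_bool (N \<le> Y n \<omega>) * real (Y n \<omega>) ^ i) \<le> C / real N"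
    and int_tail: "integrable M (\<lambda>\<omega>. of_bool (N \<le> Y n \<omega>) * real (Y n \<omega>) ^ i)" if "0 < N" "i \<le> 1" for n N i
  proof -
    \<comment> \<open>On \<open>N \<le> Y\<close> one has \<open>Y^i * N \<le> Y * Y^3\<close>. The
      exponent \<open>i = 0\<close> serves for the total mass, \<open>i = 1\<close> for the
      mean.\<close>
    have le: "of_bool (N \<le> Y n \<omega>) * real (Y n \<omega>) ^ i \<le> real (Y n \<omega>) ^ 4 / real N" for \<omega>
    proof (cases "N \<le> Y n \<omega>")
      case True
      then have "1 \<le> real (Y n \<omega>)" using that(1) by simp
      then have "real (Y n \<omega>) ^ i * real N \<le> real (Y n \<omega>) ^ 1 * real (Y n \<omega>) ^ 3"
        using that(2) True power_increasing[of 1 3 "real (Y n \<omega>)"]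
        by (intro mult_mono power_increasing) auto
      also have "\<dots> = real (Y n \<omega>) ^ 4" by (simp add: power3_eq_cube power4_eq_xxxx)
      finally show ?thesis using that(1) True by (simp add: pos_le_divide_eq)
    qed simp
    show intt: "integrable M (\<lambda>\<omega>. of_bool (N \<le> Y n \<omega>) * real (Y n \<omega>) ^ i)"
      by (rule Bochner_Integration.integrable_bound[OF integrable_divide[OF int[of n], of "real N"]])
         (use le in \<open>auto simp: abs_of_nonneg\<close>)
    have "expectation (\<lambda>\<omega>. of_bool (N \<le> Y n \<omega>) * real (Y n \<omega>) ^ i) \<le> expectation (\<lambda>\<omega>. real (Y n \<omega>) ^ 4 / real N)"
      by (intro integral_mono intt integrable_divide int le)
    also have "\<dots> \<le> C / real N" using moment[of n] by (simp add: divide_right_mono)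
    finally show "expectation (\<lambda>\<omega>. of_bool (N \<le> Y n \<omega>) * real (Y n \<omega>) ^ i) \<le> C / real N" .
  qed
  have split: "expectation (\<lambda>\<omega>. real (Y n \<omega>) ^ i) =
      (\<Sum>x<N. real x ^ i * pn n x) + expectation (\<lambda>\<omega>. of_bool (N \<le> Y n \<omega>) * real (Y n \<omega>) ^ i)"
    if "0 < N" "i \<le> 1" for n N i
  proof -
    have "integrable M (\<lambda>\<omega>. of_bool (Y n \<omega> < N) * real (Y n \<omega>) ^ i)"
    proof (rule integrable_const_bound[where B = "real N ^ i"])
      show "AE \<omega> in M. norm (of_bool (Y n \<omega> < N) * real (Y n \<omega>) ^ i) \<le> real N ^ i"
        by (auto intro!: power_mono)
    qed measurable
    then have "(\<Sum>x<N. real x ^ i * pn n x) + expectation (\<lambda>\<omega>. of_bool (N \<le> Y n \<omega>) * real (Y n \<omega>) ^ i) =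
      expectation (\<lambda>\<omega>. of_bool (Y n \<omega> < N) * real (Y n \<omega>) ^ i + of_bool (N \<le> Y n \<omega>) * real (Y n \<omega>) ^ i)"
      unfolding trunc by (rule Bochner_Integration.integral_add[OF _ int_tail[OF that], symmetric])
    also have "\<dots> = expectation (\<lambda>\<omega>. real (Y n \<omega>) ^ i)"
      by (intro Bochner_Integration.integral_cong) auto
    finally show ?thesis by simp
  qed
  have limsum: "(\<lambda>n. \<Sum>x<N. g x * pn n x) \<longlonglongrightarrow> (\<Sum>x<N. g x * p x)" for g :: "nat \<Rightarrow> real" and N
    by (intro tendsto_sum tendsto_mult_left lim)
  have squeeze: "(\<Sum>x<N. real x ^ i * pn n x) \<le> expectation (\<lambda>\<omega>. real (Y n \<omega>) ^ i)"
    "expectation (\<lambda>\<omega>. real (Y n \<omega>) ^ i) \<le> (\<Sum>x<N. real x ^ i * pn n x) + C / real N"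
    if "0 < N" "i \<le> 1" for n N i
    using split[OF that, of n] tail[OF that, of n] 
      integral_nonneg_AE[of "\<lambda>\<omega>. of_bool (N \<le> Y n \<omega>) * real (Y n \<omega>) ^ i" M] by auto
  \<comment> \<open>In the limit the partial sums up to \<open>N\<close> lie between
    \<open>1 - C / N\<close> and 1, which rules out escaping mass.\<close>
  have p_sums: "p sums 1"
    unfolding sums_def
  proof (rule tendsto_sandwich)
    have le1: "(\<Sum>x<N. p x) \<le> 1" and ge1: "1 - C / real N \<le> (\<Sum>x<N. p x)" if "0 < N" for N
    proof -
      have L: "(\<lambda>n. \<Sum>x<N. real x ^ 0 * pn n x) \<longlonglongrightarrow> (\<Sum>x<N. real x ^ 0 * p x)" by (rule limsum)
      have "(\<Sum>x<N. real x ^ 0 * p x) \<le> 1"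
        by (rule LIMSEQ_le_const2[OF L]) (use squeeze(1)[OF that, of 0] in \<open>auto simp: prob_space\<close>)
      then show "(\<Sum>x<N. p x) \<le> 1" by simp
      have "1 - C / real N \<le> (\<Sum>x<N. real x ^ 0 * p x)"
        by (rule LIMSEQ_le_const[OF L]) (use squeeze(2)[OF that, of 0] in \<open>auto simp: prob_space diff_le_eq\<close>)
      then show "1 - C / real N \<le> (\<Sum>x<N. p x)" by simp
    qed
    show "\<forall>\<^sub>F N in sequentially. (\<Sum>x<N. p x) \<le> 1"
      "\<forall>\<^sub>F N in sequentially. 1 - C / real N \<le> (\<Sum>x<N. p x)"
      using eventually_gt_at_top[of "0 :: nat"] by (eventually_elim; use le1 ge1 in simp)+
    have "(\<lambda>N. 1 - C * (1 / real N)) \<longlonglongrightarrow> 1 - C * 0"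
      by (intro tendsto_intros lim_1_over_n)
    then show "(\<lambda>N. 1 - C / real N) \<longlonglongrightarrow> 1" by simp
  qed simp
  define P where "P = embed_pmf p"
  have pmf_P: "pmf P x = p x" for x
    unfolding P_def
  proof (rule pmf_embed_pmf)
    have "(\<integral>\<^sup>+x. ennreal (p x) \<partial>count_space UNIV) = (\<Sum>x. ennreal (p x))" by (rule nn_integral_count_space_nat)
    also have "\<dots> = ennreal (\<Sum>x. p x)" by (rule suminf_ennreal2[OF p0 sums_summable[OF p_sums]])
    finally show "(\<integral>\<^sup>+x. ennreal (p x) \<partial>count_space UNIV) = 1" using sums_unique[OF p_sums] by simp
  qed (rule p0)
  \<comment> \<open>A discrete Fatou argument: the partial means of the limit inherit the bound
    \<open>C\<close>, so the limit law has a finite mean.\<close>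
  have partial_le: "(\<Sum>x<N. real x * p x) \<le> C" for N
  proof (rule LIMSEQ_le_const2[OF limsum[of real N]])
    have "(\<Sum>x<N. real x * pn n x) \<le> C" for n
    proof (cases "N = 0")
      case False
      have "(\<Sum>x<N. real x * pn n x) \<le> expectation (\<lambda>\<omega>. real (Y n \<omega>))" using squeeze(1)[of N 1 n] False by simp
      also have "\<dots> \<le> expectation (\<lambda>\<omega>. real (Y n \<omega>) ^ 4)" by (intro integral_mono int1 int le4)
      finally show ?thesis using moment[of n] by simp
    qed (use C in simp)
    then show "\<exists>N'. \<forall>n\<ge>N'. (\<Sum>x<N. real x * pn n x) \<le> C" by blast
  qed
  have summ: "summable (\<lambda>x. real x * p x)"
    by (rule summableI_nonneg_bounded[where x = C]) (use p0 partial_le in auto)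
  define m where "m = (\<Sum>x. real x * p x)"
  have intP: "integrable (measure_pmf P) real"
    unfolding measure_pmf_eq_density using summ p0
    by (subst integrable_density) (auto simp: integrable_count_space_nat_iff pmf_P abs_mult mult.commute)
  have expP: "measure_pmf.expectation P real = m"
    unfolding measure_pmf_eq_density m_def
    by (subst integral_density, simp, simp, simp)
       (subst integral_count_space_nat, use summ p0 in \<open>auto simp: integrable_count_space_nat_iff pmf_P abs_mult mult.commute\<close>)
  have mean: "(\<lambda>n. expectation (\<lambda>\<omega>. real (Y n \<omega>))) \<longlonglongrightarrow> m"
  proof (rule LIMSEQ_I)
    fix e :: real assume e: "0 < e"
    have "(\<lambda>N. \<Sum>x<N. real x * p x) \<longlonglongrightarrow> m" unfolding m_def using summ by (rule summable_LIMSEQ)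
    then have ev1: "\<forall>\<^sub>F N in sequentially. m - e / 2 < (\<Sum>x<N. real x * p x)" using e by (intro order_tendstoD(1)) auto
    have "(\<lambda>N. C * (1 / real N)) \<longlonglongrightarrow> C * 0" by (intro tendsto_intros lim_1_over_n)
    then have ev2: "\<forall>\<^sub>F N in sequentially. C * (1 / real N) < e / 2" using e by (intro order_tendstoD(2)) auto
    have "\<forall>\<^sub>F N in sequentially. 0 < N \<and> m - e / 2 < (\<Sum>x<N. real x * p x) \<and> C / real N < e / 2"
      using ev1 ev2 eventually_gt_at_top[of "0 :: nat"] by eventually_elim simp
    \<comment> \<open>At this \<open>N\<close> both the tail of the limiting mean and the tail bound
      \<open>C / N\<close>, uniform in \<open>n\<close>, are below \<open>e / 2\<close>; only a
      finite sum remains, and it converges.\<close>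
    then obtain N where N: "0 < N" "m - e / 2 < (\<Sum>x<N. real x * p x)" "C / real N < e / 2"
      unfolding eventually_sequentially by blast
    have Nm: "(\<Sum>x<N. real x * p x) \<le> m" unfolding m_def by (rule sum_le_suminf[OF summ]) (auto simp: p0)
    have "\<forall>\<^sub>F n in sequentially. m - e / 2 < (\<Sum>x<N. real x * pn n x)"
      by (rule order_tendstoD(1)[OF limsum N(2)])
    moreover have "\<forall>\<^sub>F n in sequentially. (\<Sum>x<N. real x * pn n x) < m + e / 2"
      by (rule order_tendstoD(2)[OF limsum]) (use Nm e in simp)
    ultimately have "\<forall>\<^sub>F n in sequentially. norm (expectation (\<lambda>\<omega>. real (Y n \<omega>)) - m) < e"
    proof eventually_elim
      case (elim n)
      have "(\<Sum>x<N. real x * pn n x) \<le> expectation (\<lambda>\<omega>. real (Y n \<omega>))"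
        "expectation (\<lambda>\<omega>. real (Y n \<omega>)) \<le> (\<Sum>x<N. real x * pn n x) + C / real N"
        using squeeze[of N 1 n] N(1) by simp_all
      then show ?case unfolding real_norm_def abs_less_iff using elim N(3) by linarith
    qed
    then show "\<exists>no. \<forall>n\<ge>no. norm (expectation (\<lambda>\<omega>. real (Y n \<omega>)) - m) < e"
      by (simp add: eventually_sequentially)
  qed
  have weak: "weak_conv_m (\<lambda>n. distr M borel (\<lambda>\<omega>. real (Y n \<omega>))) (distr (measure_pmf P) borel real)"
    unfolding weak_conv_m_def weak_conv_def
  proof (intro allI impI)
    fix y :: real
    \<comment> \<open>Only finitely many naturals lie below \<open>y\<close>, so the distribution
      functions converge as finite sums, at every \<open>y\<close> and not merely at continuity
      points.\<close>
    define F where "F = {x :: nat. real x \<le> y}"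
    have "F \<subseteq> {..nat \<lfloor>y\<rfloor>}" by (auto simp: F_def le_nat_floor)
    then have fin: "finite F" by (rule finite_subset) simp
    have "cdf (distr M borel (\<lambda>\<omega>. real (Y n \<omega>))) y = (\<Sum>x\<in>F. pn n x)" for n
    proof -
      have "cdf (distr M borel (\<lambda>\<omega>. real (Y n \<omega>))) y = prob {\<omega> \<in> space M. Y n \<omega> \<in> F}"
        by (auto simp: cdf_def measure_distr F_def vimage_def Int_def intro!: arg_cong[where f = prob])
      then show ?thesis using prob_finite_values[OF meas fin] by (simp add: pn_def)
    qed
    moreover have "cdf (distr (measure_pmf P) borel real) y = (\<Sum>x\<in>F. p x)"
    proof -
      have "cdf (distr (measure_pmf P) borel real) y = measure_pmf.prob P F"
        by (simp add: cdf_def measure_distr F_def vimage_def)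
      then show ?thesis using fin by (simp add: measure_measure_pmf_finite pmf_P)
    qed
    ultimately show "(\<lambda>n. cdf (distr M borel (\<lambda>\<omega>. real (Y n \<omega>))) y) \<longlonglongrightarrow> cdf (distr (measure_pmf P) borel real) y"
      by (simp add: tendsto_sum lim)
  qed
  show thesis by (rule that[OF intP _ weak]) (simp add: mean expP)
qed

end

section \<open>The chain of reference lists in a fixed environment\<close>

text \<open>Blocks are named by their index, with 0 for genesis. Such names are free of the random
  identifiers and can be translated, which regeneration requires.\<close>

definition idx_tips :: "(nat \<Rightarrow> nat list) \<Rightarrow> nat set \<Rightarrow> nat set" where
  "idx_tips f J = insert 0 J - (\<Union>m\<in>J. set (f m))"

text \<open>The entry \<open>z j\<close> of an environment carries the primitives of block \<open>j + 1\<close>. Gaps are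
  truncated at \<open>0\<close> here, and delays at \<open>\<Delta>\<close> in \<open>sees\<close> below: almost surely this changes
  nothing, and the facts on a fixed environment then hold without exceptional null sets.\<close>

type_synonym 'n env = "nat \<Rightarrow> real \<times> real \<times> 'n \<times> (real ^ 'n)"

definition gap :: "'n::finite env \<Rightarrow> nat \<Rightarrow> real" where
  "gap z m = max 0 (fst (z (m - 1)))"

definition issuer_of :: "'n::finite env \<Rightarrow> nat \<Rightarrow> 'n" where
  "issuer_of z m = fst (snd (snd (z (m - 1))))"

definition delay_of :: "'n::finite env \<Rightarrow> nat \<Rightarrow> 'n \<Rightarrow> real" where
  "delay_of z m i = snd (snd (snd (z (m - 1)))) $ i"

definition env_shift :: "nat \<Rightarrow> (nat \<Rightarrow> 'b) \<Rightarrow> nat \<Rightarrow> 'b" where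
  "env_shift s z = (\<lambda>j. z (s + j))"

lemma gap_nonneg [simp]: "0 \<le> gap z m"
  by (simp add: gap_def)

lemma gap_shift: "1 \<le> m \<Longrightarrow> gap (env_shift s z) m = gap z (s + m)"
  by (simp add: gap_def env_shift_def)

lemma issuer_shift: "1 \<le> m \<Longrightarrow> issuer_of (env_shift s z) m = issuer_of z (s + m)"
  by (simp add: issuer_of_def env_shift_def)

lemma delay_shift: "1 \<le> m \<Longrightarrow> delay_of (env_shift s z) m = delay_of z (s + m)"
  by (rule ext) (simp add: delay_of_def env_shift_def)

text \<open>The continuation \<open>h\<close> is a history in its own numbering: its genesis 0
  becomes block \<open>s\<close>, and its block \<open>m\<close> becomes block
  \<open>s + m\<close>.\<close>

definition glue :: "nat \<Rightarrow> (nat \<Rightarrow> nat list) \<Rightarrow> (nat \<Rightarrow> nat list) \<Rightarrow> nat \<Rightarrow> nat list" where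
  "glue s f h = (\<lambda>m. if m \<le> s then f m else map ((+) s) (h (m - s)))"

lemma finite_idx_tips: "finite J \<Longrightarrow> finite (idx_tips f J)"
  by (simp add: idx_tips_def)

lemma idx_tips_cong: "(\<And>m. m \<in> J \<Longrightarrow> f m = g m) \<Longrightarrow> idx_tips f J = idx_tips g J"
  by (auto simp: idx_tips_def)

text \<open>With the next lemma this bounds the disagreement between the view \<open>J\<close> of a
  node and the view \<open>A\<close> of the observer: in one direction by the references of the
  blocks still under way, in the other by these blocks themselves.\<close>

lemma idx_tips_diff_subset: "idx_tips f J - idx_tips f A \<subseteq> (\<Union>m\<in>A - J. set (f m))" if "J \<subseteq> A"
  using that by (auto simp: idx_tips_def)

lemma idx_tips_diff_subset': "idx_tips f A - idx_tips f J \<subseteq> A - J" if "J \<subseteq> A"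
  using that by (auto simp: idx_tips_def)

lemma finite_draws: "finite S \<Longrightarrow> finite (draws k S)"
proof -
  assume S: "finite S"
  have "draws k S \<subseteq> {xs. set xs \<subseteq> S \<and> length xs = min k (card S)}"
    by (auto simp: draws_def)
  then show ?thesis
    using finite_lists_length_eq[OF S] by (rule finite_subset)
qed

lemma draws_nonempty: "finite S \<Longrightarrow> draws k S \<noteq> {}"
proof -
  assume S: "finite S"
  obtain xs where "distinct xs" "set xs = S" using finite_distinct_list[OF S] by blast
  then have "take (min k (card S)) xs \<in> draws k S"
    using set_take_subset[of "min k (card S)" xs] distinct_card[of xs] by (auto simp: draws_def)
  then show ?thesis by blast
qed

text \<open>Uniform draws are thus equivariant under injective renaming. This serves for the
  translation of indices at a regeneration and for the passage from indices to identifiers.\<close>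

lemma draws_image: "inj_on g S \<Longrightarrow> draws k (g ` S) = map g ` draws k S"
proof -
  assume g: "inj_on g S"
  have c: "card (g ` S) = card S" by (rule card_image[OF g])
  show ?thesis
  proof (intro equalityI subsetI)
    fix xs assume xs: "xs \<in> draws k (g ` S)"
    define ys where "ys = map (the_inv_into S g) xs"
    have sub: "set xs \<subseteq> g ` S" using xs by (simp add: draws_def)
    have 1: "map g ys = xs"
      unfolding ys_def map_map by (rule map_idI) (use sub g in \<open>auto simp: f_the_inv_into_f\<close>)
    have 2: "set ys \<subseteq> S"
      using sub g by (auto simp: ys_def the_inv_into_f_f)
    have "distinct ys" using xs 1 by (auto simp: draws_def distinct_map)
    then have "ys \<in> draws k S" using 2 xs c by (auto simp: draws_def ys_def)
    then show "xs \<in> map g ` draws k S" using 1 by force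
  next
    fix xs assume "xs \<in> map g ` draws k S"
    then show "xs \<in> draws k (g ` S)"
      using g c by (fastforce simp: draws_def distinct_map intro: inj_on_subset)
  qed
qed

lemma inj_on_map_draws: "inj_on g S \<Longrightarrow> inj_on (map g) (draws k S)"
  by (rule inj_on_subset[OF inj_on_mapI[where A = "draws k S"]])
     (auto simp: draws_def intro: inj_on_subset)

locale reference_model =
  fixes k :: nat and \<Delta> :: real
  assumes k_ge_2: "k \<ge> 2" and Delta_nonneg: "\<Delta> \<ge> 0"
begin

text \<open>The observer is the node \<open>None\<close>.\<close>

definition sees :: "'n::finite env \<Rightarrow> nat \<Rightarrow> nat \<Rightarrow> 'n option \<Rightarrow> bool" where
  "sees z m n a = (case a of None \<Rightarrow> True | Some i \<Rightarrow> min \<Delta> (delay_of z m i) \<le> (\<Sum>j\<in>{m<..n}. gap z j))"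

text \<open>\<open>N\<close> bounds the indices and \<open>n\<close> sets the date. The pool before
  the issue of block \<open>Suc n\<close> takes the blocks up to \<open>n\<close> at the date of
  \<open>Suc n\<close>; in the pool after the issue of block \<open>n\<close> both are
  \<open>n\<close>.\<close>

definition seen :: "'n::finite env \<Rightarrow> nat \<Rightarrow> nat \<Rightarrow> 'n option \<Rightarrow> nat set" where
  "seen z N n a = {m \<in> {1..N}. sees z m n a}"

definition pool_size :: "'n::finite env \<Rightarrow> (nat \<Rightarrow> nat list) \<Rightarrow> nat \<Rightarrow> 'n option \<Rightarrow> nat" where
  "pool_size z f n a = card (idx_tips f (seen z n n a))"

definition prepool :: "'n::finite env \<Rightarrow> (nat \<Rightarrow> nat list) \<Rightarrow> nat \<Rightarrow> nat set" where
  "prepool z f n = idx_tips f (seen z n (Suc n) (Some (issuer_of z (Suc n))))"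

definition tip_count :: "nat \<Rightarrow> (nat \<Rightarrow> nat list) \<Rightarrow> nat" where
  "tip_count n f = card (idx_tips f {1..n})"

definition step :: "'n::finite env \<Rightarrow> nat \<Rightarrow> (nat \<Rightarrow> nat list) \<Rightarrow> (nat \<Rightarrow> nat list) pmf" where
  "step z n f = map_pmf (\<lambda>r. f(Suc n := r)) (pmf_of_set (draws k (prepool z f n)))"

primrec run :: "'n::finite env \<Rightarrow> nat \<Rightarrow> nat \<Rightarrow> (nat \<Rightarrow> nat list) \<Rightarrow> (nat \<Rightarrow> nat list) pmf" where
  "run z n 0 f = return_pmf f"
| "run z n (Suc j) f = bind_pmf (run z n j f) (step z (n + j))"

text \<open>Lists beyond \<open>n\<close> are empty, so there are finitely many histories at each
  time although one function type serves all times. The condition at \<open>m = 0\<close> leaves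
  genesis without references.\<close>

definition wf_hist :: "nat \<Rightarrow> (nat \<Rightarrow> nat list) set" where
  "wf_hist n = {f. (\<forall>m. set (f m) \<subseteq> {..<m}) \<and> (\<forall>m. length (f m) \<le> k) \<and> (\<forall>m>n. f m = [])}"

text \<open>Length of the run of gaps not exceeding \<open>\<Delta>\<close> that ends with gap
  \<open>n\<close>. It measures how many recent blocks may still be hidden from some node.\<close>

primrec runlen :: "'n::finite env \<Rightarrow> nat \<Rightarrow> nat" where
  "runlen z 0 = 0"
| "runlen z (Suc n) = (if gap z (Suc n) > \<Delta> then 0 else Suc (runlen z n))"

lemma run_add: "run z n (i + j) f = bind_pmf (run z n i f) (run z (n + i) j)"
proof (induction j)
  case 0 then show ?case by (simp add: bind_return_pmf')
next
  case (Suc j) then show ?case by (simp add: bind_assoc_pmf add.assoc)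
qed

lemma seen_subset: "seen z N n a \<subseteq> {1..N}"
  by (auto simp: seen_def)

lemma finite_seen [simp]: "finite (seen z N n a)"
  by (rule finite_subset[OF seen_subset]) simp

lemma finite_prepool [simp]: "finite (prepool z f n)"
  by (simp add: prepool_def finite_idx_tips)

lemma prepool_subset: "prepool z f n \<subseteq> {..n}"
  by (auto simp: prepool_def idx_tips_def seen_def)

lemma set_step: "set_pmf (step z n f) = (\<lambda>r. f(Suc n := r)) ` draws k (prepool z f n)"
  by (simp add: step_def set_pmf_of_set finite_draws draws_nonempty)

lemma wf_step: "f \<in> wf_hist n \<Longrightarrow> g \<in> set_pmf (step z n f) \<Longrightarrow> g \<in> wf_hist (Suc n)"
proof -
  assume f: "f \<in> wf_hist n" and "g \<in> set_pmf (step z n f)"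
  then obtain r where r: "r \<in> draws k (prepool z f n)" and g: "g = f(Suc n := r)"
    by (auto simp: set_step)
  have "set r \<subseteq> {..n}" using r prepool_subset[of z f n] by (auto simp: draws_def)
  moreover have "length r \<le> k" using r by (simp add: draws_def)
  ultimately show ?thesis using f by (auto simp: wf_hist_def g less_Suc_eq_le)
qed

lemma run_support:
  assumes "f \<in> wf_hist n" "g \<in> set_pmf (run z n j f)"
  shows "g \<in> wf_hist (n + j)" "\<And>m. m \<le> n \<Longrightarrow> g m = f m"
proof -
  have "g \<in> wf_hist (n + j) \<and> (\<forall>m\<le>n. g m = f m)"
    using assms(2)
  proof (induction j arbitrary: g)
    case 0 then show ?case using assms(1) by simp
  next
    case (Suc j)
    then obtain h where h: "h \<in> set_pmf (run z n j f)" "g \<in> set_pmf (step z (n + j) h)" by auto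
    then have "g \<in> wf_hist (n + Suc j)" using Suc.IH[OF h(1)] wf_step by fastforce
    moreover have "\<forall>m\<le>n. g m = h m" using h(2) by (auto simp: set_step)
    ultimately show ?case using Suc.IH[OF h(1)] by simp
  qed
  then show "g \<in> wf_hist (n + j)" "\<And>m. m \<le> n \<Longrightarrow> g m = f m" by auto
qed

lemma finite_set_run: "finite (set_pmf (run z n j f))"
  by (induction j) (auto simp: set_step finite_draws)

lemma wf_hist_0: "wf_hist 0 = {\<lambda>_. []}"
  by (auto simp: wf_hist_def fun_eq_iff) (metis ex_in_conv gr0I less_zeroE list.set_intros(1) neq_Nil_conv subset_iff lessThan_iff)

lemma finite_wf_hist: "finite (wf_hist n)"
proof -
  have "wf_hist n \<subseteq> {f. \<forall>m. (m \<in> {..n} \<longrightarrow> f m \<in> {xs. set xs \<subseteq> {..<n} \<and> length xs \<le> k}) \<and> (m \<notin> {..n} \<longrightarrow> f m = [])}"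
  proof (rule subsetI, rule CollectI, intro allI conjI impI)
    fix f m assume f: "f \<in> wf_hist n" and m: "m \<in> {..n}"
    have "set (f m) \<subseteq> {..<m}" "length (f m) \<le> k" using f by (auto simp: wf_hist_def)
    moreover have "{..<m} \<subseteq> {..<n}" using m by auto
    ultimately show "f m \<in> {xs. set xs \<subseteq> {..<n} \<and> length xs \<le> k}" by auto
  next
    fix f m assume "f \<in> wf_hist n" "m \<notin> {..n}"
    then show "f m = []" by (simp add: wf_hist_def)
  qed
  moreover have "finite {f. \<forall>m. (m \<in> {..n} \<longrightarrow> f m \<in> {xs::nat list. set xs \<subseteq> {..<n} \<and> length xs \<le> k}) \<and> (m \<notin> {..n} \<longrightarrow> f m = [])}"
    by (intro finite_set_of_finite_funs finite_lists_length_le) auto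
  ultimately show ?thesis by (rule finite_subset)
qed

lemma last_in_tips: "f \<in> wf_hist N \<Longrightarrow> n \<in> idx_tips f {1..n}"
  by (fastforce simp: idx_tips_def wf_hist_def)

lemma tip_count_pos: "f \<in> wf_hist N \<Longrightarrow> 1 \<le> tip_count n f"
  using last_in_tips[of f N n] by (auto simp: tip_count_def Suc_le_eq card_gt_0_iff finite_idx_tips)

text \<open>References point strictly backwards, so the latest block is always a tip; a single tip
  can only be block \<open>n\<close> itself.\<close>

lemma tip_count_eq_1: "f \<in> wf_hist N \<Longrightarrow> tip_count n f = 1 \<Longrightarrow> idx_tips f {1..n} = {n}"
  using last_in_tips[of f N n] by (auto simp: tip_count_def card_1_singleton_iff)

text \<open>\<open>sees\<close> truncates delays at \<open>\<Delta>\<close>, so one gap beyond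
  \<open>\<Delta>\<close> after the issue outweighs any delay, the other gaps being
  nonnegative.\<close>

lemma sees_big_gap:
  assumes "gap z j > \<Delta>" "m < j" "j \<le> n"
  shows "sees z m n a"
proof (cases a)
  case (Some i)
  have "gap z j \<le> (\<Sum>j\<in>{m<..n}. gap z j)"
    by (rule member_le_sum) (use assms in auto)
  then show ?thesis using assms by (simp add: sees_def Some)
qed (simp add: sees_def)

lemma runlen_ge: "m \<le> n \<Longrightarrow> (\<And>j. m < j \<Longrightarrow> j \<le> n \<Longrightarrow> \<not> gap z j > \<Delta>) \<Longrightarrow> n - m \<le> runlen z n"
proof (induction n)
  case (Suc n)
  show ?case
  proof (cases "m = Suc n")
    case False
    then have "n - m \<le> runlen z n" "\<not> gap z (Suc n) > \<Delta>" using Suc by auto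
    then show ?thesis using Suc.prems(1) False by auto
  qed auto
qed auto

lemma unseen_runlen: "m \<le> n \<Longrightarrow> \<not> sees z m n a \<Longrightarrow> n - m \<le> runlen z n"
  using sees_big_gap by (intro runlen_ge) blast+

lemma unseen_pre: "card ({1..n} - seen z n (Suc n) a) \<le> runlen z (Suc n)"
proof -
  have "{1..n} - seen z n (Suc n) a \<subseteq> {Suc n - runlen z (Suc n)..<Suc n}"
  proof
    fix m assume "m \<in> {1..n} - seen z n (Suc n) a"
    then show "m \<in> {Suc n - runlen z (Suc n)..<Suc n}"
      using unseen_runlen[of m "Suc n" z a] by (auto simp: seen_def)
  qed
  then have "card ({1..n} - seen z n (Suc n) a) \<le> card {Suc n - runlen z (Suc n)..<Suc n}"
    by (intro card_mono) auto
  then show ?thesis by simp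
qed

text \<open>The summand 1, absent in the count before an issue, accounts for block \<open>n\<close>,
  which has just been issued and need not have reached node \<open>a\<close>.\<close>

lemma unseen_post: "card ({1..n} - seen z n n a) \<le> runlen z n + 1"
proof -
  have "{1..n} - seen z n n a \<subseteq> {n - runlen z n..<Suc n}"
  proof
    fix m assume "m \<in> {1..n} - seen z n n a"
    then show "m \<in> {n - runlen z n..<Suc n}"
      using unseen_runlen[of m n z a] by (auto simp: seen_def)
  qed
  then have "card ({1..n} - seen z n n a) \<le> card {n - runlen z n..<Suc n}"
    by (intro card_mono) auto
  then show ?thesis by simp
qed

lemma card_refs_le: "f \<in> wf_hist N \<Longrightarrow> finite A \<Longrightarrow> card (\<Union>m\<in>A. set (f m)) \<le> k * card A"
proof -
  assume f: "f \<in> wf_hist N" and A: "finite A"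
  have "card (\<Union>m\<in>A. set (f m)) \<le> (\<Sum>m\<in>A. card (set (f m)))" by (rule card_UN_le[OF A])
  also have "\<dots> \<le> (\<Sum>m\<in>A. k)"
  proof (rule sum_mono)
    fix m
    have "length (f m) \<le> k" using f by (simp add: wf_hist_def)
    then show "card (set (f m)) \<le> k" using card_length[of "f m"] by simp
  qed
  finally show ?thesis by (simp add: mult.commute)
qed

text \<open>A local tip that is no tip for the observer has been referenced by a block that has not
  arrived. By \<open>unseen_post\<close> there are at most \<open>runlen z n + 1\<close> such
  blocks, each with at most \<open>k\<close> references.\<close>

lemma pool_size_le:
  assumes "f \<in> wf_hist N"
  shows "pool_size z f n a \<le> tip_count n f + k * (runlen z n + 1)"
proof -
  let ?V = "seen z n n a" and ?O = "idx_tips f {1..n}"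
  have "idx_tips f ?V \<subseteq> ?O \<union> (idx_tips f ?V - ?O)" by blast
  then have "card (idx_tips f ?V) \<le> card (?O \<union> (idx_tips f ?V - ?O))"
    by (intro card_mono) (auto intro: finite_idx_tips)
  also have "\<dots> \<le> card ?O + card (idx_tips f ?V - ?O)" by (rule card_Un_le)
  also have "card (idx_tips f ?V - ?O) \<le> card (\<Union>m\<in>{1..n} - ?V. set (f m))"
    by (intro card_mono idx_tips_diff_subset seen_subset) auto
  also have "\<dots> \<le> k * card ({1..n} - ?V)" by (rule card_refs_le[OF assms]) simp
  also have "\<dots> \<le> k * (runlen z n + 1)" by (intro mult_left_mono unseen_post) simp
  finally show ?thesis by (simp add: pool_size_def tip_count_def)
qed

lemma tip_count_update:
  assumes "f \<in> wf_hist n" "set r \<subseteq> {..n}"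
  shows "tip_count (Suc n) (f(Suc n := r)) = Suc (card (idx_tips f {1..n} - set r))"
proof -
  have "idx_tips (f(Suc n := r)) {1..Suc n} = insert (Suc n) (idx_tips f {1..n} - set r)"
    using assms by (fastforce simp: idx_tips_def wf_hist_def atLeastAtMostSuc_conv)
  moreover have "Suc n \<notin> idx_tips f {1..n}" by (auto simp: idx_tips_def)
  ultimately show ?thesis by (simp add: tip_count_def finite_idx_tips)
qed

lemma tip_count_step_le:
  assumes "f \<in> wf_hist n" "g \<in> set_pmf (step z n f)"
  shows "tip_count (Suc n) g \<le> Suc (tip_count n f)"
proof -
  obtain r where r: "r \<in> draws k (prepool z f n)" "g = f(Suc n := r)"
    using assms by (auto simp: set_step)
  have "set r \<subseteq> {..n}" using r prepool_subset[of z f n] by (auto simp: draws_def)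
  then have "tip_count (Suc n) g = Suc (card (idx_tips f {1..n} - set r))"
    using tip_count_update assms r by simp
  moreover have "card (idx_tips f {1..n} - set r) \<le> card (idx_tips f {1..n})"
    by (intro card_mono) (auto intro: finite_idx_tips)
  ultimately show ?thesis by (simp add: tip_count_def)
qed

text \<open>After a long gap the issuer draws from the true tips. If there are at least two, it
  removes at least two of them, since \<open>k \<ge> 2\<close>, and adds one; a single tip is
  replaced by the new block.\<close>

lemma tip_count_step_big_gap:
  assumes "f \<in> wf_hist n" "g \<in> set_pmf (step z n f)" "gap z (Suc n) > \<Delta>"
  shows "tip_count (Suc n) g \<le> max 1 (tip_count n f - 1)"
proof -
  let ?O = "idx_tips f {1..n}"
  have "seen z n (Suc n) a = {1..n}" for a
    using sees_big_gap[OF assms(3)] by (auto simp: seen_def)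
  then have "prepool z f n = ?O" by (simp add: prepool_def)
  then obtain r where r: "r \<in> draws k ?O" "g = f(Suc n := r)"
    using assms by (auto simp: set_step)
  have "set r \<subseteq> {..n}" using r by (auto simp: draws_def idx_tips_def)
  then have "tip_count (Suc n) g = Suc (card (?O - set r))"
    using tip_count_update assms r by simp
  also have "card (?O - set r) = card ?O - min k (card ?O)"
    using r by (subst card_Diff_subset) (auto simp: draws_def distinct_card)
  finally show ?thesis using k_ge_2 by (simp add: tip_count_def)
qed

lemma collapse:
  assumes "f \<in> wf_hist n" "g \<in> set_pmf (run z n j f)"
    and "\<And>i. i \<in> {1..j} \<Longrightarrow> gap z (n + i) > \<Delta>"
  shows "tip_count (n + j) g \<le> max 1 (tip_count n f - j)"
  using assms(2,3)
proof (induction j arbitrary: g)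
  case (Suc j)
  then obtain h where h: "h \<in> set_pmf (run z n j f)" "g \<in> set_pmf (step z (n + j) h)" by auto
  have "tip_count (Suc (n + j)) g \<le> max 1 (tip_count (n + j) h - 1)"
    using tip_count_step_big_gap[OF run_support(1)[OF assms(1) h(1)] h(2)] Suc.prems(2)[of "Suc j"] by simp
  moreover have "tip_count (n + j) h \<le> max 1 (tip_count n f - j)"
    using Suc.IH[OF h(1)] Suc.prems(2) by simp
  ultimately show ?case by (auto simp: max_def split: if_splits)
qed simp

lemma sees_shift: "1 \<le> m \<Longrightarrow> sees (env_shift s z) m n a = sees z (s + m) (s + n) a"
proof -
  assume m: "1 \<le> m"
  have "(\<Sum>j\<in>{m<..n}. gap (env_shift s z) j) = (\<Sum>j\<in>{m<..n}. gap z (s + j))"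
    by (intro sum.cong) (auto simp: gap_shift)
  also have "\<dots> = (\<Sum>j\<in>(+) s ` {m<..n}. gap z j)"
    by (subst sum.reindex) auto
  also have "(+) s ` {m<..n} = {s + m<..s + n}" 
    by (simp add: image_add_greaterThanAtMost)
  finally show ?thesis using m by (simp add: sees_def delay_shift split: option.splits)
qed

text \<open>The gap after block \<open>s\<close> is long, so every block up to \<open>s\<close> has
  reached every node by the issue of block \<open>s + 1\<close>. Whether a later block has arrived
  depends on later gaps and delays only.\<close>

lemma seen_shift:
  assumes "gap z (Suc s) > \<Delta>" "1 \<le> n"
  shows "seen z (s + N) (s + n) a = {1..s} \<union> (+) s ` seen (env_shift s z) N n a"
proof -
  have "m \<in> seen z (s + N) (s + n) a \<longleftrightarrow> m \<in> {1..s} \<union> (+) s ` seen (env_shift s z) N n a" for m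
  proof (cases "m \<le> s")
    case True
    then show ?thesis using sees_big_gap[OF assms(1), of m "s + n" a] assms(2)
      by (auto simp: seen_def)
  next
    case False
    then have m': "m = s + (m - s)" "1 \<le> m - s" by auto
    then obtain m' where m': "m = s + m'" "1 \<le> m'" by blast
    then show ?thesis by (auto simp: seen_def sees_shift)
  qed
  then show ?thesis by blast
qed

text \<open>All blocks up to \<open>s\<close> except \<open>s\<close> itself have been referenced,
  so block \<open>s\<close> is all that later pools inherit, in the role of genesis. Translated
  entries of \<open>h\<close> cannot touch what lies before \<open>s\<close>.\<close>

lemma idx_tips_glue:
  assumes f: "f \<in> wf_hist s" "idx_tips f {1..s} = {s}" and J: "J \<subseteq> {1..}"
  shows "idx_tips (glue s f h) ({1..s} \<union> (+) s ` J) = (+) s ` idx_tips h J"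
proof -
  have 1: "(\<Union>m\<in>{1..s} \<union> (+) s ` J. set (glue s f h m)) =
      (\<Union>m\<in>{1..s}. set (f m)) \<union> (+) s ` (\<Union>m\<in>J. set (h m))"
  proof -
    have "set (glue s f h m) = set (f m)" if "m \<in> {1..s}" for m
      using that by (simp add: glue_def)
    moreover have "set (glue s f h (s + m)) = (+) s ` set (h m)" if "m \<in> J" for m
    proof -
      have "1 \<le> m" using that J by auto
      then show ?thesis by (simp add: glue_def)
    qed
    ultimately show ?thesis by (simp add: UN_Un image_UN)
  qed
  have 2: "insert 0 {1..s} - (\<Union>m\<in>{1..s}. set (f m)) = {s}"
    using f(2) by (simp add: idx_tips_def)
  have 3: "(\<Union>m\<in>{1..s}. set (f m)) \<subseteq> {..<s}"
    using f(1) by (fastforce simp: wf_hist_def)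
  have 4: "\<And>x. x \<in> J \<Longrightarrow> s + x \<notin> (\<Union>m\<in>{1..s}. set (f m))"
    using 3 by auto
  have 5: "s \<notin> (\<Union>m\<in>{1..s}. set (f m))" using 3 by auto
  have "insert 0 ({1..s} \<union> (+) s ` J) - ((\<Union>m\<in>{1..s}. set (f m)) \<union> (+) s ` (\<Union>m\<in>J. set (h m)))
     = (insert 0 {1..s} - (\<Union>m\<in>{1..s}. set (f m)) \<union> (+) s ` J) - (+) s ` (\<Union>m\<in>J. set (h m))"
    using 4 by blast
  also have "\<dots> = (+) s ` (insert 0 J) - (+) s ` (\<Union>m\<in>J. set (h m))"
    unfolding 2 by auto
  also have "\<dots> = (+) s ` (insert 0 J - (\<Union>m\<in>J. set (h m)))"
    by (rule image_set_diff[symmetric]) simp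
  finally show ?thesis unfolding idx_tips_def 1 .
qed

lemma pool_size_glue:
  assumes "f \<in> wf_hist s" "idx_tips f {1..s} = {s}" "gap z (Suc s) > \<Delta>" "1 \<le> j"
  shows "pool_size z (glue s f h) (s + j) a = pool_size (env_shift s z) h j a"
proof -
  have "seen (env_shift s z) j j a \<subseteq> {1..}" using seen_subset by fastforce
  then show ?thesis
    by (simp only: pool_size_def seen_shift[OF assms(3,4)] idx_tips_glue[OF assms(1,2)])
       (simp add: card_image)
qed

lemma prepool_glue:
  assumes "f \<in> wf_hist s" "idx_tips f {1..s} = {s}" "gap z (Suc s) > \<Delta>"
  shows "prepool z (glue s f h) (s + j) = (+) s ` prepool (env_shift s z) h j"
proof -
  have "seen (env_shift s z) j (Suc j) a \<subseteq> {1..}" for a using seen_subset by fastforce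
  moreover have "seen z (s + j) (Suc (s + j)) a = {1..s} \<union> (+) s ` seen (env_shift s z) j (Suc j) a" for a
    using seen_shift[OF assms(3), of "Suc j" j a] by simp
  moreover have "issuer_of z (Suc (s + j)) = issuer_of (env_shift s z) (Suc j)"
    by (simp add: issuer_shift)
  ultimately show ?thesis
    by (simp only: prepool_def idx_tips_glue[OF assms(1,2)])
qed

text \<open>By induction on \<open>j\<close>: the pool for each draw is the translate of a pool of
  the fresh process, and uniform draws are equivariant. The long gap after \<open>s\<close> makes
  the starting view common to all nodes; otherwise some node could still hold older tips.\<close>

lemma regeneration:
  assumes "f \<in> wf_hist s" "idx_tips f {1..s} = {s}" "gap z (Suc s) > \<Delta>"
  shows "run z s j f = map_pmf (glue s f) (run (env_shift s z) 0 j (\<lambda>_. []))"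
proof (induction j)
  case 0
  have "glue s f (\<lambda>_. []) = f" using assms(1) by (auto simp: glue_def wf_hist_def fun_eq_iff)
  then show ?case by simp
next
  case (Suc j)
  have "step z (s + j) (glue s f h) = map_pmf (glue s f) (step (env_shift s z) j h)" for h
  proof -
    have "pmf_of_set (draws k (prepool z (glue s f h) (s + j))) =
        map_pmf (map ((+) s)) (pmf_of_set (draws k (prepool (env_shift s z) h j)))"
      unfolding prepool_glue[OF assms]
      by (subst draws_image) (auto intro!: map_pmf_of_set_inj[symmetric] inj_on_map_draws finite_draws draws_nonempty)
    moreover have "(glue s f h)(Suc (s + j) := map ((+) s) r) = glue s f (h(Suc j := r))" for r
      by (auto simp: glue_def fun_eq_iff Suc_diff_le)
    ultimately show ?thesis by (simp add: step_def map_pmf_comp)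
  qed
  then show ?case
    by (simp add: Suc.IH bind_map_pmf map_bind_pmf)
qed

text \<open>The first \<open>l - 1\<close> long gaps reduce at most \<open>l\<close> tips to the
  single tip \<open>s + (l - 1)\<close>; the last one lies between that block and its successor and
  delivers it to every node.\<close>

lemma regeneration_law:
  assumes "f \<in> wf_hist s" "tip_count s f \<le> l" "1 \<le> l"
    and "\<And>i. i \<in> {1..l} \<Longrightarrow> gap z (s + i) > \<Delta>" "1 \<le> j"
  shows "map_pmf (\<lambda>g. pool_size z g (s + (l - 1) + j) a) (run z s (l - 1 + j) f) =
     map_pmf (\<lambda>g. pool_size (env_shift (s + (l - 1)) z) g j a) (run (env_shift (s + (l - 1)) z) 0 j (\<lambda>_. []))"
proof -
  have *: "map_pmf (\<lambda>g. pool_size z g (s + (l - 1) + j) a) (run z (s + (l - 1)) j g) =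
     map_pmf (\<lambda>g. pool_size (env_shift (s + (l - 1)) z) g j a) (run (env_shift (s + (l - 1)) z) 0 j (\<lambda>_. []))"
    if g: "g \<in> set_pmf (run z s (l - 1) f)" for g
  proof -
    have wf: "g \<in> wf_hist (s + (l - 1))" by (rule run_support(1)[OF assms(1) g])
    have "tip_count (s + (l - 1)) g \<le> max 1 (tip_count s f - (l - 1))"
      by (rule collapse[OF assms(1) g]) (use assms(4) in auto)
    then have "tip_count (s + (l - 1)) g = 1"
      using tip_count_pos[OF wf, of "s + (l - 1)"] assms(2,3) by auto
    then have 1: "idx_tips g {1..s + (l - 1)} = {s + (l - 1)}"
      by (rule tip_count_eq_1[OF wf])
    have 2: "gap z (Suc (s + (l - 1))) > \<Delta>" using assms(4)[of l] assms(3) by simp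
    show ?thesis
      unfolding regeneration[OF wf 1 2] map_pmf_comp
      by (intro map_pmf_cong refl pool_size_glue[OF wf 1 2 assms(5)])
  qed
  show ?thesis
    unfolding run_add map_bind_pmf by (subst bind_pmf_cong[OF refl *]) auto
qed

end

section \<open>Drift of the number of tips\<close>

lemma prod_falling:
  fixes N k :: nat
  assumes "k \<le> N"
  shows "\<Prod>{N - k + 1..N} = (\<Prod>i<k. N - i)"
  by (rule prod.reindex_bij_witness[of _ "\<lambda>i. N - i" "\<lambda>i. N - i"]) (use assms in auto)

text \<open>The quotient of the two products is the probability that \<open>k\<close> draws without
  replacement from \<open>N\<close> elements all fall into \<open>g\<close> given ones. Each of its
  \<open>k\<close> factors is at least \<open>1 - 1 / (4 * k)\<close>, and Bernoulli's inequality
  bounds the product below by 3/4.\<close>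

lemma falling_ratio:
  fixes N g k :: nat
  assumes "0 < k" "k \<le> g" "g \<le> N" "4 * k * (N - g) + k \<le> N"
  shows "3 / 4 * real (\<Prod>{N - k + 1..N}) \<le> real (\<Prod>{g - k + 1..g})"
proof -
  define \<delta> where "\<delta> = 1 / (4 * real k)"
  have k: "real k \<ge> 1" using assms(1) by simp
  have \<delta>: "0 \<le> \<delta>" "\<delta> \<le> 1" using k by (auto simp: \<delta>_def field_simps)
  have "(1 - \<delta>) * real (N - i) \<le> real (g - i)" if "i < k" for i
  proof -
    have "4 * real k * (real N - real g) + real k \<le> real N"
      using assms(3,4) by (metis (no_types, lifting) of_nat_add of_nat_diff of_nat_le_iff of_nat_mult of_nat_numeral)
    then have "4 * real k * (real N - real g) \<le> real N - real i" using that by simp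
    then have "real N - real g \<le> \<delta> * (real N - real i)"
      using k by (simp add: \<delta>_def field_simps)
    then show ?thesis using that assms by (simp add: of_nat_diff algebra_simps)
  qed
  then have "(\<Prod>i<k. (1 - \<delta>) * real (N - i)) \<le> (\<Prod>i<k. real (g - i))"
    using \<delta> by (intro prod_mono) auto
  moreover have "(\<Prod>i<k. (1 - \<delta>) * real (N - i)) = (1 - \<delta>) ^ k * (\<Prod>i<k. real (N - i))"
    by (simp add: prod.distrib)
  moreover have "3 / 4 \<le> (1 - \<delta>) ^ k"
    using Bernoulli_inequality[of "- \<delta>" k] \<delta> k by (simp add: \<delta>_def)
  moreover have "(3 / 4) * (\<Prod>i<k. real (N - i)) \<le> (1 - \<delta>) ^ k * (\<Prod>i<k. real (N - i))"
    by (rule mult_right_mono) (use calculation in \<open>auto intro: prod_nonneg\<close>)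
  ultimately have "3 / 4 * (\<Prod>i<k. real (N - i)) \<le> (\<Prod>i<k. real (g - i))" by linarith
  then show ?thesis using assms by (subst (1 2) prod_falling) auto
qed

lemma expectation_bind_finite:
  fixes h :: "'b \<Rightarrow> real"
  assumes "finite (set_pmf p)" "\<And>a. finite (set_pmf (f a))"
  shows "measure_pmf.expectation (bind_pmf p f) h = measure_pmf.expectation p (\<lambda>a. measure_pmf.expectation (f a) h)"
proof -
  have "measure_pmf.expectation (bind_pmf p f) h = (\<Sum>a\<in>set_pmf p. pmf p a * measure_pmf.expectation (f a) h)"
    using pmf_expectation_bind[of "set_pmf p" f p h] assms by simp
  also have "\<dots> = measure_pmf.expectation p (\<lambda>a. measure_pmf.expectation (f a) h)"
    by (subst integral_measure_pmf_real[where A = "set_pmf p"]) (use assms in \<open>auto simp: mult.commute\<close>)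
  finally show ?thesis .
qed

lemma expectation_mono_finite:
  fixes f g :: "'b \<Rightarrow> real"
  assumes "finite (set_pmf p)" "\<And>a. a \<in> set_pmf p \<Longrightarrow> f a \<le> g a"
  shows "measure_pmf.expectation p f \<le> measure_pmf.expectation p g"
  by (intro integral_mono_AE integrable_measure_pmf_finite assms(1)) (use assms(2) in \<open>simp add: AE_measure_pmf_iff\<close>)

context reference_model begin

text \<open>If \<open>J\<close> blocks are hidden from the issuer, at most \<open>k * J\<close>
  elements of its pool are stale, so \<open>falling_ratio\<close> asks for
  \<open>4 * k * (k * J) + k\<close> elements; up to \<open>J\<close> tips are hidden in addition.
  The constant times \<open>J + 1\<close> exceeds the sum of these.\<close>

definition drift_const :: nat where
  "drift_const = 4 * k^2 + k + 1"

lemma finite_set_step [simp]: "finite (set_pmf (step z n f))"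
  by (simp add: set_step finite_draws)

text \<open>With probability at least 3/4 all \<open>k\<close> draws are true tips and the count
  drops by \<open>k - 1 \<ge> 1\<close>; otherwise it grows by at most one. Weighting
  \<open>1 / x\<close> by 3/4 and \<open>x\<close> by 1/4 gives the factor.\<close>

lemma tip_drift_large:
  fixes x :: real
  assumes f: "f \<in> wf_hist n" and x: "1 < x"
    and L: "drift_const * (runlen z (Suc n) + 1) \<le> tip_count n f"
  shows "measure_pmf.expectation (step z n f) (\<lambda>g. x ^ tip_count (Suc n) g) \<le>
    (3 / (4 * x) + x / 4) * x ^ tip_count n f"
proof -
  define J where "J = runlen z (Suc n)"
  define P where "P = prepool z f n"
  define Q where "Q = idx_tips f {1..n}"
  define V where "V = seen z n (Suc n) (Some (issuer_of z (Suc n)))"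
  define l where "l = tip_count n f"
  have fin: "finite P" "finite Q" by (auto simp: P_def Q_def finite_idx_tips)
  have l: "l = card Q" by (simp add: l_def tip_count_def Q_def)
  have V: "V \<subseteq> {1..n}" unfolding V_def by (rule seen_subset)
  have PV: "P = idx_tips f V" by (simp add: P_def prepool_def V_def)
  have cV: "card ({1..n} - V) \<le> J" unfolding V_def J_def by (rule unseen_pre)
  \<comment> \<open>A true tip that the issuer misses is itself a hidden block, whereas a stale
    element of its pool is referenced by a hidden block. Hence the bounds \<open>J\<close> here and
    \<open>k * J\<close> below.\<close>
  have "card (Q - P) \<le> card ({1..n} - V)"
    unfolding Q_def PV by (intro card_mono idx_tips_diff_subset' V) auto
  then have OP: "card (Q - P) \<le> J" using cV by simp
  have "card (P - Q) \<le> card (\<Union>m\<in>{1..n} - V. set (f m))"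
    unfolding Q_def PV by (intro card_mono idx_tips_diff_subset V) auto
  also have "\<dots> \<le> k * card ({1..n} - V)" by (rule card_refs_le[OF f]) simp
  finally have PO: "card (P - Q) \<le> k * J" using cV by (meson le_trans mult_le_mono2)
  define N g where "N = card P" and "g = card (P \<inter> Q)"
  have "card Q = card (Q - P) + g"
    unfolding g_def using fin by (subst card_Un_disjoint[symmetric]) (auto intro: arg_cong[where f = card])
  then have g: "l \<le> J + g" using OP l by simp
  have "N = card (P - Q) + g"
    unfolding g_def N_def using fin by (subst card_Un_disjoint[symmetric]) (auto intro: arg_cong[where f = card])
  then have gN: "g \<le> N" "N - g \<le> k * J" using PO by auto
  have "drift_const * (J + 1) = 4 * k^2 * J + k * J + J + 4 * k^2 + k + 1"
    by (simp add: drift_const_def algebra_simps)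
  then have lJ: "4 * k^2 * J + J + k \<le> l" using L unfolding J_def l_def by linarith
  have kg: "k \<le> g" using lJ g by linarith
  have "4 * k * (N - g) \<le> 4 * k * (k * J)" using gN(2) by simp
  also have "\<dots> = 4 * k^2 * J" by (simp add: power2_eq_square)
  finally have "4 * k * (N - g) + k \<le> N" using lJ g gN(1) by linarith
  then have ratio: "3 / 4 * real (\<Prod>{N - k + 1..N}) \<le> real (\<Prod>{g - k + 1..g})"
    using falling_ratio[of k g N] kg gN k_ge_2 by linarith
  define D G where "D = draws k P" and "G = {r \<in> D. set r \<subseteq> Q}"
  have D: "D = {xs. length xs = k \<and> distinct xs \<and> set xs \<subseteq> P}"
    using kg gN(1) by (auto simp: D_def draws_def N_def min_def)
  have "card D = \<Prod>{N - k + 1..N}"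
    unfolding D N_def by (rule card_lists_distinct_length_eq) (use fin kg gN(1) in \<open>auto simp: N_def\<close>)
  moreover have "G = {xs. length xs = k \<and> distinct xs \<and> set xs \<subseteq> P \<inter> Q}"
    unfolding G_def D by auto
  then have "card G = \<Prod>{g - k + 1..g}"
    unfolding g_def using card_lists_distinct_length_eq[of "P \<inter> Q" k] fin kg by (simp only: g_def) simp
  ultimately have DG: "3 / 4 * real (card D) \<le> real (card G)" using ratio by simp
  have finD: "finite D" "D \<noteq> {}" unfolding D_def using fin by (simp_all add: finite_draws draws_nonempty)
  have cD: "0 < card D" using finD by (simp add: card_gt_0_iff)
  have GD: "G \<subseteq> D" by (auto simp: G_def)
  define h where "h r = x ^ tip_count (Suc n) (f(Suc n := r))" for r
  have l2: "2 \<le> l" using lJ k_ge_2 by simp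
  have hG: "h r \<le> x ^ (l - 1)" if "r \<in> G" for r
  proof -
    have r: "set r \<subseteq> Q" "distinct r" "length r = k" using that by (auto simp: G_def D)
    have "set r \<subseteq> {..n}" using r(1) by (auto simp: Q_def idx_tips_def)
    then have "tip_count (Suc n) (f(Suc n := r)) = Suc (card (Q - set r))"
      unfolding Q_def by (rule tip_count_update[OF f])
    also have "card (Q - set r) = l - k"
      using r by (subst card_Diff_subset) (auto simp: l distinct_card)
    finally have "tip_count (Suc n) (f(Suc n := r)) \<le> l - 1" using k_ge_2 kg g lJ l2 by linarith
    then show ?thesis unfolding h_def using x by (intro power_increasing) auto
  qed
  have hD: "h r \<le> x ^ (l + 1)" if "r \<in> D" for r
  proof -
    have "f(Suc n := r) \<in> set_pmf (step z n f)" using that by (auto simp: set_step D_def P_def)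
    then have "tip_count (Suc n) (f(Suc n := r)) \<le> l + 1"
      using tip_count_step_le[OF f] unfolding l_def by fastforce
    then show ?thesis unfolding h_def using x by (intro power_increasing) auto
  qed
  have "(\<Sum>r\<in>D. h r) = (\<Sum>r\<in>G. h r) + (\<Sum>r\<in>D - G. h r)"
    using finD GD by (metis add.commute sum.subset_diff)
  also have "\<dots> \<le> (\<Sum>r\<in>G. x ^ (l - 1)) + (\<Sum>r\<in>D - G. x ^ (l + 1))"
    by (intro add_mono sum_mono hG hD) auto
  also have "\<dots> = real (card G) * x ^ (l - 1) + (real (card D) - real (card G)) * x ^ (l + 1)"
    using finD GD by (simp add: card_Diff_subset finite_subset of_nat_diff card_mono)
  also have "\<dots> = real (card D) * x ^ (l + 1) - real (card G) * (x ^ (l + 1) - x ^ (l - 1))"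
    by (simp add: algebra_simps)
  \<comment> \<open>\<open>card G\<close> enters with a nonpositive coefficient, so it may be
    replaced by its lower bound.\<close>
  also have "\<dots> \<le> real (card D) * x ^ (l + 1) - 3 / 4 * real (card D) * (x ^ (l + 1) - x ^ (l - 1))"
  proof (intro diff_left_mono mult_right_mono DG)
    have "x ^ (l - 1) \<le> x ^ (l + 1)" using x by (intro power_increasing) auto
    then show "0 \<le> x ^ (l + 1) - x ^ (l - 1)" by simp
  qed
  also have "\<dots> = real (card D) * ((3 / (4 * x) + x / 4) * x ^ l)"
  proof -
    obtain l' where "l = Suc l'" using l2 by (cases l) auto
    then show ?thesis using x by (simp add: field_simps)
  qed
  finally have "(\<Sum>r\<in>D. h r) / real (card D) \<le> (3 / (4 * x) + x / 4) * x ^ l"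
    using cD by (simp add: divide_le_eq mult.commute)
  moreover have "measure_pmf.expectation (step z n f) (\<lambda>g. x ^ tip_count (Suc n) g) = (\<Sum>r\<in>D. h r) / real (card D)"
    using finD by (simp add: step_def integral_pmf_of_set h_def D_def P_def)
  ultimately show ?thesis by (simp add: l_def)
qed

text \<open>Below the threshold there is no drift, but then the count after the step exceeds the
  threshold by at most one, which the additive term covers.\<close>

lemma tip_drift:
  fixes x :: real
  assumes f: "f \<in> wf_hist n" and x: "1 < x"
  shows "measure_pmf.expectation (step z n f) (\<lambda>g. x ^ tip_count (Suc n) g) \<le>
    (3 / (4 * x) + x / 4) * x ^ tip_count n f + x * x ^ (drift_const * (runlen z (Suc n) + 1))"
proof (cases "drift_const * (runlen z (Suc n) + 1) \<le> tip_count n f")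
  case True
  have "0 \<le> x * x ^ (drift_const * (runlen z (Suc n) + 1))" using x by simp
  then show ?thesis using tip_drift_large[OF f x True] by linarith
next
  case False
  have "measure_pmf.expectation (step z n f) (\<lambda>g. x ^ tip_count (Suc n) g) \<le>
      measure_pmf.expectation (step z n f) (\<lambda>g. x * x ^ (drift_const * (runlen z (Suc n) + 1)))"
  proof (rule expectation_mono_finite)
    fix g assume "g \<in> set_pmf (step z n f)"
    then have "tip_count (Suc n) g \<le> Suc (drift_const * (runlen z (Suc n) + 1))"
      using tip_count_step_le[OF f] False by fastforce
    then have "x ^ tip_count (Suc n) g \<le> x ^ Suc (drift_const * (runlen z (Suc n) + 1))"
      using x by (intro power_increasing) auto
    then show "x ^ tip_count (Suc n) g \<le> x * x ^ (drift_const * (runlen z (Suc n) + 1))" by simp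
  qed simp
  moreover have "0 \<le> (3 / (4 * x) + x / 4) * x ^ tip_count n f" using x by simp
  ultimately show ?thesis by simp
qed

definition hist_law :: "'n::finite env \<Rightarrow> nat \<Rightarrow> (nat \<Rightarrow> nat list) pmf" where
  "hist_law z n = run z 0 n (\<lambda>_. [])"

lemma hist_law_0: "hist_law z 0 = return_pmf (\<lambda>_. [])"
  by (simp add: hist_law_def)

lemma hist_law_Suc: "hist_law z (Suc n) = bind_pmf (hist_law z n) (step z n)"
  by (simp add: hist_law_def)

lemma hist_law_add: "hist_law z (n + j) = bind_pmf (hist_law z n) (run z n j)"
  by (simp add: hist_law_def run_add)

lemma finite_hist_law [simp]: "finite (set_pmf (hist_law z n))"
  by (simp add: hist_law_def finite_set_run)

lemma hist_law_wf: "f \<in> set_pmf (hist_law z n) \<Longrightarrow> f \<in> wf_hist n"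
  using run_support(1)[of "\<lambda>_. []" 0 f z n] by (simp add: hist_law_def wf_hist_0)

lemma tip_count_le: "f \<in> wf_hist N \<Longrightarrow> tip_count n f \<le> Suc n"
proof -
  have "card (idx_tips f {1..n}) \<le> card {0..n}"
    by (intro card_mono) (auto simp: idx_tips_def)
  then show ?thesis by (simp add: tip_count_def)
qed

lemma runlen_le: "runlen z n \<le> n"
  by (induction n) auto

lemma expected_tip_drift:
  fixes x :: real
  assumes x: "1 < x"
  shows "measure_pmf.expectation (hist_law z (Suc n)) (\<lambda>g. x ^ tip_count (Suc n) g) \<le>
    (3 / (4 * x) + x / 4) * measure_pmf.expectation (hist_law z n) (\<lambda>g. x ^ tip_count n g) +
    x * x ^ (drift_const * (runlen z (Suc n) + 1))"
proof -
  let ?C = "x * x ^ (drift_const * (runlen z (Suc n) + 1))"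
  have "measure_pmf.expectation (hist_law z (Suc n)) (\<lambda>g. x ^ tip_count (Suc n) g) =
    measure_pmf.expectation (hist_law z n) (\<lambda>f. measure_pmf.expectation (step z n f) (\<lambda>g. x ^ tip_count (Suc n) g))"
    unfolding hist_law_Suc by (rule expectation_bind_finite) auto
  also have "\<dots> \<le> measure_pmf.expectation (hist_law z n) (\<lambda>f. (3 / (4 * x) + x / 4) * x ^ tip_count n f + ?C)"
    by (intro expectation_mono_finite tip_drift[OF _ x] hist_law_wf) auto
  also have "\<dots> = (3 / (4 * x) + x / 4) * measure_pmf.expectation (hist_law z n) (\<lambda>g. x ^ tip_count n g) + ?C"
    by (subst Bochner_Integration.integral_add) (auto intro: integrable_measure_pmf_finite)
  finally show ?thesis .
qed

end

lemma env_shift_0 [simp]: "env_shift 0 z = z"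
  by (simp add: env_shift_def)

lemma env_shift_shift: "env_shift s (env_shift t z) = env_shift (t + s) z"
  by (simp add: env_shift_def add.assoc)

section \<open>The i.i.d. environment\<close>

locale random_environment = reference_model k \<Delta> + sequence_space \<nu>
  for k :: nat and \<Delta> :: real and \<nu> :: "(real \<times> real \<times> 'n::finite \<times> (real ^ 'n)) measure" +
  assumes sets_nu: "sets \<nu> = sets primitive_space"
    and big_gap_pos: "0 < measure \<nu> {x \<in> space \<nu>. \<Delta> < max 0 (fst x)}"
begin

definition big_gap_prob :: real where
  "big_gap_prob = measure \<nu> {x \<in> space \<nu>. \<Delta> < max 0 (fst x)}"

lemma space_S [simp]: "space S = UNIV"
  using sets_eq_imp_space_eq[OF sets_nu] by (simp add: space_PiM primitive_space_def space_pair_measure)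

lemma measurable_gap [measurable]: "(\<lambda>z. gap z m) \<in> borel_measurable S"
  unfolding gap_def primitive_space_def using sets_nu[unfolded primitive_space_def, measurable_cong] by measurable

lemma measurable_issuer [measurable]: "(\<lambda>z. issuer_of z m) \<in> measurable S (count_space UNIV)"
  unfolding issuer_of_def using sets_nu[unfolded primitive_space_def, measurable_cong] by measurable

lemma measurable_vec_nth [measurable]: "(\<lambda>x :: real ^ 'n. x $ i) \<in> borel_measurable borel"
  by (intro borel_measurable_continuous_onI continuous_intros)

lemma measurable_delay [measurable]: "(\<lambda>z. delay_of z m i) \<in> borel_measurable S"
  unfolding delay_of_def using sets_nu[unfolded primitive_space_def, measurable_cong] by measurable

lemma measurable_env_shift [measurable]: "env_shift s \<in> measurable S S"
  unfolding env_shift_def by (rule measurable_PiM_single') (auto simp: space_PiM)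

lemma measurable_sees [measurable]: "Measurable.pred S (\<lambda>z. sees z m n a)"
proof (cases a)
  case (Some i)
  have "(\<lambda>z. \<Sum>j\<in>{m<..n}. gap z j) \<in> borel_measurable S"
    by (rule borel_measurable_sum) (rule measurable_gap)
  moreover have "(\<lambda>z. min \<Delta> (delay_of z m i)) \<in> borel_measurable S" by measurable
  ultimately show ?thesis unfolding sees_def Some option.case pred_def by (rule borel_measurable_le[rotated])
qed (simp add: sees_def)

lemma measurable_runlen [measurable]: "(\<lambda>z. runlen z n) \<in> measurable S (count_space UNIV)"
  by (induction n) auto

end

section \<open>Forgetting the past at regeneration times\<close>

lemma expectation_abs_le:
  fixes f :: "'b \<Rightarrow> real"
  assumes "finite (set_pmf p)" "\<And>a. a \<in> set_pmf p \<Longrightarrow> \<bar>f a\<bar> \<le> C"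
  shows "\<bar>measure_pmf.expectation p f\<bar> \<le> C"
proof -
  have "measure_pmf.expectation p f \<le> measure_pmf.expectation p (\<lambda>_. C)"
    by (intro expectation_mono_finite assms(1)) (use assms(2) in \<open>auto simp: abs_le_iff\<close>)
  moreover have "measure_pmf.expectation p (\<lambda>_. - C) \<le> measure_pmf.expectation p f"
    by (intro expectation_mono_finite assms(1)) (use assms(2) in \<open>auto simp: abs_le_iff minus_le_iff\<close>)
  ultimately show ?thesis by simp
qed

lemma expectation_cong_set:
  fixes f g :: "'b \<Rightarrow> real"
  assumes "\<And>a. a \<in> set_pmf p \<Longrightarrow> f a = g a"
  shows "measure_pmf.expectation p f = measure_pmf.expectation p g"
  by (intro integral_cong_AE) (use assms in \<open>auto simp: AE_measure_pmf_iff\<close>)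

text \<open>A pointwise form of being a function of the first \<open>s\<close> coordinates. Together
  with measurability it yields independence from the shifted environment, see
  \<open>integral_prefix_shift\<close>.\<close>

definition prefix_determined :: "nat \<Rightarrow> ((nat \<Rightarrow> 'b) \<Rightarrow> 'c) \<Rightarrow> bool" where
  "prefix_determined s A \<longleftrightarrow> (\<forall>z z'. (\<forall>j<s. z j = z' j) \<longrightarrow> A z = A z')"

lemma prefix_determinedD: "prefix_determined s A \<Longrightarrow> (\<And>j. j < s \<Longrightarrow> z j = z' j) \<Longrightarrow> A z = A z'"
  by (auto simp: prefix_determined_def)

lemma gap_cong: "z (m - 1) = z' (m - 1) \<Longrightarrow> gap z m = gap z' m"
  by (simp add: gap_def)

context reference_model begin

lemma sees_cong:
  assumes "\<And>j. j < n \<Longrightarrow> z j = z' j" "1 \<le> m" "m \<le> n"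
  shows "sees z m n a = sees z' m n a"
proof -
  have "z (m - 1) = z' (m - 1)" using assms by auto
  moreover have "(\<Sum>j\<in>{m<..n}. gap z j) = (\<Sum>j\<in>{m<..n}. gap z' j)"
    by (intro sum.cong refl gap_cong assms(1)) auto
  ultimately show ?thesis by (auto simp: sees_def delay_of_def split: option.splits)
qed

lemma seen_cong: "(\<And>j. j < n \<Longrightarrow> z j = z' j) \<Longrightarrow> N \<le> n \<Longrightarrow> seen z N n a = seen z' N n a"
  using sees_cong[of n z z'] by (force simp: seen_def)

lemma pool_size_cong: "(\<And>j. j < n \<Longrightarrow> z j = z' j) \<Longrightarrow> pool_size z f n a = pool_size z' f n a"
  using seen_cong[of n z z' n a] by (simp add: pool_size_def)

lemma pool_size_hist_cong: "(\<And>m. m \<le> n \<Longrightarrow> f m = g m) \<Longrightarrow> pool_size z f n a = pool_size z g n a"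
proof -
  assume fg: "\<And>m. m \<le> n \<Longrightarrow> f m = g m"
  have "idx_tips f (seen z n n a) = idx_tips g (seen z n n a)"
    by (rule idx_tips_cong, rule fg) (auto simp: seen_def)
  then show ?thesis by (simp add: pool_size_def)
qed

lemma step_cong:
  assumes "\<And>j. j < Suc n \<Longrightarrow> z j = z' j"
  shows "step z n f = step z' n f"
proof -
  have "issuer_of z (Suc n) = issuer_of z' (Suc n)" using assms by (simp add: issuer_of_def)
  then have "prepool z f n = prepool z' f n"
    using seen_cong[where z = z and z' = z' and n = "Suc n" and N = n] assms by (simp add: prepool_def)
  then show ?thesis by (simp add: step_def)
qed

lemma hist_law_cong: "(\<And>j. j < n \<Longrightarrow> z j = z' j) \<Longrightarrow> hist_law z n = hist_law z' n"
proof (induction n)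
  case (Suc n)
  then have "hist_law z n = hist_law z' n" by auto
  moreover have "step z n = step z' n" by (rule ext, rule step_cong) (use Suc.prems in auto)
  ultimately show ?case by (simp add: hist_law_Suc)
qed (simp add: hist_law_0)

lemma runlen_cong: "(\<And>j. j < n \<Longrightarrow> z j = z' j) \<Longrightarrow> runlen z n = runlen z' n"
proof (induction n)
  case (Suc n)
  then have "runlen z n = runlen z' n" "gap z (Suc n) = gap z' (Suc n)" by (auto intro: gap_cong)
  then show ?case by simp
qed simp

definition all_big :: "nat \<Rightarrow> 'n::finite env \<Rightarrow> bool" where
  "all_big l z \<longleftrightarrow> (\<forall>i\<in>{1..l}. gap z i > \<Delta>)"

text \<open>Candidates start at multiples of \<open>l\<close>, so they use disjoint sets of gaps and
  the events \<open>all_big\<close> for different \<open>i\<close> are independent under the product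
  measure.\<close>

definition first_block :: "nat \<Rightarrow> nat \<Rightarrow> 'n::finite env \<Rightarrow> bool" where
  "first_block l i z \<longleftrightarrow> all_big l (env_shift (i * l) z) \<and> (\<forall>j<i. \<not> all_big l (env_shift (j * l) z))"

definition fresh_mean :: "(nat \<Rightarrow> real) \<Rightarrow> 'n option \<Rightarrow> nat \<Rightarrow> 'n::finite env \<Rightarrow> real" where
  "fresh_mean \<phi> a j z = measure_pmf.expectation (hist_law z j) (\<lambda>f. \<phi> (pool_size z f j a))"

text \<open>The first all-long block starts after \<open>i * l\<close> steps and regeneration occurs
  \<open>l - 1\<close> steps later, as in \<open>regeneration_law\<close>; the fresh process then
  runs for the rest of the \<open>w\<close> steps. The value is 0 if no block qualifies.\<close>

definition window_mean :: "(nat \<Rightarrow> real) \<Rightarrow> 'n option \<Rightarrow> nat \<Rightarrow> nat \<Rightarrow> nat \<Rightarrow> 'n::finite env \<Rightarrow> real" where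
  "window_mean \<phi> a l B w z = (\<Sum>i<B. of_bool (first_block l i z) *
     fresh_mean \<phi> a (w - (i * l + (l - 1))) (env_shift (i * l + (l - 1)) z))"

definition no_block :: "nat \<Rightarrow> nat \<Rightarrow> 'n::finite env \<Rightarrow> bool" where
  "no_block l B z \<longleftrightarrow> (\<forall>i<B. \<not> all_big l (env_shift (i * l) z))"

text \<open>Probability, given the environment, that the tips are too many for \<open>l\<close> long
  gaps to be sure of a regeneration.\<close>

definition excess :: "nat \<Rightarrow> nat \<Rightarrow> 'n::finite env \<Rightarrow> real" where
  "excess l n z = measure_pmf.expectation (hist_law z n) (\<lambda>f. of_bool (l < tip_count n f))"

lemma fresh_mean_abs_le: "(\<And>x. \<bar>\<phi> x\<bar> \<le> T) \<Longrightarrow> \<bar>fresh_mean \<phi> a j z\<bar> \<le> T"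
  unfolding fresh_mean_def by (intro expectation_abs_le) auto

lemma excess_nonneg: "0 \<le> excess l n z"
  unfolding excess_def by (intro integral_nonneg_AE) auto

lemma excess_le_1: "excess l n z \<le> 1"
  using expectation_abs_le[of "hist_law z n" "\<lambda>f. of_bool (l < tip_count n f)" 1] by (auto simp: excess_def)

lemma window_mean_first:
  assumes "first_block l i z" "i < B"
  shows "window_mean \<phi> a l B w z = fresh_mean \<phi> a (w - (i * l + (l - 1))) (env_shift (i * l + (l - 1)) z)"
proof -
  have "first_block l j z \<longleftrightarrow> j = i" for j
    using assms(1) by (metis first_block_def nat_neq_iff)
  then have "window_mean \<phi> a l B w z = (\<Sum>j<B. if j = i then fresh_mean \<phi> a (w - (i * l + (l - 1))) (env_shift (i * l + (l - 1)) z) else 0)"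
    unfolding window_mean_def by (intro sum.cong) auto
  then show ?thesis using assms(2) by simp
qed

lemma first_block_exists: "\<not> no_block l B z \<Longrightarrow> \<exists>i<B. first_block l i z"
proof -
  assume "\<not> no_block l B z"
  then obtain i where i: "i < B" "all_big l (env_shift (i * l) z)" by (auto simp: no_block_def)
  define i0 where "i0 = (LEAST i. all_big l (env_shift (i * l) z))"
  have "all_big l (env_shift (i0 * l) z)" unfolding i0_def by (rule LeastI[where P = "\<lambda>i. all_big l (env_shift (i * l) z)"], rule i(2))
  moreover have "i0 \<le> i" unfolding i0_def by (rule Least_le[where P = "\<lambda>i. all_big l (env_shift (i * l) z)"], rule i(2))
  moreover have "\<forall>j<i0. \<not> all_big l (env_shift (j * l) z)" unfolding i0_def using not_less_Least by blast
  ultimately show ?thesis using i(1) by (auto simp: first_block_def intro!: exI[of _ i0])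
qed

lemma window_mean_no_block: "no_block l B z \<Longrightarrow> window_mean \<phi> a l B w z = 0"
  by (auto simp: window_mean_def no_block_def first_block_def intro!: sum.neutral)

lemma window_mean_abs_le:
  assumes "\<And>x. \<bar>\<phi> x\<bar> \<le> T"
  shows "\<bar>window_mean \<phi> a l B w z\<bar> \<le> T"
proof (cases "no_block l B z")
  case True
  then show ?thesis using order_trans[OF abs_ge_zero assms] by (simp add: window_mean_no_block)
next
  case False
  obtain i where i: "i < B" "first_block l i z" using first_block_exists[OF False] by blast
  show ?thesis unfolding window_mean_first[OF i(2,1)] by (rule fresh_mean_abs_le[OF assms])
qed

text \<open>The environment alone decides which candidate is the first all-long block. If at most
  \<open>l\<close> tips are present at its start, the conditional mean of the later factor is the
  window mean whatever the past, so \<open>u\<close> factors out; both exceptional cases are paid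
  with the trivial bound \<open>2 * U * T\<close>.\<close>

lemma quenched_mixing:
  fixes u :: "(nat \<Rightarrow> nat list) \<Rightarrow> real"
  assumes u: "\<And>f. \<bar>u f\<bar> \<le> U" and u_cong: "\<And>f g. (\<And>m. m \<le> s \<Longrightarrow> f m = g m) \<Longrightarrow> u f = u g"
    and phi: "\<And>x. \<bar>\<phi> x\<bar> \<le> T" and l: "1 \<le> l" and w: "B * l \<le> w"
  shows "\<bar>measure_pmf.expectation (hist_law z (s + w)) (\<lambda>f. u f * \<phi> (pool_size z f (s + w) a)) -
      measure_pmf.expectation (hist_law z s) u * window_mean \<phi> a l B w (env_shift s z)\<bar> \<le>
    2 * U * T * (of_bool (no_block l B (env_shift s z)) +
      (\<Sum>i<B. of_bool (all_big l (env_shift (s + i * l) z)) * excess l (s + i * l) z))"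
    (is "\<bar>?E - ?u * ?W\<bar> \<le> 2 * U * T * (?nb + ?S)")
proof -
  have U: "0 \<le> U" and T: "0 \<le> T" using order_trans[OF abs_ge_zero u] order_trans[OF abs_ge_zero phi] by auto
  have S: "0 \<le> ?S" by (intro sum_nonneg mult_nonneg_nonneg excess_nonneg) auto
  show ?thesis
  proof (cases "no_block l B (env_shift s z)")
    case True
    have "\<bar>?E\<bar> \<le> U * T"
      by (intro expectation_abs_le) (auto simp: abs_mult intro!: mult_mono u phi U)
    then have "\<bar>?E - ?u * ?W\<bar> \<le> 2 * U * T * 1" 
      using U T mult_nonneg_nonneg[OF U T] by (simp add: window_mean_no_block[OF True])
    also have "\<dots> \<le> 2 * U * T * (?nb + ?S)" using True S U T by (intro mult_left_mono) auto
    finally show ?thesis .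
  next
    case False
    obtain i where i: "i < B" "first_block l i (env_shift s z)" using first_block_exists[OF False] by blast
    define m where "m = s + i * l"
    \<comment> \<open>Steps left after the regeneration: at least one, since the whole block lies
      inside the window.\<close>
    define j where "j = w - (i * l + (l - 1))"
    have "Suc i * l \<le> B * l" using i(1) by (intro mult_right_mono) auto
    then have il: "i * l + l \<le> w" using w by simp
    then have j: "1 \<le> j" and n: "s + w = m + (l - 1 + j)" using l by (auto simp: j_def m_def)
    have big: "all_big l (env_shift m z)"
      using i(2) by (simp add: first_block_def env_shift_shift m_def)
    then have gaps: "\<And>i. i \<in> {1..l} \<Longrightarrow> gap z (m + i) > \<Delta>"
      by (auto simp: all_big_def gap_shift)
    have W: "?W = fresh_mean \<phi> a j (env_shift (m + (l - 1)) z)"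
      by (simp add: window_mean_first[OF i(2,1)] env_shift_shift j_def m_def add.assoc)
    have W_le: "\<bar>?W\<bar> \<le> T" by (rule window_mean_abs_le[OF phi])
    \<comment> \<open>Conditional mean of the later factor given the history \<open>f\<close> at the
      start \<open>m\<close> of the block. The factor \<open>u\<close> is already fixed there, since
      \<open>s \<le> m\<close>.\<close>
    define R where "R f = measure_pmf.expectation (run z m (l - 1 + j) f) (\<lambda>g. \<phi> (pool_size z g (s + w) a))" for f
    have R_le: "\<bar>R f\<bar> \<le> T" for f
      unfolding R_def by (intro expectation_abs_le finite_set_run phi)
    have R_eq: "R f = ?W" if "f \<in> set_pmf (hist_law z m)" "tip_count m f \<le> l" for f
    proof -
      have "R f = measure_pmf.expectation (map_pmf (\<lambda>g. pool_size z g (m + (l - 1) + j) a) (run z m (l - 1 + j) f)) \<phi>"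
        by (simp add: R_def n add.assoc)
      also have "\<dots> = ?W"
        by (subst regeneration_law[OF hist_law_wf[OF that(1)] that(2) l gaps j]) (simp_all add: W fresh_mean_def hist_law_def)
      finally show ?thesis .
    qed
    have E: "?E = measure_pmf.expectation (hist_law z m) (\<lambda>f. u f * R f)"
    proof -
      have "?E = measure_pmf.expectation (hist_law z m) (\<lambda>f. measure_pmf.expectation (run z m (l - 1 + j) f)
          (\<lambda>g. u g * \<phi> (pool_size z g (s + w) a)))"
        unfolding n hist_law_add by (rule expectation_bind_finite) (auto simp: finite_set_run)
      also have "\<dots> = measure_pmf.expectation (hist_law z m) (\<lambda>f. u f * R f)"
      proof (rule expectation_cong_set)
        fix f assume f: "f \<in> set_pmf (hist_law z m)"
        have "u g = u f" if "g \<in> set_pmf (run z m (l - 1 + j) f)" for g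
          by (rule u_cong, rule run_support(2)[OF hist_law_wf[OF f] that]) (simp add: m_def)
        then have "measure_pmf.expectation (run z m (l - 1 + j) f) (\<lambda>g. u g * \<phi> (pool_size z g (s + w) a)) =
          measure_pmf.expectation (run z m (l - 1 + j) f) (\<lambda>g. u f * \<phi> (pool_size z g (s + w) a))"
          by (intro expectation_cong_set) auto
        then show "measure_pmf.expectation (run z m (l - 1 + j) f) (\<lambda>g. u g * \<phi> (pool_size z g (s + w) a)) = u f * R f"
          by (simp add: R_def)
      qed
      finally show ?thesis .
    qed
    have "?u = measure_pmf.expectation (hist_law z m) u"
    proof -
      have "measure_pmf.expectation (hist_law z m) u =
        measure_pmf.expectation (hist_law z s) (\<lambda>f. measure_pmf.expectation (run z s (i * l) f) u)"
        unfolding m_def hist_law_add by (rule expectation_bind_finite) (auto simp: finite_set_run)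
      also have "\<dots> = ?u"
      proof (rule expectation_cong_set)
        fix f assume f: "f \<in> set_pmf (hist_law z s)"
        have "u g = u f" if "g \<in> set_pmf (run z s (i * l) f)" for g
          by (rule u_cong, rule run_support(2)[OF hist_law_wf[OF f] that])
        then have "measure_pmf.expectation (run z s (i * l) f) u = measure_pmf.expectation (run z s (i * l) f) (\<lambda>_. u f)"
          by (intro expectation_cong_set) auto
        then show "measure_pmf.expectation (run z s (i * l) f) u = u f" by simp
      qed
      finally show ?thesis by simp
    qed
    then have "?E - ?u * ?W = measure_pmf.expectation (hist_law z m) (\<lambda>f. u f * R f) -
        measure_pmf.expectation (hist_law z m) (\<lambda>f. u f * ?W)"
      by (simp add: E)
    also have "\<dots> = measure_pmf.expectation (hist_law z m) (\<lambda>f. u f * R f - u f * ?W)"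
      by (intro Bochner_Integration.integral_diff[symmetric] integrable_measure_pmf_finite) auto
    finally have "\<bar>?E - ?u * ?W\<bar> \<le> measure_pmf.expectation (hist_law z m) (\<lambda>f. \<bar>u f * R f - u f * ?W\<bar>)"
      by simp
    also have "\<dots> \<le> measure_pmf.expectation (hist_law z m) (\<lambda>f. 2 * U * T * of_bool (l < tip_count m f))"
    proof (rule expectation_mono_finite)
      fix f assume f: "f \<in> set_pmf (hist_law z m)"
      show "\<bar>u f * R f - u f * ?W\<bar> \<le> 2 * U * T * of_bool (l < tip_count m f)"
      proof (cases "l < tip_count m f")
        case True
        have "\<bar>u f * R f - u f * ?W\<bar> = \<bar>u f\<bar> * \<bar>R f - ?W\<bar>" by (simp add: abs_mult[symmetric] algebra_simps)
        also have "\<dots> \<le> U * (2 * T)"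
          using R_le[of f] W_le by (intro mult_mono u U) auto
        finally show ?thesis using True by simp
      next
        case False
        then show ?thesis using R_eq[OF f] by simp
      qed
    qed simp
    also have "\<dots> = 2 * U * T * excess l m z" by (simp add: excess_def)
    also have "\<dots> = 2 * U * T * (of_bool (all_big l (env_shift (s + i * l) z)) * excess l (s + i * l) z)"
      using big by (simp add: m_def)
    \<comment> \<open>The index \<open>i\<close> depends on the environment. Summing over all
      candidates, each with its own \<open>all_big\<close> indicator, leaves terms that can be
      integrated one by one.\<close>
    also have "\<dots> \<le> 2 * U * T * (?nb + ?S)"
    proof (rule mult_left_mono)
      have "of_bool (all_big l (env_shift (s + i * l) z)) * excess l (s + i * l) z \<le> ?S"
        by (rule member_le_sum) (use i(1) in \<open>auto simp: excess_nonneg\<close>)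
      then show "of_bool (all_big l (env_shift (s + i * l) z)) * excess l (s + i * l) z \<le> ?nb + ?S" by simp
    qed (use U T in simp)
    finally show ?thesis .
  qed
qed

end

section \<open>Random environment\<close>

context random_environment begin

lemma space_nu [simp]: "space \<nu> = UNIV"
  using sets_eq_imp_space_eq[OF sets_nu] by (simp add: primitive_space_def space_pair_measure)

lemma prob_UNIV [simp]: "P.prob UNIV = 1"
  using P.prob_space by simp

lemma measurable_mem_idx_tips [measurable]:
  "Measurable.pred S (\<lambda>z. x \<in> idx_tips f (seen z N n a))"
proof -
  have "(x \<in> idx_tips f (seen z N n a)) \<longleftrightarrow>
    (x = 0 \<or> (x \<in> {1..N} \<and> sees z x n a)) \<and> (\<forall>m\<in>{1..N}. sees z m n a \<longrightarrow> x \<notin> set (f m))" for z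
    by (auto simp: idx_tips_def seen_def)
  then show ?thesis by simp
qed

text \<open>The value is a subset of a fixed finite set, so its being equal to \<open>P\<close> is a
  finite conjunction of membership events.\<close>

lemma measurable_idx_tips:
  "(\<lambda>z. idx_tips f (seen z N n a)) \<in> measurable S (count_space (Pow {..N}))"
proof (subst measurable_count_space_eq2, simp, intro conjI ballI)
  show "(\<lambda>z. idx_tips f (seen z N n a)) \<in> space S \<rightarrow> Pow {..N}"
    by (auto simp: idx_tips_def seen_def)
  fix P assume "P \<in> Pow {..N}"
  have "idx_tips f (seen z N n a) \<subseteq> {..N}" for z by (auto simp: idx_tips_def seen_def)
  then have "idx_tips f (seen z N n a) = {..N} \<inter> idx_tips f (seen z N n a)" for z by (rule Int_absorb1[symmetric])
  moreover have "P = {..N} \<inter> P" using \<open>P \<in> Pow {..N}\<close> by (intro Int_absorb1[symmetric]) simp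
  moreover have "{..N} \<inter> Q = {..N} \<inter> P \<longleftrightarrow> (\<forall>x\<in>{..N}. x \<in> Q \<longleftrightarrow> x \<in> P)" for Q
    by blast
  ultimately have "idx_tips f (seen z N n a) = P \<longleftrightarrow> (\<forall>x\<in>{..N}. x \<in> idx_tips f (seen z N n a) \<longleftrightarrow> x \<in> P)" for z
    by metis
  then have "(\<lambda>z. idx_tips f (seen z N n a)) -` {P} \<inter> space S =
    {z \<in> space S. \<forall>x\<in>{..N}. x \<in> idx_tips f (seen z N n a) \<longleftrightarrow> x \<in> P}"
    by (simp add: vimage_def)
  moreover have "Measurable.pred S (\<lambda>z. \<forall>x\<in>{..N}. x \<in> idx_tips f (seen z N n a) \<longleftrightarrow> x \<in> P)" by measurable
  ultimately show "(\<lambda>z. idx_tips f (seen z N n a)) -` {P} \<inter> space S \<in> sets S" by (simp add: pred_def)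
qed

lemma measurable_prepool: "(\<lambda>z. prepool z f n) \<in> measurable S (count_space (Pow {..n}))"
proof -
  have "(\<lambda>z. prepool z f n) = (\<lambda>z. (\<lambda>i z. idx_tips f (seen z n (Suc n) (Some i))) (issuer_of z (Suc n)) z)"
    by (simp add: prepool_def)
  also have "\<dots> \<in> measurable S (count_space (Pow {..n}))"
    by (rule measurable_compose_countable[OF measurable_idx_tips measurable_issuer])
  finally show ?thesis .
qed

lemma measurable_pool_size [measurable]: "(\<lambda>z. pool_size z f n a) \<in> measurable S (count_space UNIV)"
  unfolding pool_size_def
  by (rule measurable_compose[OF measurable_idx_tips]) simp

lemma measurable_pmf_step: "(\<lambda>z. pmf (step z n f) g) \<in> borel_measurable S"
  unfolding step_def
  by (rule measurable_compose[OF measurable_prepool]) simp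

text \<open>The range of summation does not depend on the environment, so measurability in
  \<open>z\<close> reduces to that of finitely many point masses.\<close>

lemma expectation_hist_law_sum:
  "measure_pmf.expectation (hist_law z n) h = (\<Sum>f\<in>wf_hist n. h f * pmf (hist_law z n) f)"
  for h :: "_ \<Rightarrow> real"
  by (rule integral_measure_pmf_real[OF finite_wf_hist]) (use hist_law_wf in blast)

lemma measurable_pmf_hist_law [measurable]: "(\<lambda>z. pmf (hist_law z n) g) \<in> borel_measurable S"
proof (induction n arbitrary: g)
  case (Suc n)
  have "pmf (hist_law z (Suc n)) g = (\<Sum>f\<in>wf_hist n. pmf (step z n f) g * pmf (hist_law z n) f)" for z :: "'n env"
    unfolding hist_law_Suc pmf_bind by (rule expectation_hist_law_sum)
  moreover have "(\<lambda>z. \<Sum>f\<in>wf_hist n. pmf (step z n f) g * pmf (hist_law z n) f) \<in> borel_measurable S"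
    by (intro borel_measurable_sum borel_measurable_times Suc.IH measurable_pmf_step)
  ultimately show ?case by simp
qed (simp add: hist_law_0)

lemma measurable_expectation:
  fixes F :: "(nat \<Rightarrow> nat list) \<Rightarrow> 'n env \<Rightarrow> real"
  assumes "\<And>f. F f \<in> borel_measurable S"
  shows "(\<lambda>z. measure_pmf.expectation (hist_law z n) (\<lambda>f. F f z)) \<in> borel_measurable S"
  unfolding expectation_hist_law_sum using assms by measurable

lemma measurable_all_big [measurable]: "Measurable.pred S (all_big l)"
  unfolding all_big_def by measurable

lemma measurable_all_big_shift [measurable]: "Measurable.pred S (\<lambda>z. all_big l (env_shift s z))"
  by (rule measurable_compose[OF measurable_env_shift measurable_all_big])

lemma measurable_first_block [measurable]: "Measurable.pred S (first_block l i)"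
  unfolding first_block_def by measurable

lemma measurable_no_block [measurable]: "Measurable.pred S (no_block l B)"
  unfolding no_block_def by measurable

lemma measurable_excess [measurable]: "excess l n \<in> borel_measurable S"
  unfolding excess_def by (rule measurable_expectation) simp

lemma measurable_fresh_mean [measurable]: "fresh_mean \<phi> a j \<in> borel_measurable S"
  unfolding fresh_mean_def by (rule measurable_expectation) simp

lemma measurable_window_mean [measurable]: "window_mean \<phi> a l B w \<in> borel_measurable S"
proof -
  have "(\<lambda>z. fresh_mean \<phi> a j (env_shift s z)) \<in> borel_measurable S" for j s
    by (rule measurable_compose[OF measurable_env_shift measurable_fresh_mean])
  then show ?thesis unfolding window_mean_def by measurable
qed

lemma integrable_bounded:
  fixes A :: "'n env \<Rightarrow> real"
  assumes "A \<in> borel_measurable S" "\<And>z. \<bar>A z\<bar> \<le> b"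
  shows "integrable S A"
  by (rule P.integrable_const_bound[where B = b]) (use assms in auto)

text \<open>\<open>S\<close> is the image of two independent copies under \<open>comb_seq s\<close>,
  which takes the first \<open>s\<close> coordinates from one copy and all later ones from the
  other. Then \<open>A\<close> reads the first copy, the shifted \<open>B\<close> the second, and
  Fubini's theorem separates them.\<close>

lemma integral_prefix_shift:
  fixes A B :: "'n env \<Rightarrow> real"
  assumes [measurable]: "A \<in> borel_measurable S" "B \<in> borel_measurable S"
    and "\<And>z. \<bar>A z\<bar> \<le> a" "\<And>z. \<bar>B z\<bar> \<le> b" "prefix_determined s A"
  shows "(\<integral>z. A z * B (env_shift s z) \<partial>S) = (\<integral>z. A z \<partial>S) * (\<integral>z. B z \<partial>S)"
proof -
  interpret SS: pair_prob_space S S ..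
  have "B \<circ> env_shift s \<in> borel_measurable S"
    by (rule measurable_comp[OF measurable_env_shift assms(2)])
  then have [measurable]: "(\<lambda>z. B (env_shift s z)) \<in> borel_measurable S" by (simp add: comp_def)
  have "(\<integral>z. A z * B (env_shift s z) \<partial>S) =
      (\<integral>z. A z * B (env_shift s z) \<partial>distr (S \<Otimes>\<^sub>M S) S (\<lambda>(z, z'). comb_seq s z z'))"
    by (simp add: PiM_comb_seq)
  also have "\<dots> = (\<integral>p. A (comb_seq s (fst p) (snd p)) * B (env_shift s (comb_seq s (fst p) (snd p))) \<partial>(S \<Otimes>\<^sub>M S))"
    by (subst integral_distr) (auto simp: measurable_comb_seq split_beta')
  also have "\<dots> = (\<integral>p. A (fst p) * B (snd p) \<partial>(S \<Otimes>\<^sub>M S))"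
  proof -
    have "A (comb_seq s z z') = A z" for z z'
      by (rule prefix_determinedD[OF assms(5)]) (simp add: comb_seq_def)
    moreover have "env_shift s (comb_seq s z z') = z'" for z z' :: "'n env"
      by (simp add: env_shift_def comb_seq_def)
    ultimately show ?thesis by simp
  qed
  also have "\<dots> = (\<integral>z. (\<integral>z'. A z * B z' \<partial>S) \<partial>S)"
  proof -
    have "integrable (S \<Otimes>\<^sub>M S) (\<lambda>p. A (fst p) * B (snd p))"
    proof (rule SS.integrable_const_bound[where B = "a * b"])
      have "\<bar>A x * B y\<bar> \<le> a * b" for x y
        unfolding abs_mult by (intro mult_mono assms order_trans[OF abs_ge_zero assms(3)[of x]]) auto
      then show "AE p in S \<Otimes>\<^sub>M S. norm (A (fst p) * B (snd p)) \<le> a * b" by simp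
    qed measurable
    from SS.integral_fst'[OF this] show ?thesis by simp
  qed
  also have "\<dots> = (\<integral>z. A z \<partial>S) * (\<integral>z. B z \<partial>S)" by simp
  finally show ?thesis .
qed

lemma integral_big_gap: "(\<integral>z. of_bool (gap z 1 > \<Delta>) \<partial>S) = big_gap_prob"
proof -
  have "(\<integral>z. of_bool (gap z 1 > \<Delta>) \<partial>S) = measure S {z \<in> space S. gap z 1 > \<Delta>}"
    by (subst Bochner_Integration.integral_cong[OF refl, of _ _ "indicator {z \<in> space S. gap z 1 > \<Delta>}"])
       (auto simp: indicator_def)
  also have "\<dots> = measure S ((\<lambda>z. z 0) -` {x \<in> space \<nu>. \<Delta> < max 0 (fst x)} \<inter> space S)"
    by (intro arg_cong[where f = "measure S"]) 
       (auto simp: gap_def)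
  also have "\<dots> = measure (distr S \<nu> (\<lambda>z. z 0)) {x \<in> space \<nu>. \<Delta> < max 0 (fst x)}"
  proof (rule measure_distr[symmetric])
    have [measurable]: "fst \<in> borel_measurable \<nu>"
      by (subst measurable_cong_sets[OF sets_nu refl]) (simp add: primitive_space_def)
    show "{x \<in> space \<nu>. \<Delta> < max 0 (fst x)} \<in> sets \<nu>" by measurable
  qed simp
  also have "\<dots> = big_gap_prob" by (simp add: PiM_component big_gap_prob_def)
  finally show ?thesis .
qed

lemma big_gap_prob_bounds: "0 < big_gap_prob" "big_gap_prob \<le> 1"
  using big_gap_pos by (auto simp: big_gap_prob_def M.prob_le_1)

lemma prefix_determined_runlen: "prefix_determined n (\<lambda>z. h (runlen z n))"
  unfolding prefix_determined_def using runlen_cong by metis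

text \<open>Each step multiplies \<open>y ^ runlen\<close> by \<open>y\<close> with probability
  \<open>1 - big_gap_prob\<close>, independently of the past, and otherwise resets it to 1. With
  \<open>q = (1 - big_gap_prob) * y\<close>, the bound is the solution of
  \<open>e = 1 + q * e\<close>.\<close>

lemma runlen_moment:
  fixes y :: real
  assumes y: "1 \<le> y" "(1 - big_gap_prob) * y < 1"
  shows "(\<integral>z. y ^ runlen z n \<partial>S) \<le> 1 / (1 - (1 - big_gap_prob) * y)"
proof (induction n)
  case 0
  have "0 \<le> (1 - big_gap_prob) * y" using y big_gap_prob_bounds by simp
  then show ?case using y by (simp add: field_simps)
next
  case (Suc n)
  define q where "q = (1 - big_gap_prob) * y"
  have q: "0 \<le> q" "q < 1" using y big_gap_prob_bounds by (auto simp: q_def)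
  have bnd: "\<bar>y ^ runlen z n\<bar> \<le> y ^ n" for z :: "'n env"
    using y runlen_le[of z n] by (simp add: power_increasing)
  have "y ^ runlen z (Suc n) \<le> 1 + y * (y ^ runlen z n * of_bool (\<not> gap (env_shift n z) 1 > \<Delta>))" for z :: "'n env"
    using y by (auto simp: gap_shift)
  then have "(\<integral>z. y ^ runlen z (Suc n) \<partial>S) \<le> (\<integral>z. 1 + y * (y ^ runlen z n * of_bool (\<not> gap (env_shift n z) 1 > \<Delta>)) \<partial>S)"
  proof (intro integral_mono)
    show "integrable S (\<lambda>z. y ^ runlen z (Suc n))"
    proof (rule integrable_bounded[where b = "y ^ Suc n"])
      show "\<bar>y ^ runlen z (Suc n)\<bar> \<le> y ^ Suc n" for z :: "'n env"
        using power_increasing[OF runlen_le[of z "Suc n"] y(1)] y by (simp del: runlen.simps power_Suc)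
    qed (simp del: runlen.simps)
    show "integrable S (\<lambda>z. 1 + y * (y ^ runlen z n * of_bool (\<not> gap (env_shift n z) 1 > \<Delta>)))"
      by (rule integrable_bounded[where b = "1 + y * y ^ n"])
         (use y bnd in \<open>auto simp: gap_shift abs_mult intro!: measurable_of_bool\<close>)
  qed
  also have "\<dots> = 1 + y * (\<integral>z. y ^ runlen z n * of_bool (\<not> gap (env_shift n z) 1 > \<Delta>) \<partial>S)"
  proof (subst Bochner_Integration.integral_add)
    show "integrable S (\<lambda>z. y * (y ^ runlen z n * of_bool (\<not> gap (env_shift n z) 1 > \<Delta>)))"
      by (rule integrable_bounded[where b = "y * y ^ n"])
         (use y bnd in \<open>auto simp: gap_shift abs_mult intro!: measurable_of_bool\<close>)
  qed simp_all
  also have "(\<integral>z. y ^ runlen z n * of_bool (\<not> gap (env_shift n z) 1 > \<Delta>) \<partial>S) =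
      (\<integral>z. y ^ runlen z n \<partial>S) * (\<integral>z. of_bool (\<not> gap z 1 > \<Delta>) \<partial>S)"
    by (rule integral_prefix_shift[where a = "y ^ n" and b = 1 and A = "\<lambda>z. y ^ runlen z n" and B = "\<lambda>z. of_bool (\<not> gap z 1 > \<Delta>)"])
       (use bnd prefix_determined_runlen in auto)
  also have "(\<integral>z. of_bool (\<not> gap z 1 > \<Delta>) \<partial>S) = 1 - big_gap_prob"
  proof -
    have "(\<integral>z. of_bool (\<not> gap z 1 > \<Delta>) \<partial>S) = (\<integral>z. 1 - of_bool (gap z 1 > \<Delta>) \<partial>S)"
      by (intro Bochner_Integration.integral_cong) auto
    also have "\<dots> = 1 - big_gap_prob"
      by (subst Bochner_Integration.integral_diff)
         (auto simp: integral_big_gap[simplified] intro!: integrable_bounded[where b = 1])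
    finally show ?thesis .
  qed
  also have "1 + y * ((\<integral>z. y ^ runlen z n \<partial>S) * (1 - big_gap_prob)) = 1 + q * (\<integral>z. y ^ runlen z n \<partial>S)"
    by (simp add: q_def)
  also have "\<dots> \<le> 1 + q * (1 / (1 - q))"
    using Suc.IH q by (intro add_left_mono mult_left_mono) (auto simp: q_def)
  also have "\<dots> = 1 / (1 - q)" using q by (simp add: field_simps)
  finally show ?case by (simp add: q_def)
qed

lemma all_big_Suc: "all_big (Suc l) z \<longleftrightarrow> gap z 1 > \<Delta> \<and> all_big l (env_shift 1 z)"
proof -
  have eq: "{1..Suc l} = insert 1 (Suc ` {1..l})" by (auto simp: image_Suc_atLeastAtMost)
  show ?thesis unfolding all_big_def eq by (auto simp: gap_shift simp del: image_Suc_atLeastAtMost)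
qed

lemma prefix_determined_all_big: "prefix_determined l (\<lambda>z :: 'n env. h (all_big l z))"
proof -
  have "all_big l z = all_big l z'" if "\<forall>j<l. z j = z' j" for z z' :: "'n env"
  proof -
    have "gap z i = gap z' i" if "i \<in> {1..l}" for i
      by (rule gap_cong) (use that \<open>\<forall>j<l. z j = z' j\<close> in auto)
    then show ?thesis by (simp add: all_big_def)
  qed
  then show ?thesis unfolding prefix_determined_def by (intro allI impI arg_cong[where f = h]) auto
qed

lemma integral_all_big: "(\<integral>z. of_bool (all_big l z) \<partial>S) = big_gap_prob ^ l"
proof (induction l)
  case (Suc l)
  have "prefix_determined 1 (\<lambda>z :: 'n env. of_bool (gap z 1 > \<Delta>) :: real)"
    by (auto simp: prefix_determined_def gap_def)
  then have "(\<integral>z. of_bool (gap z 1 > \<Delta>) * (of_bool (all_big l (env_shift 1 z)) :: real) \<partial>S) =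
    (\<integral>z. of_bool (gap z 1 > \<Delta>) \<partial>S) * (\<integral>z. of_bool (all_big l z) \<partial>S)"
    by (intro integral_prefix_shift[where a = 1 and b = 1 and A = "\<lambda>z. of_bool (gap z 1 > \<Delta>)" and B = "\<lambda>z. of_bool (all_big l z)"]) auto
  moreover have "(\<integral>z. of_bool (all_big (Suc l) z) \<partial>S) = (\<integral>z. of_bool (gap z 1 > \<Delta>) * (of_bool (all_big l (env_shift 1 z)) :: real) \<partial>S)"
    by (intro Bochner_Integration.integral_cong) (auto simp: all_big_Suc)
  ultimately show ?case using integral_big_gap Suc.IH by simp
qed (simp add: all_big_def)

text \<open>The first block is peeled off rather than the last, in the shape that
  \<open>integral_prefix_shift\<close> expects.\<close>

lemma no_block_Suc: "no_block l (Suc B) z \<longleftrightarrow> \<not> all_big l z \<and> no_block l B (env_shift l z)"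
  by (auto simp: no_block_def env_shift_shift All_less_Suc2)

lemma integral_no_block: "(\<integral>z. of_bool (no_block l B z) \<partial>S) = (1 - big_gap_prob ^ l) ^ B"
proof (induction B)
  case (Suc B)
  have "(\<integral>z. of_bool (\<not> all_big l z) * (of_bool (no_block l B (env_shift l z)) :: real) \<partial>S) =
    (\<integral>z. of_bool (\<not> all_big l z) \<partial>S) * (\<integral>z. of_bool (no_block l B z) \<partial>S)"
    by (intro integral_prefix_shift[where a = 1 and b = 1 and A = "\<lambda>z. of_bool (\<not> all_big l z)" and B = "\<lambda>z. of_bool (no_block l B z)"]
        prefix_determined_all_big[where h = "\<lambda>b. of_bool (\<not> b)"]) auto
  moreover have "(\<integral>z. of_bool (no_block l (Suc B) z) \<partial>S) = (\<integral>z. of_bool (\<not> all_big l z) * (of_bool (no_block l B (env_shift l z)) :: real) \<partial>S)"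
    by (intro Bochner_Integration.integral_cong) (auto simp: no_block_Suc)
  moreover have "(\<integral>z. of_bool (\<not> all_big l z) \<partial>S) = (\<integral>z. 1 - (of_bool (all_big l z) :: real) \<partial>S)"
    by (intro Bochner_Integration.integral_cong) auto
  moreover have "\<dots> = 1 - big_gap_prob ^ l"
    by (subst Bochner_Integration.integral_diff)
       (auto simp: integral_all_big intro!: integrable_bounded[where b = 1])
  ultimately show ?case using Suc.IH by simp
qed (simp add: no_block_def)

text \<open>\<open>F\<close> takes the environment as well as the history, because pool sizes also
  depend on the arrival times.\<close>

definition annealed :: "nat \<Rightarrow> ((nat \<Rightarrow> nat list) \<Rightarrow> 'n env \<Rightarrow> real) \<Rightarrow> real" where
  "annealed n F = (\<integral>z. measure_pmf.expectation (hist_law z n) (\<lambda>f. F f z) \<partial>S)"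

lemma integrable_expectation:
  fixes F :: "(nat \<Rightarrow> nat list) \<Rightarrow> 'n env \<Rightarrow> real"
  assumes "\<And>f. F f \<in> borel_measurable S" "\<And>f z. f \<in> wf_hist n \<Longrightarrow> \<bar>F f z\<bar> \<le> b"
  shows "integrable S (\<lambda>z. measure_pmf.expectation (hist_law z n) (\<lambda>f. F f z))"
  by (rule integrable_bounded[where b = b, OF measurable_expectation[OF assms(1)]])
     (intro expectation_abs_le finite_hist_law assms(2) hist_law_wf)

lemma annealed_mono:
  assumes "\<And>f. F f \<in> borel_measurable S" "\<And>f z. f \<in> wf_hist n \<Longrightarrow> \<bar>F f z\<bar> \<le> b"
    and "\<And>f. G f \<in> borel_measurable S" "\<And>f z. f \<in> wf_hist n \<Longrightarrow> \<bar>G f z\<bar> \<le> c"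
    and "\<And>f z. f \<in> wf_hist n \<Longrightarrow> F f z \<le> G f z"
  shows "annealed n F \<le> annealed n G"
  unfolding annealed_def
proof (rule integral_mono)
  show "measure_pmf.expectation (hist_law z n) (\<lambda>f. F f z) \<le> measure_pmf.expectation (hist_law z n) (\<lambda>f. G f z)" for z
    by (intro expectation_mono_finite finite_hist_law assms(5)) (rule hist_law_wf)
qed (rule integrable_expectation[OF assms(1,2)] integrable_expectation[OF assms(3,4)]; assumption)+

end

section \<open>Uniform exponential moments and the mixing rate\<close>

lemma linear_le_geometric:
  fixes r :: real
  assumes "1 < r"
  obtains K where "0 < K" "\<And>l :: nat. real l + 1 \<le> K * r ^ l"
proof
  define K where "K = max 1 (1 / (r - 1))"
  show "0 < K" by (simp add: K_def)
  have K: "1 \<le> K" "1 \<le> K * (r - 1)"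
    using assms by (auto simp: K_def max_def field_simps)
  show "real l + 1 \<le> K * r ^ l" for l :: nat
  proof -
    have "1 + real l * (r - 1) \<le> r ^ l" using Bernoulli_inequality[of "r - 1" l] assms by simp
    then have "K * (1 + real l * (r - 1)) \<le> K * r ^ l" using K by (intro mult_left_mono) auto
    moreover have "real l * 1 \<le> real l * (K * (r - 1))" using K by (intro mult_left_mono) auto
    ultimately show ?thesis using K by (simp add: algebra_simps)
  qed
qed

text \<open>The linear bound for the base \<open>root 4 x\<close>, raised to the fourth
  power.\<close>

lemma fourth_power_le_geometric:
  fixes x :: real
  assumes "1 < x"
  obtains K where "0 < K" "\<And>m :: nat. real m ^ 4 \<le> K * x ^ m"
proof -
  have "root 4 x > 1" using assms by simp
  then obtain K where K: "0 < K" "\<And>l :: nat. real l + 1 \<le> K * root 4 x ^ l"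
    by (rule linear_le_geometric) blast
  have "real m ^ 4 \<le> K ^ 4 * x ^ m" for m :: nat
  proof -
    have "real m ^ 4 \<le> (K * root 4 x ^ m) ^ 4" using K(2)[of m] by (intro power_mono) auto
    also have "\<dots> = K ^ 4 * (root 4 x ^ 4) ^ m" by (simp add: power_mult_distrib power_mult[symmetric] mult.commute)
    also have "root 4 x ^ 4 = x" using assms by simp
    finally show ?thesis .
  qed
  then show thesis using K(1) by (intro that[of "K ^ 4"]) auto
qed

context random_environment begin

lemma exponential_moments:
  obtains x C :: real where "1 < x" "0 < C"
    and "\<And>n. annealed n (\<lambda>f z. x ^ tip_count n f) \<le> C"
    and "\<And>n. (\<integral>z. x ^ (drift_const * (runlen z n + 1)) \<partial>S) \<le> C"
proof -
  let ?c = drift_const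
  \<comment> \<open>There are two demands on \<open>x > 1\<close>: it is below 3, so that the drift
    factor is below 1, and so close to 1 that \<open>x ^ drift_const\<close> times the probability
    of a short gap is below 1, which keeps the mean of the additive term of \<open>tip_drift\<close>
    bounded.\<close>
  have "((\<lambda>x :: real. (1 - big_gap_prob) * x ^ ?c) \<longlongrightarrow> (1 - big_gap_prob) * 1 ^ ?c) (at_right 1)"
    by (intro tendsto_intros)
  then have "eventually (\<lambda>x :: real. (1 - big_gap_prob) * x ^ ?c < 1) (at_right 1)"
    using big_gap_prob_bounds by (intro order_tendstoD(2)) auto
  moreover have "eventually (\<lambda>x :: real. x \<in> {1<..<3}) (at_right 1)"
    by (rule eventually_at_right_real) simp
  ultimately have "eventually (\<lambda>x :: real. (1 - big_gap_prob) * x ^ ?c < 1 \<and> x \<in> {1<..<3}) (at_right 1)"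
    by (rule eventually_conj)
  then obtain x :: real where x: "(1 - big_gap_prob) * x ^ ?c < 1" "1 < x" "x < 3"
    using eventually_happens'[OF trivial_limit_at_right_real] by fastforce
  define y where "y = x ^ ?c"
  have y: "1 \<le> y" using x by (simp add: y_def)
  define D where "D = y * (1 / (1 - (1 - big_gap_prob) * y))"
  have D: "0 < D" using x y by (simp add: D_def y_def)
  have powy: "x ^ (?c * (r + 1)) = y * y ^ r" for r :: nat
    by (simp add: y_def power_mult[symmetric] power_add[symmetric])
  have J: "(\<integral>z. x ^ (?c * (runlen z n + 1)) \<partial>S) \<le> D" for n
  proof -
    have "(\<integral>z. x ^ (?c * (runlen z n + 1)) \<partial>S) = y * (\<integral>z. y ^ runlen z n \<partial>S)"
      unfolding powy by simp
    also have "\<dots> \<le> D" unfolding D_def using y x runlen_moment[of y n] by (intro mult_left_mono) (auto simp: y_def)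
    finally show ?thesis .
  qed
  \<comment> \<open>One has \<open>1 - \<rho> = (x - 1) * (3 - x) / (4 * x)\<close>, which is where
    the bound 3 comes from.\<close>
  define \<rho> where "\<rho> = 3 / (4 * x) + x / 4"
  have \<rho>: "0 < \<rho>" "\<rho> < 1"
  proof -
    show "0 < \<rho>" unfolding \<rho>_def using x by (intro add_pos_pos) auto
    have "0 < (x - 1) * (3 - x)" using x by simp
    then show "\<rho> < 1" using x by (simp add: \<rho>_def field_simps)
  qed
  \<comment> \<open>The second summand is the fixed point of the recursion with factor
    \<open>\<rho>\<close> and increment \<open>x * D\<close>; the first covers the start, where
    genesis is the only tip.\<close>
  define C where "C = x + x * D / (1 - \<rho>)"
  have L: "annealed n (\<lambda>f z. x ^ tip_count n f) \<le> C" for n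
  proof (induction n)
    case 0
    have "annealed 0 (\<lambda>f z. x ^ tip_count 0 f) = x"
      by (simp add: annealed_def hist_law_0 tip_count_def idx_tips_def)
    also have "\<dots> \<le> C" using x \<rho> D by (simp add: C_def)
    finally show ?case .
  next
    case (Suc n)
    have bnd: "\<bar>x ^ tip_count m f\<bar> \<le> x ^ Suc m" if "f \<in> wf_hist m" for f m
      using power_increasing[OF tip_count_le[OF that, of m], of x] x by (simp del: power_Suc)
    have int: "integrable S (\<lambda>z. measure_pmf.expectation (hist_law z m) (\<lambda>f. x ^ tip_count m f))" for m
      by (rule integrable_expectation[where b = "x ^ Suc m"]) (auto intro: bnd simp del: power_Suc)
    have intJ: "integrable S (\<lambda>z. x ^ (?c * (runlen z m + 1)))" for m
    proof (rule integrable_bounded[where b = "x ^ (?c * (m + 1))"])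
      show "\<bar>x ^ (?c * (runlen z m + 1))\<bar> \<le> x ^ (?c * (m + 1))" for z :: "'n env"
      proof -
        have "?c * (runlen z m + 1) \<le> ?c * (m + 1)" using runlen_le[of z m] by (intro mult_left_mono) auto
        then have "x ^ (?c * (runlen z m + 1)) \<le> x ^ (?c * (m + 1))" using x by (intro power_increasing) auto
        then show ?thesis using x by simp
      qed
    qed measurable
    have "annealed (Suc n) (\<lambda>f z. x ^ tip_count (Suc n) f) \<le>
      (\<integral>z. \<rho> * measure_pmf.expectation (hist_law z n) (\<lambda>f. x ^ tip_count n f) + x * x ^ (?c * (runlen z (Suc n) + 1)) \<partial>S)"
      unfolding annealed_def
    proof (rule integral_mono[OF int])
      show "integrable S (\<lambda>z. \<rho> * measure_pmf.expectation (hist_law z n) (\<lambda>f. x ^ tip_count n f) + x * x ^ (?c * (runlen z (Suc n) + 1)))"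
        by (intro Bochner_Integration.integrable_add integrable_mult_right int intJ)
    qed (use expected_tip_drift[OF x(2)] in \<open>simp only: \<rho>_def\<close>)
    also have "\<dots> = \<rho> * annealed n (\<lambda>f z. x ^ tip_count n f) + x * (\<integral>z. x ^ (?c * (runlen z (Suc n) + 1)) \<partial>S)"
      unfolding annealed_def
      by (subst Bochner_Integration.integral_add[OF integrable_mult_right[OF int] integrable_mult_right[OF intJ]])
         (simp del: runlen.simps)
    also have "\<dots> \<le> \<rho> * C + x * D"
      by (intro add_mono mult_left_mono Suc.IH J) (use x \<rho> in auto)
    also have "\<dots> \<le> C"
    proof -
      have "C * (1 - \<rho>) = x * (1 - \<rho>) + x * D" using \<rho> by (simp add: C_def field_simps)
      moreover have "0 \<le> x * (1 - \<rho>)" using x \<rho> by simp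
      ultimately show ?thesis by (simp add: algebra_simps)
    qed
    finally show ?case .
  qed
  show thesis
  proof (rule that[of x "max C D"])
    show "annealed n (\<lambda>f z. x ^ tip_count n f) \<le> max C D" for n using L[of n] by simp
    show "(\<integral>z. x ^ (?c * (runlen z n + 1)) \<partial>S) \<le> max C D" for n using J[of n] by simp
  qed (use x D in auto)
qed

lemma integral_shift:
  fixes B :: "'n env \<Rightarrow> real"
  assumes "B \<in> borel_measurable S" "\<And>z. \<bar>B z\<bar> \<le> b"
  shows "(\<integral>z. B (env_shift s z) \<partial>S) = (\<integral>z. B z \<partial>S)"
  using integral_prefix_shift[of "\<lambda>_. 1" B 1 b s] assms by (simp add: prefix_determined_def)

lemma prefix_determined_excess: "prefix_determined n (excess l n)"
  unfolding prefix_determined_def excess_def using hist_law_cong by metis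

text \<open>Independence is used twice. The mean of \<open>u\<close> depends on the first
  \<open>s\<close> coordinates, the window mean on the later ones. At each candidate,
  \<open>excess\<close> depends on the coordinates before the block and \<open>all_big\<close> on
  those inside it, so the factor \<open>big_gap_prob ^ l\<close> survives and offsets the size of
  \<open>B\<close>.\<close>

lemma annealed_mixing:
  fixes u :: "(nat \<Rightarrow> nat list) \<Rightarrow> 'n env \<Rightarrow> real"
  assumes u: "\<And>f z. \<bar>u f z\<bar> \<le> U" and u_cong: "\<And>f g z. (\<And>m. m \<le> s \<Longrightarrow> f m = g m) \<Longrightarrow> u f z = u g z"
    and u_meas: "\<And>f. u f \<in> borel_measurable S" and u_prefix: "\<And>f. prefix_determined s (u f)"
    and phi: "\<And>x. \<bar>\<phi> x\<bar> \<le> T" and l: "1 \<le> l" and w: "B * l \<le> w"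
    and excess: "(\<And>n. (\<integral>z. excess l n z \<partial>S) \<le> e)"
  shows "\<bar>annealed (s + w) (\<lambda>f z. u f z * \<phi> (pool_size z f (s + w) a)) -
      annealed s u * (\<integral>z. window_mean \<phi> a l B w z \<partial>S)\<bar> \<le>
    2 * U * T * ((1 - big_gap_prob ^ l) ^ B + real B * (big_gap_prob ^ l * e))"
proof -
  have U: "0 \<le> U" and T: "0 \<le> T" using order_trans[OF abs_ge_zero u] order_trans[OF abs_ge_zero phi] by auto
  define E where "E z = measure_pmf.expectation (hist_law z (s + w)) (\<lambda>f. u f z * \<phi> (pool_size z f (s + w) a))" for z
  define V where "V z = measure_pmf.expectation (hist_law z s) (\<lambda>f. u f z)" for z
  define W where "W = window_mean \<phi> a l B w"
  have int_E: "integrable S E"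
    unfolding E_def by (rule integrable_expectation[where b = "U * T"])
      (auto simp: abs_mult intro!: mult_mono u phi U borel_measurable_times u_meas)
  have V_meas: "V \<in> borel_measurable S" unfolding V_def by (rule measurable_expectation[OF u_meas])
  have V_le: "\<bar>V z\<bar> \<le> U" for z unfolding V_def by (rule expectation_abs_le) (auto intro: u)
  have V_prefix: "prefix_determined s V"
    unfolding prefix_determined_def
  proof (intro allI impI)
    fix z z' :: "'n env" assume zz: "\<forall>j<s. z j = z' j"
    then have "hist_law z s = hist_law z' s" by (intro hist_law_cong) auto
    moreover have "u f z = u f z'" for f by (rule prefix_determinedD[OF u_prefix]) (use zz in auto)
    ultimately show "V z = V z'" by (simp add: V_def)
  qed
  have W_meas: "W \<in> borel_measurable S" unfolding W_def by measurable
  have W_le: "\<bar>W z\<bar> \<le> T" for z unfolding W_def by (rule window_mean_abs_le[OF phi])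
  have VW: "(\<integral>z. V z * W (env_shift s z) \<partial>S) = (\<integral>z. V z \<partial>S) * (\<integral>z. W z \<partial>S)"
    by (rule integral_prefix_shift[OF V_meas W_meas V_le W_le V_prefix])
  have Ws_meas: "(\<lambda>z. W (env_shift s z)) \<in> borel_measurable S"
    by (rule measurable_compose[OF measurable_env_shift W_meas])
  have int_VW: "integrable S (\<lambda>z. V z * W (env_shift s z))"
    by (rule integrable_bounded[where b = "U * T"])
       (auto simp: abs_mult intro!: mult_mono V_le W_le U borel_measurable_times V_meas Ws_meas)
  define N where "N z = (of_bool (no_block l B (env_shift s z)) :: real)" for z :: "'n env"
  define G where "G i z = of_bool (all_big l (env_shift (s + i * l) z)) * excess l (s + i * l) z" for i and z :: "'n env"
  have ebnd: "\<bar>excess l n z\<bar> \<le> 1" for n and z :: "'n env" using excess_nonneg[of l n z] excess_le_1[of l n z] by simp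
  have nb_meas: "(\<lambda>z. of_bool (no_block l B z) :: real) \<in> borel_measurable S" by measurable
  have N_meas: "N \<in> borel_measurable S"
    unfolding N_def by (rule measurable_compose[OF measurable_env_shift nb_meas])
  have int_N: "integrable S N" 
    by (rule integrable_bounded[where b = 1, OF N_meas]) (simp add: N_def)
  have int_G: "integrable S (G i)" for i
    unfolding G_def by (rule integrable_bounded[where b = 1]) (auto simp: ebnd)
  have "annealed (s + w) (\<lambda>f z. u f z * \<phi> (pool_size z f (s + w) a)) - annealed s u * (\<integral>z. W z \<partial>S) =
      (\<integral>z. E z - V z * W (env_shift s z) \<partial>S)"
    unfolding Bochner_Integration.integral_diff[OF int_E int_VW] VW by (simp only: annealed_def E_def[abs_def] V_def[abs_def])
  also have "\<bar>\<dots>\<bar> \<le> (\<integral>z. \<bar>E z - V z * W (env_shift s z)\<bar> \<partial>S)" by (rule integral_abs_bound)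
  also have "\<dots> \<le> (\<integral>z. 2 * U * T * (N z + (\<Sum>i<B. G i z)) \<partial>S)"
  proof (rule integral_mono)
    show "integrable S (\<lambda>z. \<bar>E z - V z * W (env_shift s z)\<bar>)"
      by (intro integrable_abs Bochner_Integration.integrable_diff int_E int_VW)
    show "integrable S (\<lambda>z. 2 * U * T * (N z + (\<Sum>i<B. G i z)))"
      by (intro integrable_mult_right Bochner_Integration.integrable_add Bochner_Integration.integrable_sum int_N int_G)
    show "\<bar>E z - V z * W (env_shift s z)\<bar> \<le> 2 * U * T * (N z + (\<Sum>i<B. G i z))" for z
      unfolding E_def V_def W_def N_def G_def
      by (rule quenched_mixing[OF u u_cong phi l w]) 
  qed
  also have "\<dots> = 2 * U * T * ((\<integral>z. N z \<partial>S) + (\<Sum>i<B. \<integral>z. G i z \<partial>S))"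
    by (simp add: Bochner_Integration.integral_add[OF int_N Bochner_Integration.integrable_sum[OF int_G]]
        Bochner_Integration.integral_sum[OF int_G])
  also have "(\<integral>z. N z \<partial>S) = (1 - big_gap_prob ^ l) ^ B"
    unfolding N_def by (subst integral_shift[OF nb_meas, of 1]) (auto simp: integral_no_block)
  also have "(\<Sum>i<B. \<integral>z. G i z \<partial>S) \<le> (\<Sum>i<B. big_gap_prob ^ l * e)"
  proof (rule sum_mono)
    fix i
    have "(\<integral>z. G i z \<partial>S) = (\<integral>z. excess l (s + i * l) z * of_bool (all_big l (env_shift (s + i * l) z)) \<partial>S)"
      by (simp add: G_def mult.commute)
    also have "\<dots> = (\<integral>z. excess l (s + i * l) z \<partial>S) * (\<integral>z. of_bool (all_big l z) \<partial>S)"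
      by (rule integral_prefix_shift[where a = 1 and b = 1 and A = "excess l (s + i * l)" and B = "\<lambda>z. of_bool (all_big l z)"])
         (auto simp: ebnd prefix_determined_excess)
    also have "\<dots> \<le> e * big_gap_prob ^ l"
      unfolding integral_all_big using big_gap_prob_bounds by (intro mult_right_mono excess) auto
    finally show "(\<integral>z. G i z \<partial>S) \<le> big_gap_prob ^ l * e" by (simp add: mult.commute)
  qed
  finally show ?thesis using U T by (simp add: W_def mult_left_mono)
qed

text \<open>Markov's inequality for \<open>x ^ tip_count n f\<close>.\<close>

lemma excess_bound:
  assumes x: "1 < x" and "\<And>n. annealed n (\<lambda>f z. x ^ tip_count n f) \<le> C"
  shows "(\<integral>z. excess l n z \<partial>S) \<le> C / x ^ l"
proof -
  have "(\<integral>z. x ^ l * excess l n z \<partial>S) \<le> annealed n (\<lambda>f z. x ^ tip_count n f)"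
    unfolding annealed_def
  proof (rule integral_mono)
    show "integrable S (\<lambda>z. x ^ l * excess l n z)"
    proof (intro integrable_mult_right integrable_bounded[where b = 1])
      show "\<bar>excess l n z\<bar> \<le> 1" for z :: "'n env" using excess_nonneg[of l n z] excess_le_1[of l n z] by simp
    qed measurable
    show "integrable S (\<lambda>z. measure_pmf.expectation (hist_law z n) (\<lambda>f. x ^ tip_count n f))"
    proof (rule integrable_expectation[where b = "x ^ Suc n"])
      show "\<bar>x ^ tip_count n f\<bar> \<le> x ^ Suc n" if "f \<in> wf_hist n" for f
        using power_increasing[OF tip_count_le[OF that, of n], of x] x by (simp del: power_Suc)
    qed simp
    show "x ^ l * excess l n z \<le> measure_pmf.expectation (hist_law z n) (\<lambda>f. x ^ tip_count n f)" for z
    proof -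
      have "x ^ l * excess l n z = measure_pmf.expectation (hist_law z n) (\<lambda>f. x ^ l * of_bool (l < tip_count n f))"
        by (simp add: excess_def)
      also have "\<dots> \<le> measure_pmf.expectation (hist_law z n) (\<lambda>f. x ^ tip_count n f)"
        by (rule expectation_mono_finite) (use x in \<open>auto intro: power_increasing\<close>)
      finally show ?thesis .
    qed
  qed
  then have "x ^ l * (\<integral>z. excess l n z \<partial>S) \<le> C" using assms(2)[of n] by simp
  then show ?thesis using x by (simp add: field_simps)
qed

text \<open>By \<open>pool_size_le\<close> a pool is at most the tip count \<open>u\<close> plus a
  multiple \<open>v\<close> of the run length plus one. The inequality
  \<open>(u + v)^4 \<le> 8 * (u^4 + v^4)\<close> separates the two, and each has a uniform
  exponential moment.\<close>

lemma fourth_moment_bound: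
  obtains C :: real where "\<And>n a. annealed n (\<lambda>f z. real (pool_size z f n a) ^ 4) \<le> C"
proof -
  obtain x C :: real where x: "1 < x" and C: "0 < C"
    and L: "\<And>n. annealed n (\<lambda>f z. x ^ tip_count n f) \<le> C"
    and J: "\<And>n. (\<integral>z. x ^ (drift_const * (runlen z n + 1)) \<partial>S) \<le> C"
    by (rule exponential_moments) blast
  obtain K :: real where K: "0 < K" "\<And>m :: nat. real m ^ 4 \<le> K * x ^ m"
    using fourth_power_le_geometric[OF x] by blast
  have "annealed n (\<lambda>f z. real (pool_size z f n a) ^ 4) \<le> 8 * K * (C + C)" for n a
  proof -
    have pw: "x ^ tip_count n f \<le> x ^ Suc n" if "f \<in> wf_hist n" for f
      using power_increasing[OF tip_count_le[OF that, of n], of x] x by simp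
    have pj: "x ^ (drift_const * (runlen z n + 1)) \<le> x ^ (drift_const * (n + 1))" for z :: "'n env"
    proof (rule power_increasing)
      show "drift_const * (runlen z n + 1) \<le> drift_const * (n + 1)"
        using runlen_le[of z n] by (intro mult_left_mono) auto
    qed (use x in simp)
    have pos: "0 \<le> x ^ m" for m using x by simp
    have main: "real (pool_size z f n a) ^ 4 \<le> 8 * K * (x ^ tip_count n f + x ^ (drift_const * (runlen z n + 1)))"
      if f: "f \<in> wf_hist n" for f and z :: "'n env"
    proof -
      define u v where "u = tip_count n f" and "v = k * (runlen z n + 1)"
      have "real (pool_size z f n a) ^ 4 \<le> (real u + real v) ^ 4"
        using pool_size_le[OF f, of z n a] unfolding u_def v_def
        by (intro power_mono) (auto simp flip: of_nat_add of_nat_mult)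
      also have "\<dots> \<le> 8 * (real u ^ 4 + real v ^ 4)"
      proof -
        have "(real u + real v)\<^sup>2 \<le> 2 * ((real u)\<^sup>2 + (real v)\<^sup>2)"
          using sum_squares_bound[of "real u" "real v"] by (simp add: power2_sum)
        then have "((real u + real v)\<^sup>2)\<^sup>2 \<le> (2 * ((real u)\<^sup>2 + (real v)\<^sup>2))\<^sup>2" by (intro power_mono) auto
        also have "\<dots> \<le> 8 * (((real u)\<^sup>2)\<^sup>2 + ((real v)\<^sup>2)\<^sup>2)"
          using sum_squares_bound[of "(real u)\<^sup>2" "(real v)\<^sup>2"] by (simp add: power2_sum power_mult_distrib)
        finally show ?thesis by (simp add: power_mult[symmetric])
      qed
      also have "\<dots> \<le> 8 * (K * x ^ u + K * x ^ v)" by (intro mult_left_mono add_mono K) auto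
      \<comment> \<open>\<open>k\<close> is at most \<open>drift_const\<close>, the factor for which
        the exponential moment of the run length is available.\<close>
      also have "x ^ v \<le> x ^ (drift_const * (runlen z n + 1))"
        unfolding v_def using x by (intro power_increasing mult_right_mono) (auto simp: drift_const_def)
      finally show ?thesis using K(1) by (simp add: u_def algebra_simps)
    qed
    have "annealed n (\<lambda>f z. real (pool_size z f n a) ^ 4) \<le>
      annealed n (\<lambda>f z. 8 * K * (x ^ tip_count n f + x ^ (drift_const * (runlen z n + 1))))"
    proof (rule annealed_mono[where b = "8 * K * (x ^ Suc n + x ^ (drift_const * (n + 1)))" and c = "8 * K * (x ^ Suc n + x ^ (drift_const * (n + 1)))"])
      fix f and z :: "'n env" assume f: "f \<in> wf_hist n"
      have *: "8 * K * (x ^ tip_count n f + x ^ (drift_const * (runlen z n + 1))) \<le> 8 * K * (x ^ Suc n + x ^ (drift_const * (n + 1)))"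
        using K(1) by (intro mult_left_mono add_mono pw[OF f] pj) auto
      then show "\<bar>8 * K * (x ^ tip_count n f + x ^ (drift_const * (runlen z n + 1)))\<bar> \<le> 8 * K * (x ^ Suc n + x ^ (drift_const * (n + 1)))"
        using K(1) pos by (subst abs_of_nonneg) (auto intro!: mult_nonneg_nonneg add_nonneg_nonneg simp del: power_Suc)
      show "\<bar>real (pool_size z f n a) ^ 4\<bar> \<le> 8 * K * (x ^ Suc n + x ^ (drift_const * (n + 1)))"
        using main[OF f, of z] * by simp
    qed (use main in auto)
    also have "\<dots> = 8 * K * (annealed n (\<lambda>f z. x ^ tip_count n f) + (\<integral>z. x ^ (drift_const * (runlen z n + 1)) \<partial>S))"
    proof -
      have 1: "measure_pmf.expectation (hist_law z n) (\<lambda>f. 8 * K * (x ^ tip_count n f + x ^ (drift_const * (runlen z n + 1)))) =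
        8 * K * (measure_pmf.expectation (hist_law z n) (\<lambda>f. x ^ tip_count n f) + x ^ (drift_const * (runlen z n + 1)))" for z
        by (subst integral_mult_right_zero, subst Bochner_Integration.integral_add) (auto intro: integrable_measure_pmf_finite)
      have 2: "integrable S (\<lambda>z. measure_pmf.expectation (hist_law z n) (\<lambda>f. x ^ tip_count n f))"
        by (rule integrable_expectation[where b = "x ^ Suc n"]) (use pw pos in \<open>auto simp del: power_Suc\<close>)
      have 3: "integrable S (\<lambda>z. x ^ (drift_const * (runlen z n + 1)))"
        by (rule integrable_bounded[where b = "x ^ (drift_const * (n + 1))"]) (use pj pos in auto)
      show ?thesis unfolding annealed_def 1
        by (subst integral_mult_right_zero, subst Bochner_Integration.integral_add[OF 2 3]) simp
    qed
    also have "\<dots> \<le> 8 * K * (C + C)" using K(1) by (intro mult_left_mono add_mono L J) auto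
    finally show ?thesis .
  qed
  then show thesis by (rule that)
qed

text \<open>Write \<open>a\<close> for \<open>big_gap_prob\<close> and take \<open>B\<close> to be
  \<open>l / a^l\<close> rounded up. Then \<open>(1 - a^l)^B \<le> exp (- l)\<close>; the factor
  \<open>B * a^l \<le> l + 1\<close> is absorbed by \<open>sqrt x ^ l\<close>, half of the decay of
  \<open>C / x^l\<close>; and \<open>B * l \<le> (l^2 + l) / a^l \<le> (4 / a)^l\<close>, whence
  \<open>A = 4 / a\<close>.\<close>

lemma block_parameters:
  fixes x C :: real
  assumes x: "1 < x" and C: "0 < C"
  obtains K q A :: real where "0 < K" "0 < q" "q < 1" "1 < A"
    "\<And>l. 1 \<le> l \<Longrightarrow> \<exists>B. real (B * l) \<le> A ^ l \<and>
       (1 - big_gap_prob ^ l) ^ B + real B * (big_gap_prob ^ l * (C / x ^ l)) \<le> K * q ^ l"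
proof -
  let ?a = big_gap_prob
  have "1 < sqrt x" using x by simp
  then obtain K :: real where K: "0 < K" "\<And>l :: nat. real l + 1 \<le> K * sqrt x ^ l"
    by (rule linear_le_geometric) blast
  define q where "q = max (exp (- 1)) (1 / sqrt x)"
  have q: "0 < q" "q < 1" using x by (auto simp: q_def max_def)
  define A where "A = 4 / ?a"
  have A: "1 < A" using big_gap_prob_bounds by (simp add: A_def field_simps)
  have bnd: "\<exists>B. real (B * l) \<le> A ^ l \<and> (1 - ?a ^ l) ^ B + real B * (?a ^ l * (C / x ^ l)) \<le> (1 + C * K) * q ^ l"
    if l: "1 \<le> l" for l
  proof -
    define b where "b = ?a ^ l"
    have b: "0 < b" "b \<le> 1" using big_gap_prob_bounds by (auto simp: b_def power_le_one)
    define B where "B = nat \<lceil>real l / b\<rceil>"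
    have B: "real l / b \<le> real B" "real B \<le> real l / b + 1"
      using b by (auto simp: B_def of_nat_ceiling)
    have sq: "real l ^ 2 + real l \<le> 4 ^ l"
    proof (induction l)
      case (Suc l)
      have "l < 4 ^ l" by (rule power_gt_expt) simp
      then have "Suc l \<le> 4 ^ l" by simp
      then have "real (Suc l) \<le> real (4 ^ l)" by (rule of_nat_mono)
      then have "real l + 1 \<le> (4 :: real) ^ l" by simp
      then have "2 * (real l + 1) \<le> 2 * (4 :: real) ^ l" by simp
      also have "\<dots> \<le> 3 * (4 :: real) ^ l" by simp
      finally have "2 * (real l + 1) \<le> 3 * (4 :: real) ^ l" .
      then show ?case using Suc by (simp add: power2_eq_square algebra_simps)
    qed simp
    have "real (B * l) \<le> (real l / b + 1) * real l" using B by (simp add: mult_right_mono)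
    also have "\<dots> \<le> (real l ^ 2 + real l) / b"
    proof -
      have "real l * b \<le> real l" using b by (simp add: mult_left_le)
      then show ?thesis using b by (simp add: field_simps power2_eq_square)
    qed
    also have "\<dots> \<le> 4 ^ l / b" using b sq by (intro divide_right_mono) auto
    also have "\<dots> = A ^ l" by (simp add: A_def b_def power_divide)
    finally have 1: "real (B * l) \<le> A ^ l" .
    have "(1 - b) ^ B \<le> exp (- b) ^ B" using b exp_ge_add_one_self[of "- b"] by (intro power_mono) auto
    also have "\<dots> = exp (- (b * real B))" by (simp add: exp_of_nat_mult[symmetric] mult.commute)
    also have "\<dots> \<le> exp (- real l)" using B(1) b by (simp add: field_simps)
    also have "\<dots> = exp (- 1) ^ l" by (simp add: exp_of_nat_mult[symmetric])
    also have "\<dots> \<le> q ^ l" by (intro power_mono) (auto simp: q_def)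
    finally have 2: "(1 - b) ^ B \<le> q ^ l" .
    have "real B * b \<le> real l + 1"
    proof -
      have "real B * b \<le> (real l / b + 1) * b" using B b by (intro mult_right_mono) auto
      also have "\<dots> = real l + b" using b by (simp add: field_simps)
      finally show ?thesis using b by simp
    qed
    then have "real B * b * (C / x ^ l) \<le> K * sqrt x ^ l * (C / x ^ l)"
      using K(2)[of l] C x by (intro mult_right_mono) auto
    also have "\<dots> = C * K * (sqrt x / x) ^ l" by (simp add: power_divide)
    also have "sqrt x / x = 1 / sqrt x" using x by (simp add: field_simps)
    also have "C * K * (1 / sqrt x) ^ l \<le> C * K * q ^ l"
      using C K(1) x by (intro mult_left_mono power_mono) (auto simp: q_def)
    finally have "(1 - b) ^ B + real B * (b * (C / x ^ l)) \<le> (1 + C * K) * q ^ l"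
      using 2 by (simp add: algebra_simps)
    then show ?thesis using 1 unfolding b_def by blast
  qed
  show thesis by (rule that[OF _ q A bnd]) (use C K in \<open>auto intro: add_pos_pos\<close>)
qed

lemma prefix_determined_pool_size: "prefix_determined n (\<lambda>z :: 'n env. \<phi> (pool_size z f n a))"
  unfolding prefix_determined_def by (intro allI impI arg_cong[where f = \<phi>] pool_size_cong) auto

text \<open>Both claims compare with an integrated window mean. In the first, the windows formed by
  the last \<open>B * l\<close> steps before \<open>n\<close> and before \<open>n'\<close> share the
  same one, as it does not depend on where the window starts. In the second, the window fills the
  whole distance \<open>n - s\<close>.\<close>

lemma mixing:
  obtains K q A :: real where "0 < K" "0 < q" "q < 1" "1 < A"
    "\<And>l n n' \<phi> T a. 1 \<le> l \<Longrightarrow> A ^ l \<le> real n \<Longrightarrow> A ^ l \<le> real n' \<Longrightarrow> (\<And>x. \<bar>\<phi> x\<bar> \<le> T) \<Longrightarrow>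
      \<bar>annealed n (\<lambda>f z. \<phi> (pool_size z f n a)) - annealed n' (\<lambda>f z. \<phi> (pool_size z f n' a))\<bar> \<le> K * T * q ^ l"
    "\<And>l s n \<phi> T a. 1 \<le> l \<Longrightarrow> s \<le> n \<Longrightarrow> A ^ l \<le> real (n - s) \<Longrightarrow> (\<And>x. \<bar>\<phi> x\<bar> \<le> T) \<Longrightarrow>
      \<bar>annealed n (\<lambda>f z. \<phi> (pool_size z f s a) * \<phi> (pool_size z f n a)) -
        annealed s (\<lambda>f z. \<phi> (pool_size z f s a)) * annealed n (\<lambda>f z. \<phi> (pool_size z f n a))\<bar> \<le> K * T^2 * q ^ l"
proof -
  obtain x C :: real where x: "1 < x" and C: "0 < C"
    and L: "\<And>n. annealed n (\<lambda>f z. x ^ tip_count n f) \<le> C"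
    by (rule exponential_moments) blast
  obtain K q A :: real where K: "0 < K" and q: "0 < q" "q < 1" and A: "1 < A"
    and B: "\<And>l. 1 \<le> l \<Longrightarrow> \<exists>B. real (B * l) \<le> A ^ l \<and>
       (1 - big_gap_prob ^ l) ^ B + real B * (big_gap_prob ^ l * (C / x ^ l)) \<le> K * q ^ l"
    using block_parameters[OF x C] by blast
  have ex: "(\<integral>z. excess l n z \<partial>S) \<le> C / x ^ l" for l n by (rule excess_bound[OF x L])
  \<comment> \<open>\<open>annealed_mixing\<close> with the constant factor \<open>u = 1\<close> and
    the window of length \<open>w\<close> that ends at \<open>n\<close>.\<close>
  have one: "\<bar>annealed n (\<lambda>f z. \<phi> (pool_size z f n a)) - (\<integral>z. window_mean \<phi> a l B w z \<partial>S)\<bar> \<le> 2 * T * (K * q ^ l)"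
    if "1 \<le> l" "B * l \<le> w" "w \<le> n" "\<And>x. \<bar>\<phi> x\<bar> \<le> T"
      "(1 - big_gap_prob ^ l) ^ B + real B * (big_gap_prob ^ l * (C / x ^ l)) \<le> K * q ^ l" for l n T a B w and \<phi> :: "nat \<Rightarrow> real"
  proof -
    have T: "0 \<le> T" using order_trans[OF abs_ge_zero that(4)] .
    have n: "n - w + w = n" using that(3) by simp
    have "\<bar>annealed (n - w + w) (\<lambda>f z. 1 * \<phi> (pool_size z f (n - w + w) a)) -
      annealed (n - w) (\<lambda>f z. 1) * (\<integral>z. window_mean \<phi> a l B w z \<partial>S)\<bar> \<le>
      2 * 1 * T * ((1 - big_gap_prob ^ l) ^ B + real B * (big_gap_prob ^ l * (C / x ^ l)))"
      by (rule annealed_mixing[OF _ _ _ _ that(4,1,2) ex]) (auto simp: prefix_determined_def)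
    also have "\<dots> \<le> 2 * 1 * T * (K * q ^ l)" using that(5) T by (intro mult_left_mono) auto
    finally show ?thesis unfolding n by (simp add: annealed_def)
  qed
  show thesis
  proof (rule that[of "4 * K" q A])
    fix l n n' :: nat and \<phi> :: "nat \<Rightarrow> real" and T and a :: "'n option"
    assume l: "1 \<le> l" and n: "A ^ l \<le> real n" "A ^ l \<le> real n'" and phi: "\<And>x. \<bar>\<phi> x\<bar> \<le> (T :: real)"
    obtain B where B: "real (B * l) \<le> A ^ l"
      "(1 - big_gap_prob ^ l) ^ B + real B * (big_gap_prob ^ l * (C / x ^ l)) \<le> K * q ^ l"
      using B[OF l] by blast
    have "B * l \<le> n" "B * l \<le> n'" using B(1) n by (metis of_nat_le_iff order_trans)+
    have "\<bar>annealed n (\<lambda>f z. \<phi> (pool_size z f n a)) - (\<integral>z. window_mean \<phi> a l B (B * l) z \<partial>S)\<bar> \<le> 2 * T * (K * q ^ l)"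
      by (rule one[OF l order_refl \<open>B * l \<le> n\<close> _ B(2)]) (rule phi)
    moreover have "\<bar>annealed n' (\<lambda>f z. \<phi> (pool_size z f n' a)) - (\<integral>z. window_mean \<phi> a l B (B * l) z \<partial>S)\<bar> \<le> 2 * T * (K * q ^ l)"
      by (rule one[OF l order_refl \<open>B * l \<le> n'\<close> _ B(2)]) (rule phi)
    ultimately show "\<bar>annealed n (\<lambda>f z. \<phi> (pool_size z f n a)) - annealed n' (\<lambda>f z. \<phi> (pool_size z f n' a))\<bar> \<le> 4 * K * T * q ^ l"
      by (simp add: algebra_simps)
  next
    fix l s n :: nat and \<phi> :: "nat \<Rightarrow> real" and T and a :: "'n option"
    assume l: "1 \<le> l" and s: "s \<le> n" and n: "A ^ l \<le> real (n - s)" and phi: "\<And>x. \<bar>\<phi> x\<bar> \<le> (T :: real)"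
    obtain B where B: "real (B * l) \<le> A ^ l"
      "(1 - big_gap_prob ^ l) ^ B + real B * (big_gap_prob ^ l * (C / x ^ l)) \<le> K * q ^ l"
      using B[OF l] by blast
    define w where "w = n - s"
    have w: "B * l \<le> w" "s + w = n" "w \<le> n" using B(1) n s unfolding w_def by (auto simp del: of_nat_mult)
    have T: "0 \<le> T" using order_trans[OF abs_ge_zero phi] .
    let ?u = "annealed s (\<lambda>f z. \<phi> (pool_size z f s a))"
    let ?v = "annealed n (\<lambda>f z. \<phi> (pool_size z f n a))"
    let ?W = "\<integral>z. window_mean \<phi> a l B w z \<partial>S"
    have "\<bar>annealed (s + w) (\<lambda>f z. \<phi> (pool_size z f s a) * \<phi> (pool_size z f (s + w) a)) - ?u * ?W\<bar> \<le>
      2 * T * T * ((1 - big_gap_prob ^ l) ^ B + real B * (big_gap_prob ^ l * (C / x ^ l)))"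
    proof (rule annealed_mixing[OF phi _ _ prefix_determined_pool_size phi l w(1) ex])
      show "\<phi> (pool_size z f s a) = \<phi> (pool_size z g s a)" if "\<And>m. m \<le> s \<Longrightarrow> f m = g m" for f g and z :: "'n env"
        using pool_size_hist_cong[of s f g z a] that by simp
    qed simp
    also have "\<dots> \<le> 2 * T * T * (K * q ^ l)" using B(2) T by (intro mult_left_mono) auto
    finally have 1: "\<bar>annealed n (\<lambda>f z. \<phi> (pool_size z f s a) * \<phi> (pool_size z f n a)) - ?u * ?W\<bar> \<le> 2 * T * T * (K * q ^ l)"
      unfolding w(2) .
    \<comment> \<open>Replacing the window mean by the mean at time \<open>n\<close> costs the same
      error once more, whence the constant \<open>4 * K\<close>.\<close>
    have "\<bar>?v - ?W\<bar> \<le> 2 * T * (K * q ^ l)" by (rule one[OF l w(1,3) _ B(2)]) (rule phi)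
    moreover have "\<bar>?u\<bar> \<le> T"
    proof -
      have int: "integrable S (\<lambda>z. measure_pmf.expectation (hist_law z s) (\<lambda>f. \<phi> (pool_size z f s a)))"
        by (rule integrable_expectation[where b = T]) (auto intro: phi)
      have "\<bar>?u\<bar> \<le> (\<integral>z. \<bar>measure_pmf.expectation (hist_law z s) (\<lambda>f. \<phi> (pool_size z f s a))\<bar> \<partial>S)"
        unfolding annealed_def by (rule integral_abs_bound)
      also have "\<dots> \<le> (\<integral>z. T \<partial>S)"
        by (intro integral_mono integrable_abs int expectation_abs_le phi) auto
      finally show ?thesis by simp
    qed
    ultimately have "\<bar>?u * (?v - ?W)\<bar> \<le> T * (2 * T * (K * q ^ l))"
      unfolding abs_mult using T by (intro mult_mono) auto
    then have "\<bar>?u * ?W - ?u * ?v\<bar> \<le> T * (2 * T * (K * q ^ l))"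
      by (simp add: algebra_simps abs_minus_commute)
    with 1 show "\<bar>annealed n (\<lambda>f z. \<phi> (pool_size z f s a) * \<phi> (pool_size z f n a)) - ?u * ?v\<bar> \<le> 4 * K * T^2 * q ^ l"
      by (simp add: power2_eq_square algebra_simps)
  qed (use K q A in auto)
qed

end

section \<open>From the block issuance model to the index model\<close>

text \<open>The conclusions have the shape of the hypotheses, so the lemma can be iterated along a
  nested product; three rounds give boxes as a generator of \<open>primitive_space\<close>.\<close>

lemma sets_pair_rectangles:
  assumes "Int_stable E" "E \<subseteq> Pow (space B)" "space B \<in> E" "sets B = sigma_sets (space B) E"
  shows "Int_stable {a \<times> b | a b. a \<in> sets A \<and> b \<in> E}"
    "{a \<times> b | a b. a \<in> sets A \<and> b \<in> E} \<subseteq> Pow (space (A \<Otimes>\<^sub>M B))"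
    "space (A \<Otimes>\<^sub>M B) \<in> {a \<times> b | a b. a \<in> sets A \<and> b \<in> E}"
    "sets (A \<Otimes>\<^sub>M B) = sigma_sets (space (A \<Otimes>\<^sub>M B)) {a \<times> b | a b. a \<in> sets A \<and> b \<in> E}"
proof -
  show "Int_stable {a \<times> b | a b. a \<in> sets A \<and> b \<in> E}"
  proof (rule Int_stableI, safe)
    fix a b c d assume "a \<in> sets A" "b \<in> E" "c \<in> sets A" "d \<in> E"
    then show "\<exists>a' b'. a \<times> b \<inter> c \<times> d = a' \<times> b' \<and> a' \<in> sets A \<and> b' \<in> E"
      using Int_stableD[OF assms(1), of b d] by (intro exI[of _ "a \<inter> c"] exI[of _ "b \<inter> d"]) auto
  qed
  show sub: "{a \<times> b | a b. a \<in> sets A \<and> b \<in> E} \<subseteq> Pow (space (A \<Otimes>\<^sub>M B))"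
    using assms(2) sets.sets_into_space by (fastforce simp: space_pair_measure)
  show "space (A \<Otimes>\<^sub>M B) \<in> {a \<times> b | a b. a \<in> sets A \<and> b \<in> E}"
    using assms(3) by (auto simp: space_pair_measure)
  have "sets (A \<Otimes>\<^sub>M B) = sets (sigma (space A \<times> space B) {a \<times> b | a b. a \<in> sets A \<and> b \<in> E})"
    by (rule sets_pair_eq[where Ca = "{space A}" and Cb = "{space B}"])
       (use assms sets.space_closed[of A] in \<open>auto simp: sets.sigma_sets_eq\<close>)
  also have "\<dots> = sigma_sets (space (A \<Otimes>\<^sub>M B)) {a \<times> b | a b. a \<in> sets A \<and> b \<in> E}"
    using sub by (simp add: space_pair_measure)
  finally show "sets (A \<Otimes>\<^sub>M B) = sigma_sets (space (A \<Otimes>\<^sub>M B)) {a \<times> b | a b. a \<in> sets A \<and> b \<in> E}" .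
qed

lemma space_primitive_space [simp]: "space primitive_space = UNIV"
  by (simp add: primitive_space_def space_pair_measure)

text \<open>Boxes form an intersection-stable generator; the law of the primitives is given on boxes
  only.\<close>

lemma primitive_measure_eqI:
  fixes \<mu> \<nu> :: "(real \<times> real \<times> 'n :: finite \<times> (real ^ 'n)) measure"
  assumes "sets \<mu> = sets primitive_space" "sets \<nu> = sets primitive_space" "finite_measure \<mu>"
    and eq: "\<And>A B I C. A \<in> sets borel \<Longrightarrow> B \<in> sets borel \<Longrightarrow> C \<in> sets borel \<Longrightarrow>
      emeasure \<mu> (A \<times> B \<times> I \<times> C) = emeasure \<nu> (A \<times> B \<times> I \<times> C)"
  shows "\<mu> = \<nu>"
proof -
  interpret finite_measure \<mu> by fact
  let ?E0 = "sets (borel :: (real ^ 'n) measure)"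
  let ?E1 = "{a \<times> b | a b. a \<in> sets (count_space (UNIV :: 'n set)) \<and> b \<in> ?E0}"
  let ?E2 = "{a \<times> b | a b. a \<in> sets (borel :: real measure) \<and> b \<in> ?E1}"
  let ?E3 = "{a \<times> b | a b. a \<in> sets (borel :: real measure) \<and> b \<in> ?E2}"
  have E0: "Int_stable ?E0" "?E0 \<subseteq> Pow (space borel)" "space borel \<in> ?E0" "sets borel = sigma_sets (space borel) ?E0"
    by (auto intro: Int_stableI simp: sets.sigma_sets_eq[of borel, simplified])
  note E1 = sets_pair_rectangles[OF E0, where A = "count_space (UNIV :: 'n set)"]
  note E2 = sets_pair_rectangles[OF E1, where A = "borel :: real measure"]
  note E3 = sets_pair_rectangles[OF E2, where A = "borel :: real measure"]
  show ?thesis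
  proof (rule measure_eqI_generator_eq[OF E3(1,2), of _ _ "\<lambda>_. UNIV"])
    show "sets \<mu> = sigma_sets (space (borel \<Otimes>\<^sub>M borel \<Otimes>\<^sub>M count_space UNIV \<Otimes>\<^sub>M borel)) ?E3"
      "sets \<nu> = sigma_sets (space (borel \<Otimes>\<^sub>M borel \<Otimes>\<^sub>M count_space UNIV \<Otimes>\<^sub>M borel)) ?E3"
      using assms(1,2) E3(4) by (simp_all add: primitive_space_def)
    show "emeasure \<mu> X = emeasure \<nu> X" if "X \<in> ?E3" for X using that eq by auto
    show "range (\<lambda>_ :: nat. UNIV) \<subseteq> ?E3" using E3(3) by (auto simp: space_pair_measure)
  qed (auto simp: space_pair_measure)
qed

section \<open>The law of the environment in the block model\<close>

context block_issuance begin

abbreviation prims :: "nat \<Rightarrow> 'a \<Rightarrow> real \<times> real \<times> 'n \<times> (real ^ 'n)" where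
  "prims \<equiv> primitives t bid issuer delay"

definition prim_law :: "(real \<times> real \<times> 'n \<times> (real ^ 'n)) measure" where
  "prim_law = distr M primitive_space (prims 1)"

definition env :: "'a \<Rightarrow> 'n env" where
  "env \<omega> = (\<lambda>j. prims (Suc j) \<omega>)"

lemma measurable_prims: "1 \<le> n \<Longrightarrow> prims n \<in> measurable M primitive_space"
  using primitives_indep by (simp add: indep_vars_def)

lemma measurable_gap_time [measurable]: "1 \<le> n \<Longrightarrow> (\<lambda>\<omega>. t n \<omega> - t (n - 1) \<omega>) \<in> borel_measurable M"
  using measurable_compose[OF measurable_prims[of n], of fst borel]
  by (simp add: primitives_def primitive_space_def)

lemma measurable_bid [measurable]: "1 \<le> n \<Longrightarrow> bid n \<in> borel_measurable M"
  using measurable_compose[OF measurable_prims[of n], of "\<lambda>x. fst (snd x)" borel]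
  by (simp add: primitives_def primitive_space_def)

lemma measurable_issuer [measurable]: "1 \<le> n \<Longrightarrow> issuer n \<in> measurable M (count_space UNIV)"
  using measurable_compose[OF measurable_prims[of n], of "\<lambda>x. fst (snd (snd x))" "count_space UNIV"]
  by (simp add: primitives_def primitive_space_def)

lemma measurable_delay [measurable]: "1 \<le> n \<Longrightarrow> delay n \<in> borel_measurable M"
  using measurable_compose[OF measurable_prims[of n], of "\<lambda>x. snd (snd (snd x))" borel]
  by (simp add: primitives_def primitive_space_def)

lemma measurable_time [measurable]: "t n \<in> borel_measurable M"
proof (induction n)
  case 0
  have "t 0 = (\<lambda>_. 0)" using t_0 by auto
  then show ?case by simp
next
  case (Suc n)
  have "t (Suc n) = (\<lambda>\<omega>. (t (Suc n) \<omega> - t (Suc n - 1) \<omega>) + t n \<omega>)" by auto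
  also have "\<dots> \<in> borel_measurable M" using measurable_gap_time[of "Suc n"] Suc by (intro borel_measurable_add) auto
  finally show ?case .
qed

lemma rectangle_law:
  assumes "1 \<le> n" "A \<in> sets borel" "B \<in> sets borel" "C \<in> sets borel"
  shows "prob (prims n -` (A \<times> B \<times> I \<times> C) \<inter> space M) =
    (\<Sum>i\<in>I. measure (density lborel (exponential_density rate)) A * measure (uniform_measure lborel {0..1}) B *
         pmf p i * measure (D i) C)"
proof -
  have [measurable]: "A \<in> sets borel" "B \<in> sets borel" "C \<in> sets borel" by fact+
  have m [measurable]: "(\<lambda>\<omega>. t n \<omega> - t (n - 1) \<omega>) \<in> borel_measurable M" "bid n \<in> borel_measurable M"
    "issuer n \<in> measurable M (count_space UNIV)" "delay n \<in> borel_measurable M"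
    using assms(1) by measurable
  have "prims n -` (A \<times> B \<times> I \<times> C) \<inter> space M =
    (\<Union>i\<in>I. {\<omega> \<in> space M. t n \<omega> - t (n - 1) \<omega> \<in> A \<and> bid n \<omega> \<in> B \<and> issuer n \<omega> = i \<and> delay n \<omega> \<in> C})"
    by (auto simp: primitives_def)
  also have "prob \<dots> = (\<Sum>i\<in>I. prob {\<omega> \<in> space M. t n \<omega> - t (n - 1) \<omega> \<in> A \<and> bid n \<omega> \<in> B \<and> issuer n \<omega> = i \<and> delay n \<omega> \<in> C})"
    by (rule finite_measure_finite_Union) (auto simp: disjoint_family_on_def)
  also have "\<dots> = (\<Sum>i\<in>I. measure (density lborel (exponential_density rate)) A * measure (uniform_measure lborel {0..1}) B *
         pmf p i * measure (D i) C)"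
    using assms by (intro sum.cong refl primitives_law) auto
  finally show ?thesis .
qed

lemma sets_rectangle: "A \<in> sets borel \<Longrightarrow> B \<in> sets borel \<Longrightarrow> C \<in> sets borel \<Longrightarrow>
    (A \<times> B \<times> I \<times> C :: (real \<times> real \<times> 'n \<times> (real ^ 'n)) set) \<in> sets primitive_space"
  by (simp add: primitive_space_def)

lemma prims_law: "1 \<le> n \<Longrightarrow> distr M primitive_space (prims n) = prim_law"
  unfolding prim_law_def
proof (rule primitive_measure_eqI)
  assume n: "1 \<le> n"
  show "finite_measure (distr M primitive_space (prims n))"
    using prob_space.finite_measure[OF prob_space_distr[OF measurable_prims[OF n]]] .
  fix A B :: "real set" and I :: "'n set" and C :: "(real ^ 'n) set"
  assume ABC: "A \<in> sets borel" "B \<in> sets borel" "C \<in> sets borel"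
  show "emeasure (distr M primitive_space (prims n)) (A \<times> B \<times> I \<times> C) = emeasure (distr M primitive_space (prims 1)) (A \<times> B \<times> I \<times> C)"
    using rectangle_law[OF n ABC] rectangle_law[OF order_refl ABC] sets_rectangle[OF ABC]
    by (simp add: emeasure_distr measurable_prims[OF n] measurable_prims[OF order_refl] emeasure_eq_measure del: One_nat_def)
qed auto

lemma prob_space_prim_law: "prob_space prim_law"
  unfolding prim_law_def by (rule prob_space_distr[OF measurable_prims]) simp

lemma exponential_tail: "measure (density lborel (exponential_density rate)) {\<Delta><..} = exp (- \<Delta> * rate)"
proof -
  interpret E: prob_space "density lborel (exponential_density rate)"
    by (rule prob_space_exponential_density[OF rate_pos])
  have "distributed (density lborel (exponential_density rate)) lborel (\<lambda>x. x) (exponential_density rate)"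
    by (auto simp: distributed_def intro!: measure_eqI simp: emeasure_distr)
  from E.exponential_distributedD_gt[OF this Delta_nonneg rate_pos] show ?thesis
    by (simp add: greaterThan_def)
qed

lemma prim_law_rectangle:
  assumes "A \<in> sets borel" "B \<in> sets borel" "C \<in> sets borel"
  shows "measure prim_law (A \<times> B \<times> I \<times> C) = (\<Sum>i\<in>I. measure (density lborel (exponential_density rate)) A *
     measure (uniform_measure lborel {0..1}) B * pmf p i * measure (D i) C)"
  using rectangle_law[OF order_refl assms] sets_rectangle[OF assms]
  by (simp add: prim_law_def measure_distr measurable_prims[OF order_refl] del: One_nat_def)

text \<open>The probability of a long gap is \<open>exp (- \<Delta> * rate)\<close>, positive
  because the exponential law is unbounded while \<open>\<Delta>\<close> is finite.\<close>

lemma random_environment_prim_law: "random_environment k \<Delta> prim_law"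
proof -
  interpret PL: prob_space prim_law by (rule prob_space_prim_law)
  interpret U: prob_space "uniform_measure lborel {0..1 :: real}"
    by (rule prob_space_uniform_measure) auto
  have sets: "sets prim_law = sets primitive_space" by (simp add: prim_law_def)
  have space: "space prim_law = UNIV" by (simp add: prim_law_def)
  have DU: "measure (D i) UNIV = 1" for i
    using prob_space.prob_space[OF D_prob[of i]] sets_eq_imp_space_eq[OF D_sets[of i]] by simp
  have "{x \<in> space prim_law. \<Delta> < max 0 (fst x)} = {\<Delta><..} \<times> UNIV \<times> UNIV \<times> UNIV"
    using Delta_nonneg by (auto simp: space)
  also have "measure prim_law \<dots> = exp (- \<Delta> * rate)"
    using U.prob_space by (subst prim_law_rectangle) (auto simp: exponential_tail DU sum_distrib_left[symmetric] sum_pmf_eq_1)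
  finally have "measure prim_law {x \<in> space prim_law. \<Delta> < max 0 (fst x)} = exp (- \<Delta> * rate)" .
  then show ?thesis
    using k_ge_2 Delta_nonneg sets
    by (intro random_environment.intro reference_model.intro sequence_space.intro product_prob_spaceI
        random_environment_axioms.intro prob_space_prim_law) auto
qed

sublocale RE: random_environment k \<Delta> prim_law
  by (rule random_environment_prim_law)

lemma measurable_env [measurable]: "env \<in> measurable M RE.S"
  unfolding env_def
  by (rule measurable_PiM_single')
     (use measurable_prims in \<open>auto simp: RE.space_nu measurable_cong_sets[OF refl RE.sets_nu]\<close>)

text \<open>A product measure is determined by finite-dimensional boxes, on which independence and
  the common law of the primitives give the product. The empty set of coordinates is treated apart
  because \<open>indep_varsD\<close> asks for a nonempty one.\<close>

lemma env_law: "distr M RE.S env = RE.S"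
proof (rule RE.PiM_eq)
  fix J :: "nat set" and F assume J: "finite J" "\<And>j. j \<in> J \<Longrightarrow> F j \<in> sets prim_law"
  have F: "F j \<in> sets primitive_space" if "j \<in> J" for j using J(2)[OF that] RE.sets_nu by simp
  have emb: "prod_emb UNIV (\<lambda>_. prim_law) J (\<Pi>\<^sub>E j\<in>J. F j) \<in> sets RE.S"
    using J by (intro sets_PiM_I) auto
  have vim: "env -` prod_emb UNIV (\<lambda>_. prim_law) J (\<Pi>\<^sub>E j\<in>J. F j) \<inter> space M = (\<Inter>j\<in>J. prims (Suc j) -` F j) \<inter> space M"
    by (auto simp: prod_emb_def env_def PiE_iff)
  have "prob ((\<Inter>j\<in>J. prims (Suc j) -` F j) \<inter> space M) = (\<Prod>j\<in>J. measure prim_law (F j))"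
  proof (cases "J = {}")
    case False
    have "prob ((\<Inter>j\<in>J. prims (Suc j) -` F j) \<inter> space M) = prob (\<Inter>i\<in>Suc ` J. prims i -` F (i - 1) \<inter> space M)"
      using False by (intro arg_cong[where f = prob]) auto
    also have "\<dots> = (\<Prod>i\<in>Suc ` J. prob (prims i -` F (i - 1) \<inter> space M))"
      by (rule indep_varsD[OF primitives_indep]) (use False J F in auto)
    also have "\<dots> = (\<Prod>j\<in>J. prob (prims (Suc j) -` F j \<inter> space M))"
      by (subst prod.reindex) auto
    also have "\<dots> = (\<Prod>j\<in>J. measure prim_law (F j))"
    proof (rule prod.cong[OF refl])
      fix j assume "j \<in> J"
      have "prob (prims (Suc j) -` F j \<inter> space M) = measure (distr M primitive_space (prims (Suc j))) (F j)"
        by (rule measure_distr[symmetric]) (use measurable_prims F \<open>j \<in> J\<close> in auto)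
      then show "prob (prims (Suc j) -` F j \<inter> space M) = measure prim_law (F j)" by (simp add: prims_law)
    qed
    finally show ?thesis .
  qed (simp add: prob_space)
  then show "emeasure (distr M RE.S env) (prod_emb UNIV (\<lambda>_. prim_law) J (\<Pi>\<^sub>E j\<in>J. F j)) = (\<Prod>j\<in>J. emeasure prim_law (F j))"
    using emb by (simp add: emeasure_distr vim emeasure_eq_measure RE.M.emeasure_eq_measure prod_ennreal)
qed simp

lemma AE_prims:
  assumes "1 \<le> n" "AE x in prim_law. Q x"
  shows "AE \<omega> in M. Q (prims n \<omega>)"
proof -
  have "AE x in distr M primitive_space (prims n). Q x" unfolding prims_law[OF assms(1)] by (rule assms(2))
  then show ?thesis by (rule AE_distrD[OF measurable_prims[OF assms(1)]])
qed

lemma AE_prim_law_rectangle: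
  assumes "A \<in> sets borel" "B \<in> sets borel" "C \<in> sets borel"
    and "\<And>i. i \<in> I \<Longrightarrow> measure (density lborel (exponential_density rate)) A *
     measure (uniform_measure lborel {0..1}) B * pmf p i * measure (D i) C = 0"
  shows "AE x in prim_law. x \<notin> A \<times> B \<times> I \<times> C"
proof (rule AE_not_in)
  have "measure prim_law (A \<times> B \<times> I \<times> C) = 0"
    by (subst prim_law_rectangle[OF assms(1-3)]) (rule sum.neutral, use assms(4) in blast)
  then show "A \<times> B \<times> I \<times> C \<in> null_sets prim_law"
    using sets_rectangle[OF assms(1-3)] RE.sets_nu by (simp add: null_sets_def RE.M.emeasure_eq_measure)
qed

lemma AE_gap_nonneg: "1 \<le> n \<Longrightarrow> AE \<omega> in M. 0 \<le> t n \<omega> - t (n - 1) \<omega>"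
proof -
  assume n: "1 \<le> n"
  have "emeasure (density lborel (exponential_density rate)) {..<0} = 0"
    by (subst emeasure_density) (auto simp: exponential_density_def indicator_def intro!: nn_integral_zero' AE_I2)
  then have "AE x in prim_law. x \<notin> {..<0} \<times> UNIV \<times> UNIV \<times> UNIV"
    by (intro AE_prim_law_rectangle) (auto simp: measure_def)
  then have "AE \<omega> in M. prims n \<omega> \<notin> {..<0} \<times> UNIV \<times> UNIV \<times> UNIV" by (rule AE_prims[OF n])
  then show ?thesis by eventually_elim (auto simp: primitives_def)
qed

lemma AE_delay_le: "1 \<le> n \<Longrightarrow> AE \<omega> in M. delay n \<omega> $ j \<le> \<Delta>"
proof -
  assume n: "1 \<le> n"
  let ?C = "{d :: real ^ 'n. \<not> d $ j \<le> \<Delta>}"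
  have C: "?C \<in> sets borel" by measurable
  have "emeasure (D i) ?C = 0" for i
    using partial_synchrony[where i = i and j = j] C D_sets[of i] sets_eq_imp_space_eq[OF D_sets[of i]]
    by (subst (asm) AE_iff_measurable[of ?C]) auto
  then have "AE x in prim_law. x \<notin> UNIV \<times> UNIV \<times> UNIV \<times> ?C"
    by (intro AE_prim_law_rectangle C) (auto simp: measure_def)
  then have "AE \<omega> in M. prims n \<omega> \<notin> UNIV \<times> UNIV \<times> UNIV \<times> ?C" by (rule AE_prims[OF n])
  then show ?thesis by eventually_elim (auto simp: primitives_def)
qed

end

section \<open>Measurability of blocks and reference lists\<close>

definition block_value :: "block \<Rightarrow> real" where
  "block_value b = (case b of Genesis \<Rightarrow> 0 | Block x \<Rightarrow> x)"

lemma space_block_space [simp]: "space block_space = UNIV"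
  by (simp add: block_space_def)

lemma space_ref_space [simp]: "space ref_space = UNIV"
  unfolding ref_space_def by (rule space_measure_of) auto

lemma sets_block_spaceI: "Block -` A \<in> sets borel \<Longrightarrow> A \<in> sets block_space"
  by (simp add: block_space_def sigma_sets.Basic)

lemma measurable_Block: "Block \<in> measurable borel block_space"
  unfolding block_space_def by (rule measurable_measure_of) auto

lemma measurable_block_value: "block_value \<in> borel_measurable block_space"
proof (rule measurableI)
  fix A :: "real set" assume "A \<in> sets borel"
  moreover have "Block -` (block_value -` A) = A" by (auto simp: block_value_def)
  ultimately show "block_value -` A \<inter> space block_space \<in> sets block_space" by (intro sets_block_spaceI) simp
qed simp

lemma sets_ref_space_nth: "A \<in> sets block_space \<Longrightarrow> {xs. i < length xs \<and> xs ! i \<in> A} \<in> sets ref_space"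
  unfolding ref_space_def by (subst sets_measure_of) auto

lemma measurable_ref_spaceI:
  assumes "\<And>i A. A \<in> sets block_space \<Longrightarrow> {\<omega> \<in> space N. i < length (f \<omega>) \<and> f \<omega> ! i \<in> A} \<in> sets N"
  shows "f \<in> measurable N ref_space"
  unfolding ref_space_def
proof (rule measurable_measure_of)
  fix y assume "y \<in> {{xs. i < length xs \<and> xs ! i \<in> A} | i A. A \<in> sets block_space}"
  then obtain i A where y: "y = {xs. i < length xs \<and> xs ! i \<in> A}" "A \<in> sets block_space" by blast
  have "f -` y \<inter> space N = {\<omega> \<in> space N. i < length (f \<omega>) \<and> f \<omega> ! i \<in> A}" by (auto simp: y)
  then show "f -` y \<inter> space N \<in> sets N" using assms[OF y(2)] by simp
qed auto

lemma measurable_length_ref_space [measurable]: "length \<in> measurable ref_space (count_space UNIV)"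
proof -
  have gt: "{xs. n < length xs} \<in> sets ref_space" for n
    using sets_ref_space_nth[of UNIV n] sets.top[of block_space] by simp
  have "length -` {n} \<inter> space ref_space \<in> sets ref_space" for n
  proof (cases n)
    case 0
    have "length -` {n} \<inter> space ref_space = space ref_space - {xs. 0 < length xs}" using 0 by auto
    also have "\<dots> \<in> sets ref_space" by (rule sets.compl_sets[OF gt])
    finally show ?thesis .
  next
    case (Suc m)
    have "length -` {n} \<inter> space ref_space = {xs. m < length xs} - {xs. n < length xs}" using Suc by auto
    also have "\<dots> \<in> sets ref_space" by (rule sets.Diff[OF gt gt])
    finally show ?thesis .
  qed
  then show ?thesis by (simp add: measurable_count_space_eq2_countable)
qed

text \<open>The value 0 past the end of the list is a filler that makes the function total;
  \<open>nth_ref_eq_block_at\<close> tests the length next to it.\<close>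

lemma measurable_nth_value [measurable]:
  "(\<lambda>xs. if i < length xs then block_value (xs ! i) else 0) \<in> borel_measurable ref_space"
proof (rule measurableI)
  fix A :: "real set" assume A: "A \<in> sets borel"
  have "{xs. i < length xs \<and> xs ! i \<in> block_value -` A} \<in> sets ref_space"
    using measurable_sets[OF measurable_block_value A] by (intro sets_ref_space_nth) simp
  moreover have "{xs :: block list. \<not> i < length xs} \<in> sets ref_space"
  proof -
    have "{xs \<in> space ref_space. \<not> i < length xs} \<in> sets ref_space" by measurable
    then show ?thesis by simp
  qed
  moreover have "(\<lambda>xs. if i < length xs then block_value (xs ! i) else 0) -` A \<inter> space ref_space =
    {xs. i < length xs \<and> xs ! i \<in> block_value -` A} \<union> (if 0 \<in> A then {xs. \<not> i < length xs} else {})"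
    by (auto split: if_splits)
  ultimately show "(\<lambda>xs. if i < length xs then block_value (xs ! i) else 0) -` A \<inter> space ref_space \<in> sets ref_space"
    by auto
qed simp

lemma measurable_nth_Genesis [measurable]: "Measurable.pred ref_space (\<lambda>xs. i < length xs \<and> xs ! i = Genesis)"
proof -
  have "{Genesis} \<in> sets block_space"
  proof (rule sets_block_spaceI)
    have "Block -` {Genesis} = {}" by auto
    then show "Block -` {Genesis} \<in> sets borel" by simp
  qed
  from sets_ref_space_nth[OF this, of i] show ?thesis by (simp add: pred_def)
qed

text \<open>\<open>ref_law\<close> concerns a fixed set of reference lists, whereas the event of
  interest compares the references with a list that itself depends on the outcome through the
  identifiers. Such an event says that a pair lies in a set \<open>W\<close> of a product space. The
  identity extends from rectangles to all such \<open>W\<close> by Dynkin's argument;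
  \<open>total\<close> serves the complements.\<close>

lemma measure_mixture_eq_on_product:
  assumes W: "W \<in> sets (A \<Otimes>\<^sub>M B)"
    and fin: "finite R" and f: "f \<in> measurable N (A \<Otimes>\<^sub>M B)" and g: "\<And>r. r \<in> R \<Longrightarrow> g r \<in> measurable N (A \<Otimes>\<^sub>M B)"
    and N: "finite_measure N" and E: "E \<in> sets N"
    and total: "measure N E = (\<Sum>r\<in>R. c * measure N E)"
    and basic: "\<And>a b. a \<in> sets A \<Longrightarrow> b \<in> sets B \<Longrightarrow>
      measure N {\<omega> \<in> E. f \<omega> \<in> a \<times> b} = (\<Sum>r\<in>R. c * measure N {\<omega> \<in> E. g r \<omega> \<in> a \<times> b})"
  shows "measure N {\<omega> \<in> E. f \<omega> \<in> W} = (\<Sum>r\<in>R. c * measure N {\<omega> \<in> E. g r \<omega> \<in> W})"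
proof -
  interpret finite_measure N by fact
  let ?G = "{a \<times> b | a b. a \<in> sets A \<and> b \<in> sets B}"
  let ?\<Omega> = "space A \<times> space B"
  have ES: "E \<subseteq> space N" using E by (rule sets.sets_into_space)
  have vim: "{\<omega> \<in> E. h \<omega> \<in> V} \<in> sets N" if "h \<in> measurable N (A \<Otimes>\<^sub>M B)" "V \<in> sigma_sets ?\<Omega> ?G" for h V
  proof -
    have "{\<omega> \<in> E. h \<omega> \<in> V} = E \<inter> (h -` V \<inter> space N)" using ES by auto
    moreover have "V \<in> sets (A \<Otimes>\<^sub>M B)" using that(2) by (simp add: sets_pair_measure)
    ultimately show ?thesis using measurable_sets[OF that(1)] E by auto
  qed
  have "W \<in> sigma_sets ?\<Omega> ?G" using W by (simp add: sets_pair_measure)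
  have "Int_stable ?G" by (rule Int_stable_pair_measure_generator)
  moreover have "?G \<subseteq> Pow ?\<Omega>" by (rule pair_measure_closed)
  ultimately show ?thesis using \<open>W \<in> sigma_sets ?\<Omega> ?G\<close>
  proof (induction rule: sigma_sets_induct_disjoint)
    case (basic V)
    then show ?case using assms(8) by blast
  next
    case empty
    then show ?case by simp
  next
    case (compl V)
    have split: "measure N {\<omega> \<in> E. h \<omega> \<in> ?\<Omega> - V} = measure N E - measure N {\<omega> \<in> E. h \<omega> \<in> V}"
      if h: "h \<in> measurable N (A \<Otimes>\<^sub>M B)" for h
    proof -
      have "{\<omega> \<in> E. h \<omega> \<in> ?\<Omega> - V} = E - {\<omega> \<in> E. h \<omega> \<in> V}"
        using measurable_space[OF h] ES by (auto simp: space_pair_measure)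
      then show ?thesis using vim[OF h compl(1)] E by (simp add: finite_measure_Diff subset_eq)
    qed
    have "(\<Sum>r\<in>R. c * measure N {\<omega> \<in> E. g r \<omega> \<in> ?\<Omega> - V}) = (\<Sum>r\<in>R. c * measure N E - c * measure N {\<omega> \<in> E. g r \<omega> \<in> V})"
      by (intro sum.cong refl) (simp only: split[OF g] right_diff_distrib)
    then show ?case unfolding split[OF f] using total compl(2) by (simp add: sum_subtractf)
  next
    case (union V)
    have sums: "(\<lambda>i. measure N {\<omega> \<in> E. h \<omega> \<in> V i}) sums measure N {\<omega> \<in> E. h \<omega> \<in> (\<Union>i. V i)}"
      if h: "h \<in> measurable N (A \<Otimes>\<^sub>M B)" for h
    proof -
      have "{\<omega> \<in> E. h \<omega> \<in> (\<Union>i. V i)} = (\<Union>i. {\<omega> \<in> E. h \<omega> \<in> V i})" by auto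
      moreover have "disjoint_family (\<lambda>i. {\<omega> \<in> E. h \<omega> \<in> V i})"
        using union(1) by (auto simp: disjoint_family_on_def)
      moreover have "range (\<lambda>i. {\<omega> \<in> E. h \<omega> \<in> V i}) \<subseteq> sets N" using vim[OF h] union(2) by auto
      ultimately show ?thesis using finite_measure_UNION[of "\<lambda>i. {\<omega> \<in> E. h \<omega> \<in> V i}"] by simp
    qed
    have "(\<lambda>i. \<Sum>r\<in>R. c * measure N {\<omega> \<in> E. g r \<omega> \<in> V i}) sums (\<Sum>r\<in>R. c * measure N {\<omega> \<in> E. g r \<omega> \<in> (\<Union>i. V i)})"
      by (intro sums_sum sums_mult sums g)
    moreover have "(\<lambda>i. \<Sum>r\<in>R. c * measure N {\<omega> \<in> E. g r \<omega> \<in> V i}) sums measure N {\<omega> \<in> E. f \<omega> \<in> (\<Union>i. V i)}"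
      using sums[OF f] union(3) by simp
    ultimately show ?case by (rule sums_unique2[symmetric])
  qed
qed

section \<open>Transition law of the references\<close>

context block_issuance begin

definition block_at :: "'a \<Rightarrow> nat \<Rightarrow> block" where
  "block_at \<omega> m = (if m = 0 then Genesis else Block (bid m \<omega>))"

text \<open>On these outcomes, which have full probability, the truncations in \<open>gap\<close>
  and \<open>sees\<close> change nothing and indices name blocks faithfully.\<close>

definition valid :: "'a \<Rightarrow> bool" where
  "valid \<omega> \<longleftrightarrow> (\<forall>n\<ge>1. 0 \<le> t n \<omega> - t (n - 1) \<omega>) \<and> (\<forall>n\<ge>1. \<forall>j. delay n \<omega> $ j \<le> \<Delta>) \<and> inj (block_at \<omega>)"

abbreviation hist_alg :: "nat \<Rightarrow> 'a measure" where
  "hist_alg n \<equiv> history M t bid issuer delay ref n"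

text \<open>The joint law of two identifiers is a product whose second factor has no atoms, so the
  diagonal is a null set.\<close>

lemma AE_bid_neq: "1 \<le> m \<Longrightarrow> m < n \<Longrightarrow> AE \<omega> in M. bid m \<omega> \<noteq> bid n \<omega>"
proof -
  assume mn: "1 \<le> m" "m < n"
  have n: "1 \<le> n" using mn by simp
  have "indep_vars (\<lambda>_. borel) (\<lambda>i \<omega>. fst (snd (prims i \<omega>))) {1..}"
    by (rule indep_vars_compose2[OF primitives_indep]) (simp add: primitive_space_def)
  then have "indep_vars (\<lambda>_. borel) (\<lambda>i \<omega>. bid i \<omega>) {1..}" by (simp add: primitives_def)
  then have "indep_vars (\<lambda>_. borel) bid (insert m {n})"
    by (rule indep_vars_subset) (use mn in auto)
  then have "indep_var borel (bid m) borel (bid n)"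
    using indep_vars_sum[of "{n}" m bid] mn by simp
  then have law: "distr M borel (bid m) \<Otimes>\<^sub>M distr M borel (bid n) = distr M (borel \<Otimes>\<^sub>M borel) (\<lambda>\<omega>. (bid m \<omega>, bid n \<omega>))"
    by (simp add: indep_var_distribution_eq)
  interpret B: prob_space "distr M borel (bid n)" by (rule prob_space_distr) (use n in measurable)
  have [measurable]: "bid m \<in> borel_measurable M" "bid n \<in> borel_measurable M" using mn n by measurable
  have single: "emeasure (distr M borel (bid n)) {x} = 0" for x
  proof -
    have "emeasure lborel ({0..1} \<inter> {x}) \<le> emeasure lborel {x}" by (rule emeasure_mono) auto
    then have "measure (uniform_measure lborel {0..1 :: real}) {x} = 0" by (simp add: measure_def)
    then have "AE y in prim_law. y \<notin> UNIV \<times> {x} \<times> UNIV \<times> UNIV"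
      by (intro AE_prim_law_rectangle) auto
    then have "AE \<omega> in M. prims n \<omega> \<notin> UNIV \<times> {x} \<times> UNIV \<times> UNIV" by (rule AE_prims[OF n])
    then have "AE \<omega> in M. \<not> bid n \<omega> = x" by eventually_elim (auto simp: primitives_def)
    moreover have "bid n -` {x} \<inter> space M = {\<omega> \<in> space M. bid n \<omega> = x}" by auto
    ultimately have "emeasure M (bid n -` {x} \<inter> space M) = 0"
      by (subst (asm) AE_iff_measurable[of "bid n -` {x} \<inter> space M"]) auto
    then show ?thesis by (simp add: emeasure_distr)
  qed
  let ?X = "{p \<in> space (borel \<Otimes>\<^sub>M borel). fst p = (snd p :: real)}"
  have X: "?X \<in> sets (borel \<Otimes>\<^sub>M borel)" by measurable
  have "emeasure (distr M borel (bid m) \<Otimes>\<^sub>M distr M borel (bid n)) ?X =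
    (\<integral>\<^sup>+x. emeasure (distr M borel (bid n)) (Pair x -` ?X) \<partial>distr M borel (bid m))"
    by (rule B.emeasure_pair_measure_alt) (use X in \<open>simp add: sets_pair_measure_cong[OF sets_distr sets_distr]\<close>)
  also have "\<dots> = 0"
  proof -
    have "Pair x -` ?X = {x}" for x by (auto simp: space_pair_measure)
    then show ?thesis by (simp add: single)
  qed
  finally have "emeasure M ((\<lambda>\<omega>. (bid m \<omega>, bid n \<omega>)) -` ?X \<inter> space M) = 0"
    unfolding law using X by (simp add: emeasure_distr)
  moreover have "(\<lambda>\<omega>. (bid m \<omega>, bid n \<omega>)) -` ?X \<inter> space M = {\<omega> \<in> space M. bid m \<omega> = bid n \<omega>}"
    by (auto simp: space_pair_measure)
  ultimately show ?thesis by (intro AE_I[of _ _ "{\<omega> \<in> space M. bid m \<omega> = bid n \<omega>}"]) auto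
qed

lemma AE_valid: "AE \<omega> in M. valid \<omega>"
proof -
  have "AE \<omega> in M. \<forall>n. 1 \<le> n \<longrightarrow> 0 \<le> t n \<omega> - t (n - 1) \<omega>"
    unfolding AE_all_countable using AE_gap_nonneg by auto
  moreover have "AE \<omega> in M. \<forall>n. 1 \<le> n \<longrightarrow> (\<forall>j. delay n \<omega> $ j \<le> \<Delta>)"
    unfolding AE_all_countable using AE_delay_le by (auto simp: AE_all_countable)
  moreover have "AE \<omega> in M. \<forall>m n. 1 \<le> m \<longrightarrow> m < n \<longrightarrow> bid m \<omega> \<noteq> bid n \<omega>"
    unfolding AE_all_countable using AE_bid_neq by (auto simp: AE_all_countable)
  ultimately show ?thesis
  proof eventually_elim
    case (elim \<omega>)
    have "inj (block_at \<omega>)"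
    proof (rule injI)
      fix m n assume eq: "block_at \<omega> m = block_at \<omega> n"
      show "m = n"
      proof (rule ccontr)
        assume "m \<noteq> n"
        then have "block_at \<omega> (min m n) = block_at \<omega> (max m n)" "min m n < max m n"
          using eq by (auto simp: min_def max_def)
        then show False using elim(3) by (auto simp: block_at_def split: if_splits)
      qed
    qed
    then show ?case using elim by (simp add: valid_def)
  qed
qed

lemma space_history [simp]: "space (hist_alg n) = space M"
  unfolding history_def by (rule space_measure_of) auto

lemma sets_history: "sets (hist_alg n) = sigma_sets (space M)
     ({prims m -` A \<inter> space M | m A. 1 \<le> m \<and> A \<in> sets primitive_space} \<union>
      {ref m -` A \<inter> space M | m A. 1 \<le> m \<and> m < n \<and> A \<in> sets ref_space})"
  unfolding history_def by (rule sets_measure_of) auto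

lemma measurable_prims_history: "1 \<le> m \<Longrightarrow> prims m \<in> measurable (hist_alg n) primitive_space"
proof (rule measurableI)
  fix A :: "(real \<times> real \<times> 'n \<times> (real ^ 'n)) set" assume "1 \<le> m" "A \<in> sets primitive_space"
  then show "prims m -` A \<inter> space (hist_alg n) \<in> sets (hist_alg n)"
    unfolding sets_history space_history by (intro sigma_sets.Basic UnI1) blast
qed simp

lemma measurable_ref_history: "1 \<le> m \<Longrightarrow> m < n \<Longrightarrow> ref m \<in> measurable (hist_alg n) ref_space"
proof (rule measurableI)
  fix A assume "1 \<le> m" "m < n" "A \<in> sets ref_space"
  then show "ref m -` A \<inter> space (hist_alg n) \<in> sets (hist_alg n)"
    unfolding sets_history space_history by (intro sigma_sets.Basic UnI2) blast
qed simp

lemma measurable_bid_history: "1 \<le> m \<Longrightarrow> bid m \<in> borel_measurable (hist_alg n)"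
  using measurable_compose[OF measurable_prims_history[of m n], of "\<lambda>x. fst (snd x)" borel]
  by (simp add: primitives_def primitive_space_def)

lemma measurable_env_history: "env \<in> measurable (hist_alg n) RE.S"
  unfolding env_def
  by (rule measurable_PiM_single')
     (use measurable_prims_history in \<open>auto simp: RE.space_nu measurable_cong_sets[OF refl RE.sets_nu]\<close>)

lemma subalgebra_history: "subalgebra M (hist_alg n)"
proof -
  have "sets (hist_alg n) \<subseteq> sets M"
    unfolding sets_history
  proof (rule sets.sigma_sets_subset, safe)
    fix m :: nat and A :: "(real \<times> real \<times> 'n \<times> (real ^ 'n)) set" assume "1 \<le> m" "A \<in> sets primitive_space"
    then show "prims m -` A \<inter> space M \<in> sets M" using measurable_sets[OF measurable_prims] by blast
  next
    fix m :: nat and A assume "1 \<le> m" "A \<in> sets ref_space"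
    then show "ref m -` A \<inter> space M \<in> sets M" using measurable_sets[OF ref_measurable] by blast
  qed
  then show ?thesis by (simp add: subalgebra_def)
qed

text \<open>\<open>block_value\<close> gives genesis the same value as \<open>Block 0\<close>, hence
  the separate test for \<open>Genesis\<close>. The right-hand side consists of conditions known to
  be measurable in the list and in the identifiers.\<close>

lemma nth_ref_eq_block_at:
  "i < length xs \<and> xs ! i = block_at \<omega> j \<longleftrightarrow>
    (if j = 0 then i < length xs \<and> xs ! i = Genesis
     else i < length xs \<and> \<not> (i < length xs \<and> xs ! i = Genesis) \<and> (if i < length xs then block_value (xs ! i) else 0) = bid j \<omega>)"
  by (cases "xs ! i") (auto simp: block_at_def block_value_def)

lemma measurable_nth_block_at:
  assumes f [measurable]: "f \<in> measurable N ref_space"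
    and h: "\<And>j. 1 \<le> j \<Longrightarrow> (\<lambda>x. bid j (h x)) \<in> borel_measurable N"
  shows "Measurable.pred N (\<lambda>x. i < length (f x) \<and> f x ! i = block_at (h x) j)"
proof (cases "j = 0")
  case True
  show ?thesis unfolding nth_ref_eq_block_at True if_P[OF refl] 
    by (rule measurable_compose[OF f measurable_nth_Genesis])
next
  case False
  have [measurable]: "(\<lambda>x. bid j (h x)) \<in> borel_measurable N" using h False by simp
  have [measurable]: "Measurable.pred N (\<lambda>x. i < length (f x) \<and> f x ! i = Genesis)"
    by (rule measurable_compose[OF f measurable_nth_Genesis])
  have [measurable]: "(\<lambda>x. if i < length (f x) then block_value (f x ! i) else 0) \<in> borel_measurable N"
    by (rule measurable_compose[OF f measurable_nth_value])
  show ?thesis unfolding nth_ref_eq_block_at if_not_P[OF False] by measurable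
qed

lemma measurable_eq_map_block_at:
  assumes f [measurable]: "f \<in> measurable N ref_space"
    and h: "\<And>j. 1 \<le> j \<Longrightarrow> (\<lambda>x. bid j (h x)) \<in> borel_measurable N"
  shows "Measurable.pred N (\<lambda>x. f x = map (block_at (h x)) r)"
proof -
  have eq: "f x = map (block_at (h x)) r \<longleftrightarrow>
    length (f x) = length r \<and> (\<forall>i\<in>{..<length r}. i < length (f x) \<and> f x ! i = block_at (h x) (r ! i))" for x
    by (auto simp: list_eq_iff_nth_eq)
  have [measurable]: "Measurable.pred N (\<lambda>x. i < length (f x) \<and> f x ! i = block_at (h x) j)" for i j
    by (rule measurable_nth_block_at[OF f h])
  have "Measurable.pred N (\<lambda>x. \<forall>i\<in>{..<length r}. i < length (f x) \<and> f x ! i = block_at (h x) (r ! i))"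
    by (rule pred_intros_finite) auto
  then show ?thesis unfolding eq by measurable
qed

lemma measurable_map_block_at: "(\<lambda>\<omega>. map (block_at \<omega>) r) \<in> measurable M ref_space"
proof (rule measurable_ref_spaceI)
  fix i A assume A: "A \<in> sets block_space"
  have "{\<omega> \<in> space M. block_at \<omega> j \<in> A} \<in> sets M" for j
  proof (cases "j = 0")
    case False
    have "(\<lambda>\<omega>. Block (bid j \<omega>)) \<in> measurable M block_space"
      by (rule measurable_compose[OF measurable_bid measurable_Block]) (use False in simp)
    from measurable_sets[OF this A] show ?thesis using False by (simp add: block_at_def vimage_def Int_def conj_commute)
  qed (simp add: block_at_def)
  then show "{\<omega> \<in> space M. i < length (map (block_at \<omega>) r) \<and> map (block_at \<omega>) r ! i \<in> A} \<in> sets M"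
    by (cases "i < length r") auto
qed

text \<open>On the event \<open>A\<close> of the history the pool is the image of one fixed index
  set \<open>P\<close>, so the conditional law of the references is uniform over the images of the
  lists in \<open>draws k P\<close>. Injectivity of \<open>block_at\<close> keeps the images of
  distinct index lists distinct.\<close>

lemma ref_transition:
  assumes n: "1 \<le> n" and A: "A \<in> sets (hist_alg n)" and P: "finite P"
    and ae: "AE \<omega> in M. \<omega> \<in> A \<longrightarrow> inj (block_at \<omega>) \<and> pre_pool t bid delay ref n (issuer n \<omega>) \<omega> = block_at \<omega> ` P"
  shows "prob {\<omega> \<in> A. ref n \<omega> = map (block_at \<omega>) r} = prob A * pmf (pmf_of_set (draws k P)) r"
proof -
  interpret sub: finite_measure_subalgebra M "hist_alg n" by standard (rule subalgebra_history)
  define R where "R = draws k P"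
  define c where "c = 1 / real (card R)"
  have R: "finite R" "R \<noteq> {}" using P by (auto simp: R_def finite_draws draws_nonempty)
  have cR: "0 < card R" using R by (simp add: card_gt_0_iff)
  have AM: "A \<in> sets M" using A subalgebra_history by (auto simp: subalgebra_def)
  have AS: "A \<subseteq> space M" using AM by (rule sets.sets_into_space)
  have ref_m [measurable]: "ref n \<in> measurable M ref_space" by (rule ref_measurable[OF n])
  have id_m: "(\<lambda>\<omega>. \<omega>) \<in> measurable M (hist_alg n)"
    using subalgebra_history by (auto simp: measurable_def subalgebra_def)
  \<comment> \<open>On rectangles the condition \<open>b\<close> merely replaces \<open>A\<close> by
    \<open>A \<inter> b\<close>, still in the history, over which the conditional expectation
    integrates correctly.\<close>
  have basic: "prob {\<omega> \<in> A. (ref n \<omega>, \<omega>) \<in> a \<times> b} = (\<Sum>r\<in>R. c * prob {\<omega> \<in> A. (map (block_at \<omega>) r, \<omega>) \<in> a \<times> b})"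
    if a: "a \<in> sets ref_space" and b: "b \<in> sets (hist_alg n)" for a b
  proof -
    have AB: "A \<inter> b \<in> sets (hist_alg n)" using A b by auto
    have ABM: "A \<inter> b \<in> sets M" using AB subalgebra_history by (auto simp: subalgebra_def)
    have ia: "(\<lambda>\<omega>. indicator a (ref n \<omega>) :: real) \<in> borel_measurable M"
      by (rule measurable_compose[OF ref_m]) (use a in simp)
    have int: "integrable M (\<lambda>\<omega>. indicator a (ref n \<omega>) :: real)"
      by (rule integrable_const_bound[where B = 1]) (use ia in auto)
    have im: "(\<lambda>\<omega>. indicator a (map (block_at \<omega>) r) :: real) \<in> borel_measurable M" for r
      by (rule measurable_compose[OF measurable_map_block_at]) (use a in simp)
    have set: "{\<omega> \<in> A. (h \<omega>, \<omega>) \<in> a \<times> b} = (A \<inter> b) \<inter> {\<omega> \<in> space M. h \<omega> \<in> a}" for h using AS by auto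
    have setint: "(LINT \<omega>:A \<inter> b|M. indicator a (h \<omega>)) = prob {\<omega> \<in> A. (h \<omega>, \<omega>) \<in> a \<times> b}"
      if h: "h \<in> measurable M ref_space" for h
    proof -
      have hs: "{\<omega> \<in> space M. h \<omega> \<in> a} \<in> sets M" using measurable_sets[OF h a] by (simp add: vimage_def Int_def conj_commute)
      have "(LINT \<omega>:A \<inter> b|M. indicator a (h \<omega>)) = expectation (indicator {\<omega> \<in> A. (h \<omega>, \<omega>) \<in> a \<times> b})"
        unfolding set_lebesgue_integral_def
        by (intro Bochner_Integration.integral_cong) (auto simp: indicator_def)
      also have "\<dots> = prob {\<omega> \<in> A. (h \<omega>, \<omega>) \<in> a \<times> b}"
        unfolding Bochner_Integration.integral_indicator using AS by (intro arg_cong[where f = prob]) auto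
      finally show ?thesis .
    qed
    have "prob {\<omega> \<in> A. (ref n \<omega>, \<omega>) \<in> a \<times> b} = (LINT \<omega>:A \<inter> b|M. indicator a (ref n \<omega>))"
      by (rule setint[OF ref_m, symmetric])
    also have "\<dots> = (LINT \<omega>:A \<inter> b|M. real_cond_exp M (hist_alg n) (\<lambda>\<omega>. indicator a (ref n \<omega>)) \<omega>)"
      by (rule sub.real_cond_exp_intA[OF int AB])
    also have "\<dots> = expectation (\<lambda>\<omega>. \<Sum>r\<in>R. c * (indicator (A \<inter> b) \<omega> * indicator a (map (block_at \<omega>) r)))"
      unfolding set_lebesgue_integral_def
    proof (rule integral_cong_AE)
      show "(\<lambda>\<omega>. indicat_real (A \<inter> b) \<omega> *\<^sub>R real_cond_exp M (hist_alg n) (\<lambda>\<omega>. indicator a (ref n \<omega>)) \<omega>) \<in> borel_measurable M"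
        using ABM borel_measurable_cond_exp2 by measurable
      show "(\<lambda>\<omega>. \<Sum>r\<in>R. c * (indicator (A \<inter> b) \<omega> * indicator a (map (block_at \<omega>) r))) \<in> borel_measurable M"
        using im ABM by measurable
      show "AE \<omega> in M. indicat_real (A \<inter> b) \<omega> *\<^sub>R real_cond_exp M (hist_alg n) (\<lambda>\<omega>. indicator a (ref n \<omega>)) \<omega> =
        (\<Sum>r\<in>R. c * (indicator (A \<inter> b) \<omega> * indicator a (map (block_at \<omega>) r)))"
        using ref_law[OF n a] ae
      proof eventually_elim
        case (elim \<omega>)
        show ?case
        proof (cases "\<omega> \<in> A \<inter> b")
          case True
          then have inj: "inj (block_at \<omega>)" and pool: "pre_pool t bid delay ref n (issuer n \<omega>) \<omega> = block_at \<omega> ` P"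
            using elim(2) by auto
          have injP: "inj_on (block_at \<omega>) P" using inj by (rule inj_on_subset) simp
          have "pmf_of_set (draws k (block_at \<omega> ` P)) = map_pmf (map (block_at \<omega>)) (pmf_of_set R)"
            unfolding R_def
            by (subst draws_image[OF injP], rule map_pmf_of_set_inj[symmetric])
               (use P in \<open>auto intro: inj_on_map_draws injP simp: finite_draws draws_nonempty\<close>)
          then have "measure_pmf.prob (pmf_of_set (draws k (block_at \<omega> ` P))) a =
            real (card (R \<inter> map (block_at \<omega>) -` a)) / real (card R)"
            using R by (simp add: measure_pmf_of_set)
          also have "\<dots> = (\<Sum>r\<in>R. c * indicator a (map (block_at \<omega>) r))"
          proof -
            have "(\<Sum>r\<in>R. c * indicator a (map (block_at \<omega>) r)) = c * (\<Sum>r\<in>R. if r \<in> map (block_at \<omega>) -` a then 1 else 0)"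
              by (simp add: sum_distrib_left indicator_def of_bool_def)
            also have "\<dots> = c * real (card (R \<inter> map (block_at \<omega>) -` a))"
              using R(1) by (simp add: sum.If_cases vimage_def)
            finally show ?thesis by (simp add: c_def)
          qed
          finally show ?thesis using True elim(1) pool by simp
        qed simp
      qed
    qed
    also have "\<dots> = (\<Sum>r\<in>R. c * (LINT \<omega>:A \<inter> b|M. indicator a (map (block_at \<omega>) r)))"
    proof -
      have "integrable M (\<lambda>\<omega>. c * (indicator (A \<inter> b) \<omega> * indicator a (map (block_at \<omega>) r)))" for r
      proof (rule integrable_const_bound[where B = "\<bar>c\<bar>"])
        show "(\<lambda>\<omega>. c * (indicator (A \<inter> b) \<omega> * indicator a (map (block_at \<omega>) r))) \<in> borel_measurable M"
          using im[of r] ABM by measurable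
      qed (auto simp: indicator_def)
      then show ?thesis by (simp add: Bochner_Integration.integral_sum set_lebesgue_integral_def)
    qed
    also have "\<dots> = (\<Sum>r\<in>R. c * prob {\<omega> \<in> A. (map (block_at \<omega>) r, \<omega>) \<in> a \<times> b})"
      by (intro sum.cong refl arg_cong2[where f = "(*)"] setint measurable_map_block_at)
    finally show ?thesis .
  qed
  \<comment> \<open>The graph of the list \<open>r\<close> in terms of identifiers, as a measurable
    set of pairs of a reference list and an outcome.\<close>
  define W where "W = {p \<in> space (ref_space \<Otimes>\<^sub>M hist_alg n). fst p = map (block_at (snd p)) r}"
  have "Measurable.pred (ref_space \<Otimes>\<^sub>M hist_alg n) (\<lambda>p. fst p = map (block_at (snd p)) r)"
    by (rule measurable_eq_map_block_at) (auto intro: measurable_compose[OF measurable_snd measurable_bid_history])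
  then have W: "W \<in> sets (ref_space \<Otimes>\<^sub>M hist_alg n)" by (simp add: W_def pred_def)
  have "prob {\<omega> \<in> A. (ref n \<omega>, \<omega>) \<in> W} = (\<Sum>r'\<in>R. c * prob {\<omega> \<in> A. (map (block_at \<omega>) r', \<omega>) \<in> W})"
  proof (rule measure_mixture_eq_on_product[OF W R(1) _ _ finite_measure_axioms AM _ basic])
    show "(\<lambda>\<omega>. (ref n \<omega>, \<omega>)) \<in> measurable M (ref_space \<Otimes>\<^sub>M hist_alg n)"
      by (intro measurable_Pair ref_m id_m)
    show "(\<lambda>\<omega>. (map (block_at \<omega>) r', \<omega>)) \<in> measurable M (ref_space \<Otimes>\<^sub>M hist_alg n)" for r'
      by (intro measurable_Pair measurable_map_block_at id_m)
    show "prob A = (\<Sum>r\<in>R. c * prob A)" using cR by (simp add: c_def)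
  qed
  moreover have "{\<omega> \<in> A. (ref n \<omega>, \<omega>) \<in> W} = {\<omega> \<in> A. ref n \<omega> = map (block_at \<omega>) r}"
    using AS by (auto simp: W_def space_pair_measure)
  \<comment> \<open>By injectivity only the summand \<open>r' = r\<close> of the mixture
    survives.\<close>
  moreover have "prob {\<omega> \<in> A. (map (block_at \<omega>) r', \<omega>) \<in> W} = (if r' = r then prob A else 0)" for r'
  proof (cases "r' = r")
    case True
    have "{\<omega> \<in> A. (map (block_at \<omega>) r', \<omega>) \<in> W} = A" using True AS by (auto simp: W_def space_pair_measure)
    then show ?thesis using True by simp
  next
    case False
    have "AE \<omega> in M. \<omega> \<notin> {\<omega> \<in> A. (map (block_at \<omega>) r', \<omega>) \<in> W}"
      using ae by eventually_elim (use False in \<open>auto simp: W_def inj_map_eq_map\<close>)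
    moreover have "{\<omega> \<in> A. (map (block_at \<omega>) r', \<omega>) \<in> W} \<in> sets M"
    proof -
      have "(\<lambda>\<omega>. (map (block_at \<omega>) r', \<omega>)) -` W \<inter> space M \<in> sets M"
        by (rule measurable_sets[OF measurable_Pair[OF measurable_map_block_at id_m] W])
      moreover have "{\<omega> \<in> A. (map (block_at \<omega>) r', \<omega>) \<in> W} = A \<inter> ((\<lambda>\<omega>. (map (block_at \<omega>) r', \<omega>)) -` W \<inter> space M)"
        using AS by auto
      ultimately show ?thesis using AM by auto
    qed
    ultimately show ?thesis using False by (simp add: prob_eq_0)
  qed
  ultimately have "prob {\<omega> \<in> A. ref n \<omega> = map (block_at \<omega>) r} = (\<Sum>r'\<in>R. c * (if r' = r then prob A else 0))" by simp
  also have "\<dots> = (if r \<in> R then c * prob A else 0)" using R(1) by (simp add: if_distrib sum.delta cong: if_cong)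
  also have "\<dots> = prob A * pmf (pmf_of_set R) r" using R by (simp add: c_def pmf_of_set indicator_def)
  finally show ?thesis by (simp add: R_def)
qed

end

section \<open>Joint law of environment and references\<close>

context reference_model begin

lemma prepool_hist_cong: "(\<And>m. m \<le> n \<Longrightarrow> f m = g m) \<Longrightarrow> prepool z f n = prepool z g n"
  unfolding prepool_def by (rule idx_tips_cong) (auto simp: seen_def)

text \<open>A history up to \<open>Suc n\<close> has a single possible predecessor, obtained by
  emptying its last list, so the sum over predecessors collapses to one term.\<close>

lemma pmf_hist_law_Suc:
  assumes f: "f \<in> wf_hist (Suc n)"
  shows "pmf (hist_law z (Suc n)) f =
    pmf (hist_law z n) (f(Suc n := [])) * pmf (pmf_of_set (draws k (prepool z f n))) (f (Suc n))"
proof -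
  define g where "g = f(Suc n := [])"
  define c where "c = pmf (pmf_of_set (draws k (prepool z f n))) (f (Suc n))"
  have step: "pmf (step z n h) f = c * indicator {g} h" if h: "h \<in> set_pmf (hist_law z n)" for h
  proof (cases "h = g")
    case True
    have "prepool z h n = prepool z f n" by (rule prepool_hist_cong) (simp add: True g_def)
    moreover have "pmf (step z n h) (h(Suc n := f (Suc n))) = pmf (pmf_of_set (draws k (prepool z h n))) (f (Suc n))"
      unfolding step_def
      by (rule pmf_map_inj') (metis fun_upd_same injI)
    moreover have "h(Suc n := f (Suc n)) = f" by (simp add: True g_def)
    ultimately show ?thesis using True by (simp add: c_def)
  next
    case False
    have "f \<notin> set_pmf (step z n h)"
    proof
      assume "f \<in> set_pmf (step z n h)"
      then obtain r where "f = h(Suc n := r)" by (auto simp: set_step)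
      moreover have "h (Suc n) = []" using hist_law_wf[OF h] by (simp add: wf_hist_def)
      ultimately have "h = g" by (simp add: g_def fun_upd_idem)
      with False show False ..
    qed
    then show ?thesis using False by (simp add: set_pmf_iff)
  qed
  have "pmf (hist_law z (Suc n)) f = measure_pmf.expectation (hist_law z n) (\<lambda>h. c * indicator {g} h)"
    unfolding hist_law_Suc pmf_bind by (rule expectation_cong_set) (rule step)
  also have "\<dots> = c * pmf (hist_law z n) g" by (simp add: pmf.rep_eq)
  finally show ?thesis by (simp add: c_def g_def mult.commute)
qed

lemma wf_hist_drop: "f \<in> wf_hist (Suc n) \<Longrightarrow> f(Suc n := []) \<in> wf_hist n"
  by (auto simp: wf_hist_def)

end

context block_issuance begin

definition refs_follow :: "nat \<Rightarrow> (nat \<Rightarrow> nat list) \<Rightarrow> 'a \<Rightarrow> bool" where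
  "refs_follow n f \<omega> \<longleftrightarrow> (\<forall>m\<in>{1..n}. ref m \<omega> = map (block_at \<omega>) (f m))"

definition arrived :: "'n option \<Rightarrow> nat \<Rightarrow> nat \<Rightarrow> 'a \<Rightarrow> nat set" where
  "arrived a N n \<omega> = {m \<in> {1..N}. case a of None \<Rightarrow> True | Some i \<Rightarrow> t m \<omega> + delay m \<omega> $ i \<le> t n \<omega>}"

definition pool_card :: "'n option \<Rightarrow> nat \<Rightarrow> 'a \<Rightarrow> nat" where
  "pool_card a n \<omega> = card (tips bid ref (arrived a n n \<omega>) \<omega>)"

lemma Xobs_pool_card: "Xobs bid ref n \<omega> = real (pool_card None n \<omega>)"
  by (simp add: Xobs_def observer_pool_def pool_card_def arrived_def atLeastAtMost_def atLeast_def atMost_def Int_def)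

lemma Xloc_pool_card: "Xloc t bid delay ref i n \<omega> = real (pool_card (Some i) n \<omega>)"
proof -
  have "arrived (Some i) n n \<omega> = {m. 1 \<le> m \<and> m \<le> n \<and> t m \<omega> + delay m \<omega> $ i \<le> t n \<omega>}" by (auto simp: arrived_def)
  then show ?thesis by (simp add: Xloc_def local_pool_def pool_card_def)
qed

lemma tips_eq: "J \<subseteq> {1..} \<Longrightarrow> tips bid ref J \<omega> = block_at \<omega> ` insert 0 J - (\<Union>m\<in>J. set (ref m \<omega>))"
  by (force simp: tips_def block_at_def)

lemma tips_block_at:
  assumes "inj (block_at \<omega>)" "refs_follow n f \<omega>" "J \<subseteq> {1..n}"
  shows "tips bid ref J \<omega> = block_at \<omega> ` idx_tips f J"
proof -
  have "(\<Union>m\<in>J. set (ref m \<omega>)) = block_at \<omega> ` (\<Union>m\<in>J. set (f m))"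
  proof -
    have "set (ref m \<omega>) = block_at \<omega> ` set (f m)" if "m \<in> J" for m
      using assms(2,3) that by (auto simp: refs_follow_def)
    then show ?thesis by (simp add: image_UN)
  qed
  moreover have "J \<subseteq> {1..}" using assms(3) by auto
  ultimately show ?thesis
    by (simp only: tips_eq idx_tips_def image_set_diff[OF assms(1)])
qed

lemma gap_env: "valid \<omega> \<Longrightarrow> 1 \<le> m \<Longrightarrow> gap (env \<omega>) m = t m \<omega> - t (m - 1) \<omega>"
  by (simp add: gap_def env_def primitives_def valid_def)

text \<open>The gaps after block \<open>m\<close> telescope to
  \<open>t n \<omega> - t m \<omega>\<close>, and on valid outcomes truncating the delay has no
  effect.\<close>

lemma sees_env:
  assumes v: "valid \<omega>" and m: "1 \<le> m" "m \<le> n"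
  shows "RE.sees (env \<omega>) m n a \<longleftrightarrow> (case a of None \<Rightarrow> True | Some i \<Rightarrow> t m \<omega> + delay m \<omega> $ i \<le> t n \<omega>)"
proof -
  have "(\<Sum>j\<in>{m<..n}. gap (env \<omega>) j) = t n \<omega> - t m \<omega>"
    using m(2)
  proof (induction n)
    case (Suc n)
    show ?case
    proof (cases "m = Suc n")
      case False
      then have "m \<le> n" using Suc.prems by simp
      moreover from this have "{m<..Suc n} = insert (Suc n) {m<..n}" by auto
      ultimately show ?thesis using Suc.IH gap_env[OF v, of "Suc n"] by simp
    qed simp
  qed (use m in simp)
  moreover have "min \<Delta> (delay_of (env \<omega>) m i) = delay m \<omega> $ i" for i
  proof -
    have "delay m \<omega> $ i \<le> \<Delta>" using v m by (simp add: valid_def)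
    then show ?thesis using m by (simp add: delay_of_def env_def primitives_def)
  qed
  ultimately show ?thesis by (auto simp: RE.sees_def split: option.splits)
qed

lemma seen_env: "valid \<omega> \<Longrightarrow> N \<le> n \<Longrightarrow> RE.seen (env \<omega>) N n a = arrived a N n \<omega>"
  unfolding RE.seen_def arrived_def using sees_env[of \<omega> _ n a] by (intro Collect_cong) auto

lemma pool_card_env:
  assumes "valid \<omega>" "refs_follow n f \<omega>"
  shows "pool_card a n \<omega> = RE.pool_size (env \<omega>) f n a"
proof -
  have inj: "inj (block_at \<omega>)" using assms(1) by (simp add: valid_def)
  have "tips bid ref (arrived a n n \<omega>) \<omega> = block_at \<omega> ` idx_tips f (arrived a n n \<omega>)"
    by (rule tips_block_at[OF inj assms(2)]) (auto simp: arrived_def)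
  then show ?thesis
    using inj by (simp add: pool_card_def RE.pool_size_def seen_env[OF assms(1)] card_image inj_on_subset)
qed

lemma pre_pool_env:
  assumes "valid \<omega>" "refs_follow n f \<omega>"
  shows "pre_pool t bid delay ref (Suc n) (issuer (Suc n) \<omega>) \<omega> = block_at \<omega> ` RE.prepool (env \<omega>) f n"
proof -
  have inj: "inj (block_at \<omega>)" using assms(1) by (simp add: valid_def)
  let ?i = "issuer (Suc n) \<omega>"
  have "issuer_of (env \<omega>) (Suc n) = ?i" by (simp add: issuer_of_def env_def primitives_def)
  moreover have "{m. 1 \<le> m \<and> m < Suc n \<and> t m \<omega> + delay m \<omega> $ ?i \<le> t (Suc n) \<omega>} = arrived (Some ?i) n (Suc n) \<omega>"
    by (auto simp: arrived_def)
  moreover have "tips bid ref (arrived (Some ?i) n (Suc n) \<omega>) \<omega> = block_at \<omega> ` idx_tips f (arrived (Some ?i) n (Suc n) \<omega>)"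
    by (rule tips_block_at[OF inj assms(2)]) (auto simp: arrived_def)
  ultimately show ?thesis
    by (simp add: pre_pool_def RE.prepool_def seen_env[OF assms(1)])
qed

lemma measurable_refs_follow_history:
  "Measurable.pred (hist_alg (Suc n)) (refs_follow n f)"
  unfolding refs_follow_def
  by (rule pred_intros_finite, simp)
     (auto intro!: measurable_eq_map_block_at measurable_ref_history measurable_bid_history)

lemma measurable_from_history: "h \<in> measurable (hist_alg n) N \<Longrightarrow> h \<in> measurable M N"
  using subalgebra_history[of n] by (auto simp: measurable_def subalgebra_def)

lemma measurable_refs_follow [measurable]: "Measurable.pred M (refs_follow n f)"
  by (rule measurable_from_history[OF measurable_refs_follow_history])

text \<open>By induction on \<open>n\<close>. The pool for block \<open>Suc n\<close> depends on the
  environment and on the earlier lists \<open>g\<close>, so the event is cut along the finitely many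
  values \<open>P\<close> of that pool and \<open>ref_transition\<close> applies to each piece. The
  event \<open>env \<omega> \<in> A\<close> may involve future primitives; the history contains them
  all.\<close>

lemma joint_law:
  assumes "f \<in> RE.wf_hist n" "A \<in> sets RE.S"
  shows "prob {\<omega> \<in> space M. env \<omega> \<in> A \<and> refs_follow n f \<omega>} = (\<integral>z. indicator A z * pmf (RE.hist_law z n) f \<partial>RE.S)"
  using assms
proof (induction n arbitrary: f A)
  case 0
  have "f = (\<lambda>_. [])" using 0 by (simp add: RE.wf_hist_0)
  then have "(\<integral>z. indicator A z * pmf (RE.hist_law z 0) f \<partial>RE.S) = measure RE.S A"
    using sets.sets_into_space[OF 0(2)] by (simp add: RE.hist_law_0)
  also have "\<dots> = measure (distr M RE.S env) A" by (simp add: env_law)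
  also have "\<dots> = prob (env -` A \<inter> space M)" by (rule measure_distr[OF measurable_env 0(2)])
  finally show ?case by (simp add: refs_follow_def vimage_def Int_def conj_commute)
next
  case (Suc n)
  define g where "g = f(Suc n := [])"
  define r where "r = f (Suc n)"
  have g: "g \<in> RE.wf_hist n" unfolding g_def by (rule RE.wf_hist_drop[OF Suc.prems(1)])
  have pp: "RE.prepool z f n = RE.prepool z g n" for z :: "'n env"
    by (rule RE.prepool_hist_cong) (simp add: g_def)
  define AP where "AP P = A \<inter> {z \<in> space RE.S. RE.prepool z g n = P}" for P
  have AP: "AP P \<in> sets RE.S" for P
  proof (cases "P \<in> Pow {..n}")
    case True
    have "(\<lambda>z. RE.prepool z g n) -` {P} \<inter> space RE.S \<in> sets RE.S"
      by (rule measurable_sets[OF RE.measurable_prepool]) (use True in simp)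
    moreover have "AP P = A \<inter> ((\<lambda>z. RE.prepool z g n) -` {P} \<inter> space RE.S)" by (auto simp: AP_def)
    ultimately show ?thesis using Suc.prems(2) by (metis sets.Int)
  next
    case False
    then have "AP P = {}" using RE.prepool_subset unfolding AP_def by blast
    then show ?thesis by simp
  qed
  define BP where "BP P = {\<omega> \<in> space M. env \<omega> \<in> AP P \<and> refs_follow n g \<omega>}" for P
  \<comment> \<open>This event involves primitives and the references of blocks up to
    \<open>n\<close> only, hence it belongs to the conditioning for block
    \<open>Suc n\<close>.\<close>
  have BP: "BP P \<in> sets (hist_alg (Suc n))" for P
  proof -
    have "env -` AP P \<inter> space (hist_alg (Suc n)) \<in> sets (hist_alg (Suc n))"
      by (rule measurable_sets[OF measurable_env_history AP])
    moreover have "{\<omega> \<in> space (hist_alg (Suc n)). refs_follow n g \<omega>} \<in> sets (hist_alg (Suc n))"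
      using measurable_refs_follow_history[of n g] by (simp add: pred_def)
    ultimately have "(env -` AP P \<inter> space M) \<inter> {\<omega> \<in> space M. refs_follow n g \<omega>} \<in> sets (hist_alg (Suc n))"
      by (metis sets.Int space_history)
    moreover have "BP P = (env -` AP P \<inter> space M) \<inter> {\<omega> \<in> space M. refs_follow n g \<omega>}" by (auto simp: BP_def)
    ultimately show ?thesis by simp
  qed
  define CP where "CP P = {\<omega> \<in> BP P. ref (Suc n) \<omega> = map (block_at \<omega>) r}" for P
  have CP: "prob (CP P) = (\<integral>z. indicator (AP P) z * pmf (RE.hist_law z n) g * pmf (pmf_of_set (draws k P)) r \<partial>RE.S)"
    if P: "P \<in> Pow {..n}" for P
  proof -
    have "prob (CP P) = prob (BP P) * pmf (pmf_of_set (draws k P)) r"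
      unfolding CP_def
    proof (rule ref_transition[OF _ BP])
      show "finite P" using P finite_subset by blast
      show "AE \<omega> in M. \<omega> \<in> BP P \<longrightarrow> inj (block_at \<omega>) \<and>
          pre_pool t bid delay ref (Suc n) (issuer (Suc n) \<omega>) \<omega> = block_at \<omega> ` P"
        using AE_valid
      proof eventually_elim
        case (elim \<omega>)
        then show ?case using pre_pool_env[OF elim, of n g] by (auto simp: BP_def AP_def valid_def)
      qed
    qed simp
    then show ?thesis unfolding BP_def Suc.IH[OF g AP] by simp
  qed
  have CP_sets: "CP P \<in> sets M" for P
  proof -
    have "{\<omega> \<in> space M. ref (Suc n) \<omega> = map (block_at \<omega>) r} \<in> sets M"
      using measurable_eq_map_block_at[OF ref_measurable[of "Suc n"] measurable_bid, of r] by (simp add: pred_def)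
    moreover have "BP P \<in> sets M" using BP[of P] subalgebra_history[of "Suc n"] by (auto simp: subalgebra_def)
    moreover have "CP P = BP P \<inter> {\<omega> \<in> space M. ref (Suc n) \<omega> = map (block_at \<omega>) r}" by (auto simp: CP_def BP_def)
    ultimately show ?thesis by simp
  qed
  have rf: "refs_follow (Suc n) f \<omega> \<longleftrightarrow> refs_follow n g \<omega> \<and> ref (Suc n) \<omega> = map (block_at \<omega>) r" for \<omega>
    by (auto simp: refs_follow_def g_def r_def atLeastAtMostSuc_conv)
  have "{\<omega> \<in> space M. env \<omega> \<in> A \<and> refs_follow (Suc n) f \<omega>} = (\<Union>P\<in>Pow {..n}. CP P)"
  proof -
    have "RE.prepool (env \<omega>) g n \<in> Pow {..n}" for \<omega> using RE.prepool_subset by blast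
    then show ?thesis unfolding rf by (auto simp: CP_def BP_def AP_def)
  qed
  also have "prob \<dots> = (\<Sum>P\<in>Pow {..n}. prob (CP P))"
    by (rule finite_measure_finite_Union) (use CP_sets in \<open>auto simp: disjoint_family_on_def CP_def BP_def AP_def\<close>)
  also have "\<dots> = (\<Sum>P\<in>Pow {..n}. \<integral>z. indicator (AP P) z * pmf (RE.hist_law z n) g * pmf (pmf_of_set (draws k P)) r \<partial>RE.S)"
    by (intro sum.cong refl CP)
  also have "\<dots> = (\<integral>z. (\<Sum>P\<in>Pow {..n}. indicator (AP P) z * pmf (RE.hist_law z n) g * pmf (pmf_of_set (draws k P)) r) \<partial>RE.S)"
  proof (rule Bochner_Integration.integral_sum[symmetric])
    fix P
    show "integrable RE.S (\<lambda>z. indicator (AP P) z * pmf (RE.hist_law z n) g * pmf (pmf_of_set (draws k P)) r)"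
    proof (rule RE.integrable_bounded[where b = 1])
      show "(\<lambda>z. indicator (AP P) z * pmf (RE.hist_law z n) g * pmf (pmf_of_set (draws k P)) r) \<in> borel_measurable RE.S"
        using AP[of P] by measurable
      show "\<bar>indicator (AP P) z * pmf (RE.hist_law z n) g * pmf (pmf_of_set (draws k P)) r\<bar> \<le> 1" for z
        by (auto simp: indicator_def abs_mult pmf_le_1 intro!: mult_le_one)
    qed
  qed
  also have "\<dots> = (\<integral>z. indicator A z * pmf (RE.hist_law z (Suc n)) f \<partial>RE.S)"
  proof (rule Bochner_Integration.integral_cong[OF refl])
    fix z :: "'n env"
    have "(\<Sum>P\<in>Pow {..n}. indicator (AP P) z * pmf (RE.hist_law z n) g * pmf (pmf_of_set (draws k P)) r) =
      (\<Sum>P\<in>Pow {..n}. if P = RE.prepool z g n then indicator A z * pmf (RE.hist_law z n) g * pmf (pmf_of_set (draws k P)) r else 0)"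
      by (intro sum.cong) (auto simp: AP_def indicator_def)
    also have "\<dots> = indicator A z * (pmf (RE.hist_law z n) g * pmf (pmf_of_set (draws k (RE.prepool z g n))) r)"
      using RE.prepool_subset[of z g n] by (subst sum.delta) auto
    finally show "(\<Sum>P\<in>Pow {..n}. indicator (AP P) z * pmf (RE.hist_law z n) g * pmf (pmf_of_set (draws k P)) r) =
      indicator A z * pmf (RE.hist_law z (Suc n)) f"
      by (simp add: RE.pmf_hist_law_Suc[OF Suc.prems(1)] pp g_def[symmetric] r_def[symmetric])
  qed
  finally show ?case .
qed

text \<open>\<open>joint_law\<close> says that on the outcomes following \<open>f\<close> the
  environment has density \<open>pmf (RE.hist_law z n) f\<close> with respect to its law;
  integrating \<open>h\<close> against equal measures gives the claim.\<close>

lemma integral_refs_follow: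
  fixes h :: "'n env \<Rightarrow> real"
  assumes f: "f \<in> RE.wf_hist n" and h: "h \<in> borel_measurable RE.S"
  shows "expectation (\<lambda>\<omega>. indicator {\<omega>. refs_follow n f \<omega>} \<omega> * h (env \<omega>)) = (\<integral>z. h z * pmf (RE.hist_law z n) f \<partial>RE.S)"
proof -
  define E where "E = {\<omega> \<in> space M. refs_follow n f \<omega>}"
  have E: "E \<in> sets M" unfolding E_def by measurable
  have pm: "(\<lambda>z. pmf (RE.hist_law z n) f) \<in> borel_measurable RE.S" by (rule RE.measurable_pmf_hist_law)
  have env_d: "env \<in> measurable (density M (indicator E)) RE.S" by (simp add: measurable_env)
  have "distr (density M (indicator E)) RE.S env = density RE.S (\<lambda>z. ennreal (pmf (RE.hist_law z n) f))"
  proof (rule measure_eqI)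
    fix A assume "A \<in> sets (distr (density M (indicator E)) RE.S env)"
    then have A: "A \<in> sets RE.S" by simp
    have vA: "env -` A \<inter> space M \<in> sets M" by (rule measurable_sets[OF measurable_env A])
    have "emeasure (distr (density M (indicator E)) RE.S env) A = emeasure (density M (indicator E)) (env -` A \<inter> space M)"
      using A env_d by (simp add: emeasure_distr)
    also have "\<dots> = (\<integral>\<^sup>+\<omega>. indicator E \<omega> * indicator (env -` A \<inter> space M) \<omega> \<partial>M)"
      using E vA by (intro emeasure_density) auto
    also have "\<dots> = (\<integral>\<^sup>+\<omega>. indicator {\<omega> \<in> space M. env \<omega> \<in> A \<and> refs_follow n f \<omega>} \<omega> \<partial>M)"
      by (intro nn_integral_cong) (auto simp: E_def indicator_def)
    also have "\<dots> = emeasure M {\<omega> \<in> space M. env \<omega> \<in> A \<and> refs_follow n f \<omega>}"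
    proof (rule nn_integral_indicator)
      have "{\<omega> \<in> space M. env \<omega> \<in> A \<and> refs_follow n f \<omega>} = (env -` A \<inter> space M) \<inter> E" by (auto simp: E_def)
      then show "{\<omega> \<in> space M. env \<omega> \<in> A \<and> refs_follow n f \<omega>} \<in> sets M" using E vA by simp
    qed
    also have "\<dots> = ennreal (\<integral>z. indicator A z * pmf (RE.hist_law z n) f \<partial>RE.S)"
      by (simp add: emeasure_eq_measure joint_law[OF f A])
    also have "\<dots> = (\<integral>\<^sup>+z. ennreal (indicator A z * pmf (RE.hist_law z n) f) \<partial>RE.S)"
    proof (rule nn_integral_eq_integral[symmetric])
      show "integrable RE.S (\<lambda>z. indicator A z * pmf (RE.hist_law z n) f)"
        by (rule RE.integrable_bounded[where b = 1])
           (use A pm in \<open>auto simp: indicator_def abs_mult pmf_le_1\<close>)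
    qed auto
    also have "\<dots> = emeasure (density RE.S (\<lambda>z. ennreal (pmf (RE.hist_law z n) f))) A"
      using A pm by (subst emeasure_density) (auto intro!: nn_integral_cong simp: indicator_def)
    finally show "emeasure (distr (density M (indicator E)) RE.S env) A = emeasure (density RE.S (\<lambda>z. ennreal (pmf (RE.hist_law z n) f))) A" .
  qed simp
  then have "(\<integral>z. h z \<partial>distr (density M (indicator E)) RE.S env) = (\<integral>z. h z \<partial>density RE.S (\<lambda>z. ennreal (pmf (RE.hist_law z n) f)))"
    by simp
  moreover have "(\<integral>z. h z \<partial>distr (density M (indicator E)) RE.S env) = expectation (\<lambda>\<omega>. indicator E \<omega> *\<^sub>R h (env \<omega>))"
  proof -
    have he: "(\<lambda>\<omega>. h (env \<omega>)) \<in> borel_measurable M" by (rule measurable_compose[OF measurable_env h])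
    have "(\<integral>z. h z \<partial>distr (density M (indicator E)) RE.S env) = (\<integral>\<omega>. h (env \<omega>) \<partial>density M (\<lambda>\<omega>. ennreal (indicator E \<omega>)))"
      by (subst integral_distr[OF env_d h]) (simp add: ennreal_indicator)
    also have "\<dots> = expectation (\<lambda>\<omega>. indicator E \<omega> *\<^sub>R h (env \<omega>))"
      by (rule integral_density[OF he]) (use E in auto)
    finally show ?thesis .
  qed
  moreover have "(\<integral>z. h z \<partial>density RE.S (\<lambda>z. ennreal (pmf (RE.hist_law z n) f))) = (\<integral>z. pmf (RE.hist_law z n) f *\<^sub>R h z \<partial>RE.S)"
    by (rule integral_density[OF h pm]) auto
  moreover have "expectation (\<lambda>\<omega>. indicator E \<omega> *\<^sub>R h (env \<omega>)) = expectation (\<lambda>\<omega>. indicator {\<omega>. refs_follow n f \<omega>} \<omega> * h (env \<omega>))"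
    by (intro Bochner_Integration.integral_cong) (auto simp: E_def indicator_def)
  ultimately show ?thesis by (simp add: mult.commute)
qed

lemma refs_follow_unique:
  assumes "valid \<omega>" "f \<in> RE.wf_hist n" "g \<in> RE.wf_hist n" "refs_follow n f \<omega>" "refs_follow n g \<omega>"
  shows "f = g"
proof
  fix m
  have inj: "inj (block_at \<omega>)" using assms(1) by (simp add: valid_def)
  consider "m = 0" | "m \<in> {1..n}" | "n < m" by fastforce
  then show "f m = g m"
  proof cases
    case 1
    have "set (f 0) \<subseteq> {..<0}" "set (g 0) \<subseteq> {..<0}" using assms(2,3) unfolding RE.wf_hist_def by blast+
    then show ?thesis using 1 by simp
  next
    case 2
    then have "map (block_at \<omega>) (f m) = map (block_at \<omega>) (g m)" using assms(4,5) by (metis refs_follow_def)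
    then show ?thesis using inj by (simp add: inj_map_eq_map)
  next
    case 3
    then show ?thesis using assms(2,3) by (simp add: RE.wf_hist_def)
  qed
qed

lemma sum_refs_follow:
  assumes "valid \<omega>" "f \<in> RE.wf_hist n" "refs_follow n f \<omega>"
  shows "(\<Sum>g\<in>RE.wf_hist n. indicator {\<omega>. refs_follow n g \<omega>} \<omega> * (h g :: real)) = h f"
proof -
  have "(\<Sum>g\<in>RE.wf_hist n. indicator {\<omega>. refs_follow n g \<omega>} \<omega> * h g) = (\<Sum>g\<in>RE.wf_hist n. if g = f then h f else 0)"
    by (intro sum.cong) (use refs_follow_unique[OF assms(1)] assms(2,3) in \<open>auto simp: indicator_def\<close>)
  then show ?thesis using assms(2) RE.finite_wf_hist by simp
qed

lemma integrable_refs_follow: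
  fixes h :: "'n env \<Rightarrow> real"
  assumes "h \<in> borel_measurable RE.S" "\<And>z. \<bar>h z\<bar> \<le> b"
  shows "integrable M (\<lambda>\<omega>. indicator {\<omega>. refs_follow n f \<omega>} \<omega> * h (env \<omega>))"
proof (rule integrable_const_bound[where B = b])
  have [measurable]: "(\<lambda>\<omega>. h (env \<omega>)) \<in> borel_measurable M" by (rule measurable_compose[OF measurable_env assms(1)])
  have "(\<lambda>\<omega>. of_bool (refs_follow n f \<omega>) * h (env \<omega>)) \<in> borel_measurable M" by measurable
  then show "(\<lambda>\<omega>. indicator {\<omega>. refs_follow n f \<omega>} \<omega> * h (env \<omega>)) \<in> borel_measurable M"
    by (simp add: indicator_def of_bool_def)
qed (use assms(2) order_trans[OF abs_ge_zero assms(2)] in \<open>auto simp: indicator_def\<close>)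

text \<open>A counting argument on total mass: the probabilities of following the various histories
  add up to 1, because \<open>RE.hist_law z n\<close> lives on \<open>RE.wf_hist n\<close>, while a
  valid outcome follows at most one history. A variable that is almost surely at most 1 and has mean
  1 equals 1 almost surely.\<close>

lemma AE_refs_follow: "AE \<omega> in M. \<exists>f\<in>RE.wf_hist n. refs_follow n f \<omega>"
proof -
  define h where "h \<omega> = (\<Sum>f\<in>RE.wf_hist n. indicator {\<omega>. refs_follow n f \<omega>} \<omega> * (1 :: real))" for \<omega>
  have int: "integrable M (\<lambda>\<omega>. indicator {\<omega>. refs_follow n f \<omega>} \<omega> * (1 :: real))" for f
    by (rule integrable_refs_follow[where h = "\<lambda>_. 1"]) auto
  have inth: "integrable M h" unfolding h_def by (intro Bochner_Integration.integrable_sum int)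
  have "expectation h = (\<Sum>f\<in>RE.wf_hist n. expectation (\<lambda>\<omega>. indicator {\<omega>. refs_follow n f \<omega>} \<omega> * 1))"
    unfolding h_def by (rule Bochner_Integration.integral_sum[OF int])
  also have "\<dots> = (\<Sum>f\<in>RE.wf_hist n. \<integral>z. 1 * pmf (RE.hist_law z n) f \<partial>RE.S)"
    by (intro sum.cong refl integral_refs_follow) auto
  also have "\<dots> = (\<integral>z. (\<Sum>f\<in>RE.wf_hist n. 1 * pmf (RE.hist_law z n) f) \<partial>RE.S)"
    by (intro Bochner_Integration.integral_sum[symmetric] RE.integrable_bounded[where b = 1]) (auto simp: pmf_le_1)
  also have "\<dots> = (\<integral>z. 1 \<partial>RE.S)"
  proof (intro Bochner_Integration.integral_cong refl)
    fix z :: "'n env"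
    have "set_pmf (RE.hist_law z n) \<subseteq> RE.wf_hist n" using RE.hist_law_wf by blast
    then show "(\<Sum>f\<in>RE.wf_hist n. 1 * pmf (RE.hist_law z n) f) = 1"
      using sum_pmf_eq_1[OF RE.finite_wf_hist] by simp
  qed
  finally have "expectation h = 1" by simp
  moreover have le: "AE \<omega> in M. 0 \<le> 1 - h \<omega>"
    using AE_valid
  proof eventually_elim
    case (elim \<omega>)
    show ?case
    proof (cases "\<exists>f\<in>RE.wf_hist n. refs_follow n f \<omega>")
      case True
      then obtain f where "f \<in> RE.wf_hist n" "refs_follow n f \<omega>" by blast
      then show ?thesis unfolding h_def by (subst sum_refs_follow[OF elim, where h = "\<lambda>_. 1"]) auto
    next
      case False
      then have "h \<omega> = 0" unfolding h_def by (intro sum.neutral) auto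
      then show ?thesis by simp
    qed
  qed
  ultimately have "expectation (\<lambda>\<omega>. 1 - h \<omega>) = 0" using inth by (simp add: prob_space)
  then have "AE \<omega> in M. 1 - h \<omega> = 0"
    using integral_nonneg_eq_0_iff_AE[of M "\<lambda>\<omega>. 1 - h \<omega>"] inth le by simp
  then show ?thesis
  proof eventually_elim
    case (elim \<omega>)
    show ?case
    proof (rule ccontr)
      assume "\<not> ?case"
      then have "h \<omega> = 0" unfolding h_def by (intro sum.neutral) auto
      then show False using elim by simp
    qed
  qed
qed

text \<open>Almost every outcome follows exactly one well-formed history, so \<open>G\<close> is
  almost surely a finite sum over histories of functions of the environment, and
  \<open>integral_refs_follow\<close> evaluates each term.\<close>

lemma expectation_annealed:
  fixes F :: "(nat \<Rightarrow> nat list) \<Rightarrow> 'n env \<Rightarrow> real"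
  assumes F: "\<And>f. F f \<in> borel_measurable RE.S" "\<And>f z. f \<in> RE.wf_hist n \<Longrightarrow> \<bar>F f z\<bar> \<le> b"
    and G: "G \<in> borel_measurable M"
    and eq: "\<And>\<omega> f. valid \<omega> \<Longrightarrow> f \<in> RE.wf_hist n \<Longrightarrow> refs_follow n f \<omega> \<Longrightarrow> G \<omega> = F f (env \<omega>)"
  shows "expectation G = RE.annealed n F"
proof -
  have int: "integrable M (\<lambda>\<omega>. indicator {\<omega>. refs_follow n f \<omega>} \<omega> * F f (env \<omega>))" if "f \<in> RE.wf_hist n" for f
    by (rule integrable_refs_follow[where h = "F f", OF F(1) F(2)[OF that]])
  have "expectation G = expectation (\<lambda>\<omega>. \<Sum>f\<in>RE.wf_hist n. indicator {\<omega>. refs_follow n f \<omega>} \<omega> * F f (env \<omega>))"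
  proof (rule integral_cong_AE[OF G])
    show "(\<lambda>\<omega>. \<Sum>f\<in>RE.wf_hist n. indicator {\<omega>. refs_follow n f \<omega>} \<omega> * F f (env \<omega>)) \<in> borel_measurable M"
      by (intro borel_measurable_sum borel_measurable_integrable int)
    show "AE \<omega> in M. G \<omega> = (\<Sum>f\<in>RE.wf_hist n. indicator {\<omega>. refs_follow n f \<omega>} \<omega> * F f (env \<omega>))"
      using AE_valid AE_refs_follow[of n]
    proof eventually_elim
      case (elim \<omega>)
      then obtain f where f: "f \<in> RE.wf_hist n" "refs_follow n f \<omega>" by blast
      show ?case using sum_refs_follow[OF elim(1) f, of "\<lambda>f. F f (env \<omega>)"] eq[OF elim(1) f] by simp
    qed
  qed
  also have "\<dots> = (\<Sum>f\<in>RE.wf_hist n. expectation (\<lambda>\<omega>. indicator {\<omega>. refs_follow n f \<omega>} \<omega> * F f (env \<omega>)))"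
    by (rule Bochner_Integration.integral_sum[OF int])
  also have "\<dots> = (\<Sum>f\<in>RE.wf_hist n. \<integral>z. F f z * pmf (RE.hist_law z n) f \<partial>RE.S)"
    by (intro sum.cong refl integral_refs_follow F(1))
  also have "\<dots> = (\<integral>z. (\<Sum>f\<in>RE.wf_hist n. F f z * pmf (RE.hist_law z n) f) \<partial>RE.S)"
  proof (rule Bochner_Integration.integral_sum[symmetric])
    fix f assume f: "f \<in> RE.wf_hist n"
    show "integrable RE.S (\<lambda>z. F f z * pmf (RE.hist_law z n) f)"
    proof (rule RE.integrable_bounded[where b = b])
      show "(\<lambda>z. F f z * pmf (RE.hist_law z n) f) \<in> borel_measurable RE.S"
        by (intro borel_measurable_times F(1) RE.measurable_pmf_hist_law)
      fix z :: "'n env"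
      have "\<bar>F f z\<bar> * pmf (RE.hist_law z n) f \<le> b * 1"
        using order_trans[OF abs_ge_zero F(2)[OF f]] by (intro mult_mono F(2)[OF f] pmf_le_1) auto
      then show "\<bar>F f z * pmf (RE.hist_law z n) f\<bar> \<le> b" by (simp add: abs_mult)
    qed
  qed
  finally show ?thesis by (simp add: RE.annealed_def RE.expectation_hist_law_sum)
qed

lemma measurable_block_at_eq: "Measurable.pred M (\<lambda>\<omega>. block_at \<omega> i = block_at \<omega> j)"
proof (cases "i = 0 \<or> j = 0")
  case True
  then have "block_at \<omega> i = block_at \<omega> j \<longleftrightarrow> i = 0 \<and> j = 0" for \<omega> by (auto simp: block_at_def)
  then show ?thesis by simp
next
  case False
  then have [measurable]: "bid i \<in> borel_measurable M" "bid j \<in> borel_measurable M" by (auto intro: measurable_bid)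
  have "Measurable.pred M (\<lambda>\<omega>. bid i \<omega> = bid j \<omega>)" by measurable
  then show ?thesis using False by (simp add: block_at_def)
qed

lemma measurable_block_at_in_ref:
  assumes "1 \<le> m"
  shows "Measurable.pred M (\<lambda>\<omega>. block_at \<omega> j \<in> set (ref m \<omega>))"
proof -
  have "Measurable.pred M (\<lambda>\<omega>. i < length (ref m \<omega>) \<and> ref m \<omega> ! i = block_at \<omega> j)" for i
    by (rule measurable_nth_block_at[OF ref_measurable[OF assms]]) (rule measurable_bid)
  then have "Measurable.pred M (\<lambda>\<omega>. \<exists>i. i < length (ref m \<omega>) \<and> ref m \<omega> ! i = block_at \<omega> j)"
    by measurable
  then show ?thesis by (simp add: in_set_conv_nth)
qed

lemma measurable_arrived: "Measurable.pred M (\<lambda>\<omega>. m \<in> arrived a N n \<omega>)"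
proof (cases "m \<in> {1..N}")
  case True
  then have [measurable]: "delay m \<in> borel_measurable M" by (intro measurable_delay) simp
  show ?thesis
  proof (cases a)
    case (Some i)
    have "(\<lambda>\<omega>. delay m \<omega> $ i) \<in> borel_measurable M"
      by (rule measurable_compose[OF \<open>delay m \<in> borel_measurable M\<close> RE.measurable_vec_nth])
    then have "Measurable.pred M (\<lambda>\<omega>. t m \<omega> + delay m \<omega> $ i \<le> t n \<omega>)" by measurable
    moreover have "m \<in> arrived a N n \<omega> \<longleftrightarrow> t m \<omega> + delay m \<omega> $ i \<le> t n \<omega>" for \<omega>
      unfolding arrived_def Some option.case using True by blast
    ultimately show ?thesis by simp
  next
    case None
    have "m \<in> arrived a N n \<omega>" for \<omega> unfolding arrived_def None option.case using True by blast
    then show ?thesis by simp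
  qed
next
  case False
  then have "m \<notin> arrived a N n \<omega>" for \<omega> unfolding arrived_def by blast
  then show ?thesis by simp
qed

text \<open>Where identifiers collide, a block is counted through the first index that carries its identifier.\<close>

lemma pool_card_sum:
  "pool_card a n \<omega> = (\<Sum>j\<in>{..n}. of_bool (j \<in> insert 0 (arrived a n n \<omega>) \<and>
      (\<forall>i\<in>{..<j}. i \<in> insert 0 (arrived a n n \<omega>) \<longrightarrow> block_at \<omega> i \<noteq> block_at \<omega> j) \<and>
      (\<forall>m\<in>{1..n}. m \<in> arrived a n n \<omega> \<longrightarrow> block_at \<omega> j \<notin> set (ref m \<omega>))))"
proof -
  define V where "V = arrived a n n \<omega>"
  have V: "V \<subseteq> {1..n}" by (auto simp: V_def arrived_def)
  define F where "F = {j. j \<in> insert 0 V \<and> (\<forall>i\<in>{..<j}. i \<in> insert 0 V \<longrightarrow> block_at \<omega> i \<noteq> block_at \<omega> j) \<and>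
      (\<forall>m\<in>{1..n}. m \<in> V \<longrightarrow> block_at \<omega> j \<notin> set (ref m \<omega>))}"
  have FN: "F \<subseteq> {..n}" using V by (auto simp: F_def)
  have inj: "inj_on (block_at \<omega>) F"
  proof (rule inj_onI)
    fix i j assume ij: "i \<in> F" "j \<in> F" "block_at \<omega> i = block_at \<omega> j"
    show "i = j"
    proof (rule linorder_cases[of i j])
      assume "i < j"
      then show ?thesis using ij by (auto simp: F_def)
    next
      assume "j < i"
      then show ?thesis using ij by (auto simp: F_def)
    qed
  qed
  have "tips bid ref V \<omega> = block_at \<omega> ` F"
  proof (intro equalityI subsetI)
    fix x assume "x \<in> tips bid ref V \<omega>"
    moreover have "V \<subseteq> {1..}" using V by auto
    ultimately have x: "x \<in> block_at \<omega> ` insert 0 V" "\<forall>m\<in>V. x \<notin> set (ref m \<omega>)" by (auto simp: tips_eq)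
    then obtain j where j: "j \<in> insert 0 V \<and> block_at \<omega> j = x" by auto
    define i where "i = (LEAST j. j \<in> insert 0 V \<and> block_at \<omega> j = x)"
    have i: "i \<in> insert 0 V \<and> block_at \<omega> i = x"
      unfolding i_def by (rule LeastI[where P = "\<lambda>j. j \<in> insert 0 V \<and> block_at \<omega> j = x", OF j])
    have "\<forall>i'\<in>{..<i}. i' \<in> insert 0 V \<longrightarrow> block_at \<omega> i' \<noteq> block_at \<omega> i"
      using i not_less_Least[where P = "\<lambda>j. j \<in> insert 0 V \<and> block_at \<omega> j = x"] unfolding i_def[symmetric] by blast
    then have "i \<in> F" using i x(2) by (auto simp: F_def)
    then show "x \<in> block_at \<omega> ` F" using i by blast
  next
    fix x assume "x \<in> block_at \<omega> ` F"
    moreover have "V \<subseteq> {1..}" using V by auto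
    ultimately show "x \<in> tips bid ref V \<omega>" using V by (auto simp: tips_eq F_def)
  qed
  then have "pool_card a n \<omega> = card F" by (simp add: pool_card_def V_def[symmetric] card_image[OF inj])
  also have "\<dots> = (\<Sum>j\<in>{..n}. of_bool (j \<in> F))"
    using FN by (simp add: of_bool_def sum.If_cases Int_absorb1)
  finally show ?thesis by (simp add: F_def V_def)
qed

lemma measurable_pool_card [measurable]: "pool_card a n \<in> measurable M (count_space UNIV)"
proof -
  have [measurable]: "Measurable.pred M (\<lambda>\<omega>. j \<in> insert 0 (arrived a n n \<omega>))" for j
    using measurable_arrived[of j a n n] by (cases "j = 0") auto
  have 1: "Measurable.pred M (\<lambda>\<omega>. \<forall>i\<in>{..<j}. i \<in> insert 0 (arrived a n n \<omega>) \<longrightarrow> block_at \<omega> i \<noteq> block_at \<omega> j)" for j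
    using measurable_block_at_eq by (intro pred_intros_finite) measurable
  have 2: "Measurable.pred M (\<lambda>\<omega>. \<forall>m\<in>{1..n}. m \<in> arrived a n n \<omega> \<longrightarrow> block_at \<omega> j \<notin> set (ref m \<omega>))" for j
  proof (intro pred_intros_finite)
    fix m assume "m \<in> {1..n}"
    then have "Measurable.pred M (\<lambda>\<omega>. block_at \<omega> j \<in> set (ref m \<omega>))" by (intro measurable_block_at_in_ref) simp
    then show "Measurable.pred M (\<lambda>\<omega>. m \<in> arrived a n n \<omega> \<longrightarrow> block_at \<omega> j \<notin> set (ref m \<omega>))"
      using measurable_arrived[of m a n n] by measurable
  qed simp
  have "(\<lambda>\<omega>. \<Sum>j\<in>{..n}. of_bool (j \<in> insert 0 (arrived a n n \<omega>) \<and>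
      (\<forall>i\<in>{..<j}. i \<in> insert 0 (arrived a n n \<omega>) \<longrightarrow> block_at \<omega> i \<noteq> block_at \<omega> j) \<and>
      (\<forall>m\<in>{1..n}. m \<in> arrived a n n \<omega> \<longrightarrow> block_at \<omega> j \<notin> set (ref m \<omega>))) :: nat) \<in> measurable M (count_space UNIV)"
    using 1 2 by measurable
  then show ?thesis unfolding pool_card_sum[symmetric] .
qed

lemma pool_card_le: "pool_card a n \<omega> \<le> Suc n"
proof -
  have "pool_card a n \<omega> \<le> (\<Sum>j\<in>{..n}. 1)" unfolding pool_card_sum by (intro sum_mono) auto
  then show ?thesis by simp
qed

lemma expectation_pool_card:
  assumes "\<And>x. \<bar>\<phi> x\<bar> \<le> b"
  shows "expectation (\<lambda>\<omega>. \<phi> (pool_card a n \<omega>)) = RE.annealed n (\<lambda>f z. \<phi> (RE.pool_size z f n a))"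
proof (rule expectation_annealed[where b = b])
  show "(\<lambda>\<omega>. \<phi> (pool_card a n \<omega>)) \<in> borel_measurable M"
    by (rule measurable_compose[OF measurable_pool_card]) simp
  show "(\<lambda>z. \<phi> (RE.pool_size z f n a)) \<in> borel_measurable RE.S" for f
    by (rule measurable_compose[OF RE.measurable_pool_size]) simp
qed (auto simp: assms pool_card_env)

lemma refs_follow_mono: "refs_follow n f \<omega> \<Longrightarrow> s \<le> n \<Longrightarrow> refs_follow s f \<omega>"
  by (auto simp: refs_follow_def)

lemma expectation_pool_card_mult:
  assumes phi: "\<And>x. \<bar>\<phi> x\<bar> \<le> b" and s: "s \<le> n"
  shows "expectation (\<lambda>\<omega>. \<phi> (pool_card a s \<omega>) * \<phi> (pool_card a n \<omega>)) =
    RE.annealed n (\<lambda>f z. \<phi> (RE.pool_size z f s a) * \<phi> (RE.pool_size z f n a))"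
proof (rule expectation_annealed[where b = "b * b"])
  have 1: "(\<lambda>\<omega>. \<phi> (pool_card a n \<omega>)) \<in> borel_measurable M" for n
    by (rule measurable_compose[OF measurable_pool_card]) simp
  have 2: "(\<lambda>z. \<phi> (RE.pool_size z f n a)) \<in> borel_measurable RE.S" for f n
    by (rule measurable_compose[OF RE.measurable_pool_size]) simp
  show "(\<lambda>\<omega>. \<phi> (pool_card a s \<omega>) * \<phi> (pool_card a n \<omega>)) \<in> borel_measurable M"
    by (intro borel_measurable_times 1)
  show "(\<lambda>z. \<phi> (RE.pool_size z f s a) * \<phi> (RE.pool_size z f n a)) \<in> borel_measurable RE.S" for f
    by (intro borel_measurable_times 2)
  show "\<bar>\<phi> (RE.pool_size z f s a) * \<phi> (RE.pool_size z f n a)\<bar> \<le> b * b" for f and z :: "'n env"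
    unfolding abs_mult by (intro mult_mono phi order_trans[OF abs_ge_zero phi]) auto
  show "\<phi> (pool_card a s \<omega>) * \<phi> (pool_card a n \<omega>) = \<phi> (RE.pool_size (env \<omega>) f s a) * \<phi> (RE.pool_size (env \<omega>) f n a)"
    if "valid \<omega>" "refs_follow n f \<omega>" for \<omega> f
    using that by (simp add: pool_card_env[OF _ refs_follow_mono[OF _ s]] pool_card_env)
qed

lemma fourth_moment:
  obtains C where "\<And>n a. expectation (\<lambda>\<omega>. real (pool_card a n \<omega>) ^ 4) \<le> C"
proof -
  obtain C where C: "\<And>n a. RE.annealed n (\<lambda>f z. real (RE.pool_size z f n a) ^ 4) \<le> C"
    by (rule RE.fourth_moment_bound) blast
  have "expectation (\<lambda>\<omega>. real (pool_card a n \<omega>) ^ 4) \<le> C" for n a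
  proof -
    \<comment> \<open>The transfer of expectations is available for bounded functions; capping at
      \<open>Suc n\<close> changes nothing, as neither pool size exceeds it.\<close>
    let ?\<phi> = "\<lambda>x. real (min x (Suc n)) ^ 4"
    have "expectation (\<lambda>\<omega>. real (pool_card a n \<omega>) ^ 4) = expectation (\<lambda>\<omega>. ?\<phi> (pool_card a n \<omega>))"
      by (simp add: min_absorb1 pool_card_le)
    also have "\<dots> = RE.annealed n (\<lambda>f z. ?\<phi> (RE.pool_size z f n a))"
      by (rule expectation_pool_card[where b = "real (Suc n) ^ 4"]) (auto intro!: power_mono)
    also have "\<dots> \<le> RE.annealed n (\<lambda>f z. real (RE.pool_size z f n a) ^ 4)"
    proof -
      have ps: "RE.pool_size z f n a \<le> Suc n" for f and z :: "'n env"
      proof -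
        have "card (idx_tips f (RE.seen z n n a)) \<le> card {..n}"
          by (intro card_mono) (auto simp: idx_tips_def RE.seen_def)
        then show ?thesis by (simp add: RE.pool_size_def)
      qed
      show ?thesis by (simp add: min_absorb1 ps)
    qed
    also have "\<dots> \<le> C" by (rule C)
    finally show ?thesis .
  qed
  then show thesis by (rule that)
qed

lemma pool_card_limits:
  obtains P :: "nat pmf" where "integrable (measure_pmf P) real"
    "weak_conv_m (\<lambda>n. distr M borel (\<lambda>\<omega>. real (pool_card a n \<omega>))) (distr (measure_pmf P) borel real)"
    "AE \<omega> in M. (\<lambda>n. (\<Sum>m=1..n. real (pool_card a m \<omega>)) / real n) \<longlonglongrightarrow> measure_pmf.expectation P real"
proof -
  obtain C where C: "\<And>n a. expectation (\<lambda>\<omega>. real (pool_card a n \<omega>) ^ 4) \<le> C"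
    by (rule fourth_moment) blast
  obtain K q A :: real where K: "0 < K" and q: "0 < q" "q < 1" and A: "1 < A" and
    cauchy: "\<And>l n n' \<phi> T a. 1 \<le> l \<Longrightarrow> A ^ l \<le> real n \<Longrightarrow> A ^ l \<le> real n' \<Longrightarrow> (\<And>x. \<bar>\<phi> x\<bar> \<le> T) \<Longrightarrow>
      \<bar>RE.annealed n (\<lambda>f z. \<phi> (RE.pool_size z f n a)) - RE.annealed n' (\<lambda>f z. \<phi> (RE.pool_size z f n' a))\<bar> \<le> K * T * q ^ l" and
    cov: "\<And>l s n \<phi> T a. 1 \<le> l \<Longrightarrow> s \<le> n \<Longrightarrow> A ^ l \<le> real (n - s) \<Longrightarrow> (\<And>x. \<bar>\<phi> x\<bar> \<le> T) \<Longrightarrow>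
      \<bar>RE.annealed n (\<lambda>f z. \<phi> (RE.pool_size z f s a) * \<phi> (RE.pool_size z f n a)) -
        RE.annealed s (\<lambda>f z. \<phi> (RE.pool_size z f s a)) * RE.annealed n (\<lambda>f z. \<phi> (RE.pool_size z f n a))\<bar> \<le> K * T^2 * q ^ l"
    by (rule RE.mixing) blast
  have meas: "(\<lambda>\<omega>. real (pool_card a n \<omega>)) \<in> borel_measurable M" for n
    by (rule measurable_compose[OF measurable_pool_card]) simp
  have int4: "integrable M (\<lambda>\<omega>. real (pool_card a n \<omega>) ^ 4)" for n
  proof (rule integrable_const_bound[where B = "real (Suc n) ^ 4"])
    show "AE \<omega> in M. norm (real (pool_card a n \<omega>) ^ 4) \<le> real (Suc n) ^ 4"
      using pool_card_le by (intro AE_I2) (simp add: power_mono del: of_nat_Suc)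
  qed (intro borel_measurable_power meas)
  interpret mixing_sequence M "\<lambda>n \<omega>. real (pool_card a n \<omega>)" C K q A
  proof (intro mixing_sequence.intro mixing_sequence_axioms.intro prob_space_axioms meas int4 C K q A)
    fix l s n and T :: real
    assume l: "1 \<le> l" and s: "s \<le> n" and gap: "A ^ l \<le> real (n - s)" and T: "0 < T"
    have phi: "\<bar>min T (real x)\<bar> \<le> T" for x :: nat using T by auto
    show "\<bar>expectation (\<lambda>\<omega>. min T (real (pool_card a s \<omega>)) * min T (real (pool_card a n \<omega>))) -
        expectation (\<lambda>\<omega>. min T (real (pool_card a s \<omega>))) * expectation (\<lambda>\<omega>. min T (real (pool_card a n \<omega>)))\<bar>
        \<le> K * T\<^sup>2 * q ^ l"
      using cov[of l s n "\<lambda>x. min T (real x)" T a, OF l s gap phi]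
      by (simp only: expectation_pool_card[where \<phi> = "\<lambda>x. min T (real x)", OF phi]
          expectation_pool_card_mult[where \<phi> = "\<lambda>x. min T (real x)", OF phi s])
  qed auto
  have conv: "convergent (\<lambda>n. prob {\<omega> \<in> space M. pool_card a n \<omega> = x})" for x
  proof -
    \<comment> \<open>A point mass is the mean of a bounded function, so the first mixing bound
      makes it a Cauchy sequence in \<open>n\<close>; no candidate for the limit has to be
      named.\<close>
    let ?\<phi> = "\<lambda>y. of_bool (y = x) :: real"
    have phi: "\<bar>?\<phi> y\<bar> \<le> 1" for y by simp
    have eq: "prob {\<omega> \<in> space M. pool_card a n \<omega> = x} = RE.annealed n (\<lambda>f z. ?\<phi> (RE.pool_size z f n a))" for n
    proof -
      have "prob {\<omega> \<in> space M. pool_card a n \<omega> = x} = expectation (indicator {\<omega> \<in> space M. pool_card a n \<omega> = x})"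
        unfolding Bochner_Integration.integral_indicator by (intro arg_cong[where f = prob]) auto
      also have "\<dots> = expectation (\<lambda>\<omega>. ?\<phi> (pool_card a n \<omega>))"
        by (intro Bochner_Integration.integral_cong) (auto simp: indicator_def)
      also have "\<dots> = RE.annealed n (\<lambda>f z. ?\<phi> (RE.pool_size z f n a))"
        by (rule expectation_pool_card[where \<phi> = ?\<phi>, OF phi])
      finally show ?thesis .
    qed
    have "Cauchy (\<lambda>n. prob {\<omega> \<in> space M. pool_card a n \<omega> = x})"
    proof (rule metric_CauchyI)
      fix e :: real assume e: "0 < e"
      have "(\<lambda>l. K * 1 * q ^ l) \<longlonglongrightarrow> K * 1 * 0" using q by (intro tendsto_intros LIMSEQ_power_zero) auto
      then have "\<forall>\<^sub>F l in sequentially. K * 1 * q ^ l < e" using e by (intro order_tendstoD(2)) auto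
      moreover have "\<forall>\<^sub>F l :: nat in sequentially. 1 \<le> l" by (rule eventually_ge_at_top)
      ultimately have "\<forall>\<^sub>F l in sequentially. K * 1 * q ^ l < e \<and> 1 \<le> l" by (rule eventually_conj)
      then obtain l where l: "K * 1 * q ^ l < e" "1 \<le> l" unfolding eventually_sequentially by blast
      obtain N :: nat where N: "A ^ l \<le> real N" using real_arch_simple by blast
      have "dist (prob {\<omega> \<in> space M. pool_card a m \<omega> = x}) (prob {\<omega> \<in> space M. pool_card a n \<omega> = x}) < e"
        if "N \<le> m" "N \<le> n" for m n
      proof -
        have "A ^ l \<le> real m" "A ^ l \<le> real n" using N that by auto
        from cauchy[of l m n ?\<phi> 1 a, OF l(2) this phi] l(1) show ?thesis
          unfolding dist_real_def eq by linarith
      qed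
      then show "\<exists>N. \<forall>m\<ge>N. \<forall>n\<ge>N. dist (prob {\<omega> \<in> space M. pool_card a m \<omega> = x}) (prob {\<omega> \<in> space M. pool_card a n \<omega> = x}) < e"
        by blast
    qed
    then show ?thesis by (rule Cauchy_convergent)
  qed
  obtain P :: "nat pmf" where P: "integrable (measure_pmf P) real"
    "(\<lambda>n. expectation (\<lambda>\<omega>. real (pool_card a n \<omega>))) \<longlonglongrightarrow> measure_pmf.expectation P real"
    "weak_conv_m (\<lambda>n. distr M borel (\<lambda>\<omega>. real (pool_card a n \<omega>))) (distr (measure_pmf P) borel real)"
    using limit_law[OF measurable_pool_card int4 C conv] by blast
  show thesis by (rule that[OF P(1,3) strong_law[OF P(2)]])
qed

end

section \<open>The limit variables on a common probability space\<close>

lemma distr_pmf_cong: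
  fixes f :: "'b \<Rightarrow> real" and g :: "'c \<Rightarrow> real"
  assumes "map_pmf f p = map_pmf g q"
  shows "distr (measure_pmf p) borel f = distr (measure_pmf q) borel g"
proof (rule measure_eqI)
  fix A assume "A \<in> sets (distr (measure_pmf p) borel f)"
  moreover have "emeasure (measure_pmf (map_pmf f p)) A = emeasure (measure_pmf (map_pmf g q)) A"
    using assms by simp
  ultimately show "emeasure (distr (measure_pmf p) borel f) A = emeasure (distr (measure_pmf q) borel g) A"
    by (simp add: emeasure_distr)
qed simp

theorem corollary3p9:
  fixes M :: "'a measure" and k :: nat and rate \<Delta> :: real
    and p :: "'n :: finite pmf" and D :: "'n \<Rightarrow> (real ^ 'n) measure"
    and t bid :: "nat \<Rightarrow> 'a \<Rightarrow> real" and issuer :: "nat \<Rightarrow> 'a \<Rightarrow> 'n"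
    and delay :: "nat \<Rightarrow> 'a \<Rightarrow> real ^ 'n" and ref :: "nat \<Rightarrow> 'a \<Rightarrow> block list"
  assumes "block_issuance M k rate \<Delta> p D t bid issuer delay ref"
  shows "\<exists>(Q :: (real \<times> (real ^ 'n)) measure) Xobs_inf Xloc_inf.
    prob_space Q \<and> integrable Q Xobs_inf \<and> (\<forall>i. integrable Q (Xloc_inf i)) \<and>
    weak_conv_m (\<lambda>n. distr M borel (Xobs bid ref n)) (distr Q borel Xobs_inf) \<and>
    (\<forall>i. weak_conv_m (\<lambda>n. distr M borel (Xloc t bid delay ref i n)) (distr Q borel (Xloc_inf i))) \<and>
    (AE \<omega> in M. (\<lambda>n. (\<Sum>m=1..n. Xobs bid ref m \<omega>) / real n) \<longlonglongrightarrow> integral\<^sup>L Q Xobs_inf) \<and>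
    (\<forall>i. AE \<omega> in M. (\<lambda>n. (\<Sum>m=1..n. Xloc t bid delay ref i m \<omega>) / real n) \<longlonglongrightarrow> integral\<^sup>L Q (Xloc_inf i))"
proof -
  interpret block_issuance M k rate \<Delta> p D t bid issuer delay ref by fact
  define limit_for where "limit_for a P \<longleftrightarrow> integrable (measure_pmf P) real \<and>
    weak_conv_m (\<lambda>n. distr M borel (\<lambda>\<omega>. real (pool_card a n \<omega>))) (distr (measure_pmf P) borel real) \<and>
    (AE \<omega> in M. (\<lambda>n. (\<Sum>m=1..n. real (pool_card a m \<omega>)) / real n) \<longlonglongrightarrow> measure_pmf.expectation P real)"
    for a and P :: "nat pmf"
  have "\<exists>P. limit_for a P" for a
    by (rule pool_card_limits[of a]) (auto simp: limit_for_def)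
  then have "\<exists>P. \<forall>a. limit_for a (P a)" by (intro choice allI)
  then obtain P where "\<forall>a. limit_for a (P a)" ..
  then have P: "integrable (measure_pmf (P a)) real"
    "weak_conv_m (\<lambda>n. distr M borel (\<lambda>\<omega>. real (pool_card a n \<omega>))) (distr (measure_pmf (P a)) borel real)"
    "AE \<omega> in M. (\<lambda>n. (\<Sum>m=1..n. real (pool_card a m \<omega>)) / real n) \<longlonglongrightarrow> measure_pmf.expectation (P a) real" for a
    by (simp_all add: limit_for_def)
  \<comment> \<open>Only the marginal laws are prescribed, so the limits may be taken independent: a
    finite product of the laws, carried over to the type of pairs required for \<open>Q\<close>. The
    default 0 of \<open>Pi_pmf\<close> never occurs, the index set being
    \<open>UNIV\<close>.\<close>
  define Q where "Q = map_pmf (\<lambda>g. (g None, \<chi> i. g (Some i))) (Pi_pmf UNIV 0 (\<lambda>a. map_pmf real (P a)))"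
  define X where "X a = (case a of None \<Rightarrow> fst | Some i \<Rightarrow> (\<lambda>z :: real \<times> (real ^ 'n). snd z $ i))" for a
  have law: "map_pmf (X a) Q = map_pmf real (P a)" for a
  proof -
    have "map_pmf (X a) Q = map_pmf (\<lambda>g. g a) (Pi_pmf UNIV 0 (\<lambda>a. map_pmf real (P a)))"
      unfolding Q_def map_pmf_comp by (intro map_pmf_cong refl) (auto simp: X_def split: option.splits)
    also have "\<dots> = map_pmf real (P a)" by (subst Pi_pmf_component) auto
    finally show ?thesis .
  qed
  have int: "integrable (measure_pmf Q) (X a)" for a
  proof -
    have "integrable (measure_pmf (map_pmf (X a) Q)) (\<lambda>x. x)" unfolding law using P(1)[of a] by simp
    then show ?thesis by simp
  qed
  have mean: "measure_pmf.expectation Q (X a) = measure_pmf.expectation (P a) real" for a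
  proof -
    have "measure_pmf.expectation (map_pmf (X a) Q) (\<lambda>x. x) = measure_pmf.expectation (P a) real"
      unfolding law by simp
    then show ?thesis by simp
  qed
  have weak: "weak_conv_m (\<lambda>n. distr M borel (\<lambda>\<omega>. real (pool_card a n \<omega>))) (distr (measure_pmf Q) borel (X a))" for a
    using P(2)[of a] by (simp only: distr_pmf_cong[OF law])
  have strong: "AE \<omega> in M. (\<lambda>n. (\<Sum>m=1..n. real (pool_card a m \<omega>)) / real n) \<longlonglongrightarrow> measure_pmf.expectation Q (X a)" for a
    unfolding mean by (rule P(3))
  have obs: "Xobs bid ref n = (\<lambda>\<omega>. real (pool_card None n \<omega>))" for n
    by (rule ext) (rule Xobs_pool_card)
  have loc: "Xloc t bid delay ref i n = (\<lambda>\<omega>. real (pool_card (Some i) n \<omega>))" for i n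
    by (rule ext) (rule Xloc_pool_card)
  show ?thesis
    unfolding obs loc
    by (intro exI[of _ "measure_pmf Q"] exI[of _ "X None"] exI[of _ "\<lambda>i. X (Some i)"] conjI allI
        measure_pmf.prob_space_axioms int weak strong)
qed

end
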